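(* Let $m\ge 2$ be an integer and let $S^{2m-1}=\{z\in\mathbb{C}^m : |z|=1\}$ with surface measure $\sigma$. Let $\Delta_{S^{2m-1}}$ denote the (nonnegative) Laplace–Beltrami operator on $S^{2m-1}$, and for $R>0$ let $S^0_R(\Delta_{S^{2m-1}})=\int_0^\infty \chi_{[0,R]}(\lambda)\, dE(\lambda)$ be its spectral projection onto $[0,R]$. Then for every $1<p<\infty$, $$\sup_{R>0}\|S^0_R(\Delta_{S^{2m-1}})\|_{H^p(S^{2m-1})\to L^p(S^{2m-1})}<\infty .$$ Moreover, there is a constant $C$ (depending only on $m$) such that $$\sigma\big(\{x\in S^{2m-1} : |S^0_R(\Delta_{S^{2m-1}})f(x)|>\lambda\}\big)\le C\,\frac{\|f\|_{H^1}}{\lambda}\qquad\text{for all }\lambda,R>0,\ f\in H^1(S^{2m-1}),$$ i.e. the operators $S^0_R(\Delta_{S^{2m-1}})$ are uniformly bounded from $H^1(S^{2m-1})$ to weak-$L^1(S^{2m-1})$.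
   Context: For a nonnegative self-adjoint operator $L=\int_0^\infty\lambda\,dE_L(\lambda)$ and $\delta\ge0$, $R>0$, the Riesz mean is $S^\delta_R(L)=\int_0^\infty S^\delta_R(\lambda)\,dE_L(\lambda)$ with $S^\delta_R(\lambda)=(1-\lambda/R)^\delta$ for $\lambda\le R$ and $0$ for $\lambda>R$ (so $S^0_R(\lambda)=\chi_{[0,R]}(\lambda)$). $B_m=\{z\in\mathbb{C}^m:|z|\le1\}$, $A(\partial B_m)$ is the set of continuous functions on $\partial B_m=S^{2m-1}$ that are restrictions of functions holomorphic in $B_m$ (continuous up to the boundary), and for $0<p<\infty$ the Hardy space $H^p(S^{2m-1})$ is the closure of $A(\partial B_m)$ in $L^p(S^{2m-1},\sigma)$. *)

theory Defs
  imports "HOL-Analysis.Analysis"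
begin

text \<open>Surface measure on S^(2m-1) (cone construction): sigma(A) = 2m * vol{t x : x in A, 0<t<=1}.\<close>
definition sphere_measure :: "(complex ^ 'm::finite) measure" where
  "sphere_measure =
     scale_measure (ennreal (real (2 * CARD('m))))
       (distr (restrict_space lborel (cball 0 1 - {0}))
              (restrict_space borel (sphere 0 1))
              (\<lambda>x. x /\<^sub>R norm x))"

definition in_Lp :: "real \<Rightarrow> (complex ^ 'm::finite \<Rightarrow> complex) \<Rightarrow> bool" where
  "in_Lp p f \<longleftrightarrow> f \<in> borel_measurable sphere_measure \<and>
      integrable sphere_measure (\<lambda>x. norm (f x) powr p)"

definition Lp_norm :: "real \<Rightarrow> (complex ^ 'm::finite \<Rightarrow> complex) \<Rightarrow> real" where
  "Lp_norm p f = (integral\<^sup>L sphere_measure (\<lambda>x. norm (f x) powr p)) powr (1 / p)"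

definition holo_on :: "(complex ^ 'm::finite) set \<Rightarrow> (complex ^ 'm \<Rightarrow> complex) \<Rightarrow> bool" where
  "holo_on U F \<longleftrightarrow> (\<forall>z\<in>U. \<exists>L. (F has_derivative L) (at z) \<and>
                        (\<forall>c v. L (c *s v) = c * L v))"

definition ball_algebra :: "(complex ^ 'm::finite \<Rightarrow> complex) set" where
  "ball_algebra = {g. continuous_on (sphere 0 1) g \<and>
      (\<exists>F. continuous_on (cball 0 1) F \<and> holo_on (ball 0 1) F \<and>
           (\<forall>x\<in>sphere 0 1. F x = g x))}"

definition hardy :: "real \<Rightarrow> (complex ^ 'm::finite \<Rightarrow> complex) set" where
  "hardy p = {f. in_Lp p f \<and>
      (\<forall>e>0. \<exists>g\<in>ball_algebra. Lp_norm p (\<lambda>x. f x - g x) < e)}"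

definition C2_on :: "(complex ^ 'm::finite) set \<Rightarrow> (complex ^ 'm \<Rightarrow> complex) \<Rightarrow> bool" where
  "C2_on U u \<longleftrightarrow> open U \<and> u differentiable_on U \<and>
     (\<forall>b\<in>Basis. (\<lambda>x. frechet_derivative u (at x) b) differentiable_on U) \<and>
     (\<forall>b\<in>Basis. \<forall>c\<in>Basis. continuous_on U
        (\<lambda>x. frechet_derivative (\<lambda>y. frechet_derivative u (at y) b) (at x) c))"

definition laplacian :: "(complex ^ 'm::finite \<Rightarrow> complex) \<Rightarrow> complex ^ 'm \<Rightarrow> complex" where
  "laplacian u x = (\<Sum>b\<in>Basis. frechet_derivative (\<lambda>y. frechet_derivative u (at y) b) (at x) b)"

text \<open>Nonnegative Laplace-Beltrami operator on the sphere: minus the Euclidean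
Laplacian of the degree-0 homogeneous extension, evaluated on the sphere.\<close>
definition laplace_beltrami :: "(complex ^ 'm::finite \<Rightarrow> complex) \<Rightarrow> complex ^ 'm \<Rightarrow> complex" where
  "laplace_beltrami Y x = - laplacian (\<lambda>y. Y (y /\<^sub>R norm y)) x"

definition LB_eigenfun :: "(complex ^ 'm::finite \<Rightarrow> complex) \<Rightarrow> real \<Rightarrow> bool" where
  "LB_eigenfun Y \<mu> \<longleftrightarrow> (\<forall>x. x \<notin> sphere 0 1 \<longrightarrow> Y x = 0) \<and>
     C2_on (- {0}) (\<lambda>y. Y (y /\<^sub>R norm y)) \<and>
     (\<forall>x\<in>sphere 0 1. laplace_beltrami Y x = complex_of_real \<mu> * Y x)"

text \<open>Range of the spectral projection chi_[0,R](Delta): span of eigenfunctions with eigenvalue in [0,R].\<close>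
definition spec_space :: "real \<Rightarrow> (complex ^ 'm::finite \<Rightarrow> complex) set" where
  "spec_space R = {g. \<exists>n (c :: nat \<Rightarrow> complex) Y \<mu>.
      (\<forall>i<n. 0 \<le> \<mu> i \<and> \<mu> i \<le> R \<and> LB_eigenfun (Y i) (\<mu> i)) \<and>
      g = (\<lambda>x. \<Sum>i<n. c i * Y i x)}"

text \<open>S^0_R(Delta) f: the (orthogonal) projection onto spec_space R, given by pairing
f against the (finite-dimensional) range; this makes sense for f in L^1.\<close>
definition riesz0 :: "real \<Rightarrow> (complex ^ 'm::finite \<Rightarrow> complex) \<Rightarrow> (complex ^ 'm \<Rightarrow> complex)" where
  "riesz0 R f = (THE g. g \<in> spec_space R \<and>
      (\<forall>Y\<in>spec_space R. integral\<^sup>L sphere_measure (\<lambda>x. f x * cnj (Y x)) =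
                        integral\<^sup>L sphere_measure (\<lambda>x. g x * cnj (Y x))))"

end

theory Submission
  imports Defs "HOL-Complex_Analysis.Complex_Analysis"
begin

text \<open>On Hardy spaces the spectral projection is a partial sum operator. A function \<open>F\<close> holomorphic in the
  ball is \<open>\<Sum>k. F\<^sub>k\<close> with \<open>F\<^sub>k\<close> a homogeneous holomorphic polynomial of degree \<open>k\<close>, whose restriction to the
  sphere is an eigenfunction with eigenvalue \<open>k (k + 2 m - 2)\<close>, so that \<open>S\<^sup>0\<^sub>R F = \<Sum>k\<le>N. F\<^sub>k\<close>. On the slice
  \<open>t \<mapsto> F (e\<^sup>i\<^sup>t z)\<close> this is the \<open>N\<close>-th partial sum of a Fourier series, hence the bounds follow from
  the one-dimensional ones by rotation invariance of the surface measure.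

  On the circle, \<open>e\<^sup>-\<^sup>i\<^sup>N\<^sup>t q = h = cnj a + b\<close> with analytic polynomials \<open>a\<close>, \<open>b\<close> such that \<open>|a|\<close> is the modulus
  of the partial sum of \<open>q\<close>. For suitable concave \<open>\<phi>\<close>, \<open>\<kappa>\<close> the function \<open>C \<phi>(|h|\<^sup>2) - \<kappa>(|a|\<^sup>2 + |b|\<^sup>2)\<close> is
  subharmonic, and the mean value inequality gives the theorem of M. Riesz for \<open>1 < p \<le> 2\<close> as well as
  Kolmogorov's weak type inequality; exponents \<open>p > 2\<close> are reached by doubling through the pair \<open>(- a\<^sup>2, b\<^sup>2)\<close>.\<close>

section \<open>Subharmonicity along pairs of analytic polynomials\<close>

text \<open>\<open>riesz0 R f\<close> is tested against all eigenfunctions with eigenvalue at most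
  \<open>R\<close>, in general a larger space than the span of holomorphic monomials. Identifying it
  with a partial sum therefore needs monomials of high degree to be orthogonal to every such
  eigenfunction. This symmetry of the Laplace-Beltrami operator is obtained in the ambient space, by
  integrating a divergence built from degree 0 homogeneous extensions, and is returned to the sphere
  by the cone construction of the measure. Uniformity in \<open>R\<close> comes from the circle
  estimates, whose constants do not depend on the degree \<open>N\<close> of truncation. They are
  proved for polynomials and reach Hardy functions by density: at fixed \<open>N\<close> truncation
  is continuous from L^1 to the sup norm, with a constant used for passing to the limit only. The
  weak type bound is routed through the integral of \<open>x\<^sup>2 / (1 + x\<^sup>2)\<close>,
  which dominates half of the indicator of \<open>x \<ge> 1\<close>. Its integrand is continuous, so
  it passes through subharmonicity, slice averages and limits just as a power does.\<close>

lemma circle_integral_mono: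
  fixes V Vs Vss Vt Vtt :: "real \<Rightarrow> real \<Rightarrow> real"
  assumes ds: "\<And>s t. ((\<lambda>s. V s t) has_real_derivative Vs s t) (at s)"
    and dss: "\<And>s t. ((\<lambda>s. Vs s t) has_real_derivative Vss s t) (at s)"
    and dt: "\<And>s t. ((\<lambda>t. V s t) has_real_derivative Vt s t) (at t)"
    and dtt: "\<And>s t. ((\<lambda>t. Vt s t) has_real_derivative Vtt s t) (at t)"
    and cs: "continuous_on UNIV (\<lambda>(s, t). Vs s t)"
    and css: "continuous_on UNIV (\<lambda>(s, t). Vss s t)"
    and periodic: "\<And>s. Vt s (2 * pi) = Vt s 0"
    and subharmonic: "\<And>s t. 0 \<le> Vss s t + Vtt s t"
    and bdd: "\<And>s t. s \<le> 0 \<Longrightarrow> V s t \<le> B"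
    and "s0 \<le> s1"
  shows "integral {0..2 * pi} (V s0) \<le> integral {0..2 * pi} (V s1)"
proof -
  define N where "N s = integral {0..2 * pi} (V s)" for s
  define N1 where "N1 s = integral {0..2 * pi} (Vs s)" for s
  define N2 where "N2 s = integral {0..2 * pi} (Vss s)" for s
  have contV: "continuous_on A (V s)" for s A
    using DERIV_continuous[OF dt] by (auto simp: continuous_on_eq_continuous_at intro!: continuous_at_imp_continuous_on)
  have contVs: "continuous_on A (Vs s)" for s A
    using continuous_on_compose2[OF cs, of A "\<lambda>t. (s, t)"] by (simp add: continuous_on_Pair)
  have contVss: "continuous_on A (Vss s)" for s A
    using continuous_on_compose2[OF css, of A "\<lambda>t. (s, t)"] by (simp add: continuous_on_Pair)
  have dN: "(N has_real_derivative N1 s) (at s)" for s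
    unfolding N_def N1_def
    using leibniz_rule_field_derivative[where U = UNIV and f = V and fx = Vs and a = 0 and b = "2*pi" and ?x0.0 = s]
    by (auto simp: ds intro!: integrable_continuous_real contV continuous_on_subset[OF cs])
  have dN1: "(N1 has_real_derivative N2 s) (at s)" for s
    unfolding N1_def N2_def
    using leibniz_rule_field_derivative[where U = UNIV and f = Vs and fx = Vss and a = 0 and b = "2*pi" and ?x0.0 = s]
    by (auto simp: dss intro!: integrable_continuous_real contVs continuous_on_subset[OF css])
  \<comment> \<open>By periodicity \<open>Vtt\<close> integrates to 0 over a period, so
    \<open>N2\<close> is also the integral of \<open>Vss + Vtt\<close>.\<close>
  have "0 \<le> N2 s" for s
  proof -
    have "(Vtt s has_integral (Vt s (2 * pi) - Vt s 0)) {0..2 * pi}"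
    proof (rule fundamental_theorem_of_calculus)
      fix t
      show "(Vt s has_vector_derivative Vtt s t) (at t within {0..2 * pi})"
        using dtt[of s t] unfolding has_real_derivative_iff_has_vector_derivative
        by (rule has_vector_derivative_at_within)
    qed simp
    moreover have "(Vss s has_integral N2 s) {0..2 * pi}"
      unfolding N2_def by (intro integrable_integral integrable_continuous_real contVss)
    ultimately have "((\<lambda>t. Vss s t + Vtt s t) has_integral N2 s + 0) {0..2 * pi}"
      using periodic by (auto dest: has_integral_add)
    then have "0 \<le> N2 s + 0"
      by (rule has_integral_nonneg) (rule subharmonic)
    then show ?thesis by simp
  qed
  then have N1_mono: "N1 s \<le> N1 s'" if "s \<le> s'" for s s'
    by (intro DERIV_nonneg_imp_nondecreasing[OF that]) (blast intro: dN1)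
  have N_bdd: "N s \<le> 2 * pi * B" if "s \<le> 0" for s
  proof -
    have "N s \<le> integral {0..2 * pi} (\<lambda>t. B)"
      unfolding N_def by (intro integral_le integrable_continuous_real contV) (auto simp: bdd that)
    then show ?thesis by simp
  qed
  \<comment> \<open>\<open>N\<close> is convex in \<open>s\<close>; a negative slope at one point
    would force at least linear growth to the left, against the upper bound for
    \<open>s \<le> 0\<close>.\<close>
  have "0 \<le> N1 s" for s
  proof (rule ccontr)
    assume neg: "\<not> 0 \<le> N1 s"
    have lower: "N s + (- N1 s) * y \<le> N (s - y)" if y: "0 < y" for y
    proof -
      obtain z where z: "s - y < z" "z < s" "N s - N (s - y) = (s - (s - y)) * N1 z"
        using MVT2[of "s - y" s N N1] dN y by auto
      then have "N s - N (s - y) \<le> y * N1 s"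
        using N1_mono[of z s] y by (auto intro: mult_left_mono)
      then show ?thesis by (simp add: algebra_simps)
    qed
    \<comment> \<open>The first two summands bring \<open>s - y\<close> below 0, the last one makes
      the linear gain exceed \<open>2 * pi * B\<close>.\<close>
    define y where "y = \<bar>s\<bar> + 1 + (\<bar>2 * pi * B\<bar> + \<bar>N s\<bar> + 1) / (- N1 s)"
    have "0 \<le> (\<bar>2 * pi * B\<bar> + \<bar>N s\<bar> + 1) / (- N1 s)"
      using neg by (intro divide_nonneg_pos) auto
    then have "0 < y" "s - y \<le> 0"
      unfolding y_def by linarith+
    have "(\<bar>2 * pi * B\<bar> + \<bar>N s\<bar> + 1) = (- N1 s) * ((\<bar>2 * pi * B\<bar> + \<bar>N s\<bar> + 1) / (- N1 s))"
      using neg by auto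
    also have "\<dots> \<le> (- N1 s) * y"
      using neg unfolding y_def by (intro mult_left_mono) auto
    finally have "2 * pi * B < N (s - y)"
      using lower[OF \<open>0 < y\<close>] by linarith
    then show False
      using N_bdd[OF \<open>s - y \<le> 0\<close>] by simp
  qed
  then have "N s0 \<le> N s1"
    by (intro DERIV_nonneg_imp_nondecreasing[OF \<open>s0 \<le> s1\<close>]) (blast intro: dN)
  then show ?thesis by (simp add: N_def)
qed

lemma norm_sq_derivs:
  fixes h h1 h2 :: "real \<Rightarrow> complex"
  assumes "\<And>s. (h has_vector_derivative h1 s) (at s)"
    and "\<And>s. (h1 has_vector_derivative h2 s) (at s)"
  shows "((\<lambda>s. (norm (h s))\<^sup>2) has_real_derivative 2 * (h s \<bullet> h1 s)) (at s)"
    and "((\<lambda>s. 2 * (h s \<bullet> h1 s)) has_real_derivative 2 * ((norm (h1 s))\<^sup>2 + h s \<bullet> h2 s)) (at s)"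
proof -
  note inner_deriv = bounded_bilinear.has_vector_derivative[OF bounded_bilinear_inner]
  show "((\<lambda>s. (norm (h s))\<^sup>2) has_real_derivative 2 * (h s \<bullet> h1 s)) (at s)"
    unfolding power2_norm_eq_inner has_real_derivative_iff_has_vector_derivative
    by (rule has_vector_derivative_eq_rhs[OF inner_deriv[OF assms(1) assms(1)]]) (simp add: inner_commute)
  have "((\<lambda>s. h s \<bullet> h1 s) has_real_derivative (norm (h1 s))\<^sup>2 + h s \<bullet> h2 s) (at s)"
    unfolding power2_norm_eq_inner has_real_derivative_iff_has_vector_derivative
    by (rule has_vector_derivative_eq_rhs[OF inner_deriv[OF assms(1) assms(2)]]) simp
  then show "((\<lambda>s. 2 * (h s \<bullet> h1 s)) has_real_derivative 2 * ((norm (h1 s))\<^sup>2 + h s \<bullet> h2 s)) (at s)"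
    by (rule DERIV_cmult)
qed

lemma compose_second_deriv:
  fixes X X1 X2 \<phi> \<phi>1 \<phi>2 :: "real \<Rightarrow> real"
  assumes "\<And>s. (X has_real_derivative X1 s) (at s)"
    and "\<And>s. (X1 has_real_derivative X2 s) (at s)"
    and "\<And>s. 0 \<le> X s"
    and "\<And>x. 0 \<le> x \<Longrightarrow> (\<phi> has_real_derivative \<phi>1 x) (at x)"
    and "\<And>x. 0 \<le> x \<Longrightarrow> (\<phi>1 has_real_derivative \<phi>2 x) (at x)"
  shows "((\<lambda>s. \<phi> (X s)) has_real_derivative \<phi>1 (X s) * X1 s) (at s)"
    and "((\<lambda>s. \<phi>1 (X s) * X1 s) has_real_derivative \<phi>2 (X s) * (X1 s)\<^sup>2 + \<phi>1 (X s) * X2 s) (at s)"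
proof -
  show "((\<lambda>s. \<phi> (X s)) has_real_derivative \<phi>1 (X s) * X1 s) (at s)"
    using DERIV_chain2[OF assms(4)[OF assms(3)] assms(1)] .
  have "((\<lambda>s. \<phi>1 (X s)) has_real_derivative \<phi>2 (X s) * X1 s) (at s)"
    using DERIV_chain2[OF assms(5)[OF assms(3)] assms(1)] .
  from DERIV_mult[OF this assms(2)]
  show "((\<lambda>s. \<phi>1 (X s) * X1 s) has_real_derivative \<phi>2 (X s) * (X1 s)\<^sup>2 + \<phi>1 (X s) * X2 s) (at s)"
    by (simp add: power2_eq_square algebra_simps)
qed

text \<open>A gradient bound: for \<open>h = cnj A + B\<close>, with \<open>u\<close>,
  \<open>v\<close> the derivatives of \<open>A\<close>, \<open>B\<close>, the two inner products are
  half the partial derivatives of \<open>|h|^2\<close> in \<open>s\<close> and \<open>t\<close>.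
  Cauchy-Schwarz for each, then the parallelogram law.\<close>

lemma inner_sq_add_inner_sq_le:
  fixes h u v :: complex
  shows "(h \<bullet> (cnj u + v))\<^sup>2 + (h \<bullet> (\<i> * (v - cnj u)))\<^sup>2 \<le> 2 * (norm h)\<^sup>2 * ((norm u)\<^sup>2 + (norm v)\<^sup>2)"
proof -
  have "(h \<bullet> w)\<^sup>2 \<le> (norm h)\<^sup>2 * (norm w)\<^sup>2" for w
    using Cauchy_Schwarz_ineq[of h w] by (simp add: power2_norm_eq_inner)
  then have "(h \<bullet> (cnj u + v))\<^sup>2 + (h \<bullet> (\<i> * (v - cnj u)))\<^sup>2
    \<le> (norm h)\<^sup>2 * (norm (cnj u + v))\<^sup>2 + (norm h)\<^sup>2 * (norm (\<i> * (v - cnj u)))\<^sup>2"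
    by (meson add_mono)
  also have "\<dots> = 2 * (norm h)\<^sup>2 * ((norm u)\<^sup>2 + (norm v)\<^sup>2)"
    by (simp add: norm_mult cmod_power2) (simp add: power2_eq_square algebra_simps)
  finally show ?thesis .
qed

text \<open>The expression is the Laplacian in \<open>w = s + i t\<close> of
  \<open>C \<phi>(|h|^2) - \<kappa>(|A|^2 + |B|^2)\<close>, where \<open>A1\<close>,
  \<open>A2\<close> and \<open>B1\<close>, \<open>B2\<close> are complex derivatives. Both arguments
  have Laplacian \<open>4 D\<close> with \<open>D = |A1|^2 + |B1|^2\<close>. As
  \<open>\<phi>2 \<le> 0\<close>, the bound \<open>8 x D\<close> for the squared gradient of
  \<open>|h|^2\<close> leaves at least \<open>4 D C (\<phi>1 + 2 x \<phi>2)\<close> from the first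
  term, and \<open>\<kappa>2 \<le> 0\<close> leaves at most \<open>4 D \<kappa>1\<close> to
  subtract.\<close>

lemma harmonic_pair_laplacian:
  fixes A B A1 B1 A2 B2 :: complex and \<phi>1 \<phi>2 \<kappa>1 \<kappa>2 C :: real
  defines "h \<equiv> cnj A + B"
    and "x \<equiv> (norm (cnj A + B))\<^sup>2" and "S \<equiv> (norm A)\<^sup>2 + (norm B)\<^sup>2"
  assumes "\<phi>2 \<le> 0" "\<kappa>2 \<le> 0" "0 \<le> C" "\<kappa>1 \<le> C * (\<phi>1 + 2 * x * \<phi>2)"
  shows "0 \<le> (C * (\<phi>2 * (2 * (h \<bullet> (cnj A1 + B1)))\<^sup>2 + \<phi>1 * (2 * ((norm (cnj A1 + B1))\<^sup>2 + h \<bullet> (cnj A2 + B2))))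
          - (\<kappa>2 * (2 * (A \<bullet> A1) + 2 * (B \<bullet> B1))\<^sup>2
             + \<kappa>1 * (2 * ((norm A1)\<^sup>2 + A \<bullet> A2) + 2 * ((norm B1)\<^sup>2 + B \<bullet> B2))))
        + (C * (\<phi>2 * (2 * (h \<bullet> (cnj (\<i> * A1) + \<i> * B1)))\<^sup>2 + \<phi>1 * (2 * ((norm (cnj (\<i> * A1) + \<i> * B1))\<^sup>2 + h \<bullet> (cnj (- A2) + - B2))))
          - (\<kappa>2 * (2 * (A \<bullet> (\<i> * A1)) + 2 * (B \<bullet> (\<i> * B1)))\<^sup>2
             + \<kappa>1 * (2 * ((norm (\<i> * A1))\<^sup>2 + A \<bullet> (- A2)) + 2 * ((norm (\<i> * B1))\<^sup>2 + B \<bullet> (- B2)))))"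
    (is "0 \<le> ?L")
proof -
  define D where "D = (norm A1)\<^sup>2 + (norm B1)\<^sup>2"
  define P where "P = (h \<bullet> (cnj A1 + B1))\<^sup>2 + (h \<bullet> (\<i> * (B1 - cnj A1)))\<^sup>2"
  have eq: "cnj (\<i> * A1) + \<i> * B1 = \<i> * (B1 - cnj A1)"
    by (simp add: algebra_simps)
  have parallelogram: "(norm (cnj A1 + B1))\<^sup>2 + (norm (\<i> * (B1 - cnj A1)))\<^sup>2 = 2 * D"
    unfolding D_def by (simp add: norm_mult cmod_power2) (simp add: power2_eq_square algebra_simps)
  have neg: "h \<bullet> (cnj (- A2) + - B2) = - (h \<bullet> (cnj A2 + B2))"
    by (metis add.inverse_distrib_swap add.commute complex_cnj_minus inner_minus_right)
  \<comment> \<open>Here \<open>j\<close>, \<open>k\<close>, \<open>l\<close> are the contributions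
    of the second complex derivatives; they enter with opposite signs in the \<open>s\<close> and
    \<open>t\<close> directions and cancel.\<close>
  have collect: "(C * (\<phi>2 * (2 * I)\<^sup>2 + \<phi>1 * (2 * (n1 + j))) - (\<kappa>2 * (2 * I')\<^sup>2 + \<kappa>1 * (2 * (m1 + k) + 2 * (m2 + l))))
        + (C * (\<phi>2 * (2 * J)\<^sup>2 + \<phi>1 * (2 * (n2 - j))) - (\<kappa>2 * (2 * J')\<^sup>2 + \<kappa>1 * (2 * (m1 - k) + 2 * (m2 - l))))
      = C * (4 * \<phi>2 * (I\<^sup>2 + J\<^sup>2) + 2 * \<phi>1 * (n1 + n2)) - (\<kappa>2 * ((2 * I')\<^sup>2 + (2 * J')\<^sup>2) + 4 * \<kappa>1 * (m1 + m2))"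
    for I J I' J' n1 n2 m1 m2 j k l :: real
    by (simp add: power2_eq_square algebra_simps)
  have "?L = C * (4 * \<phi>2 * P + 2 * \<phi>1 * ((norm (cnj A1 + B1))\<^sup>2 + (norm (\<i> * (B1 - cnj A1)))\<^sup>2))
        - (\<kappa>2 * ((2 * (A \<bullet> A1 + B \<bullet> B1))\<^sup>2 + (2 * (A \<bullet> (\<i> * A1) + B \<bullet> (\<i> * B1)))\<^sup>2)
          + 4 * \<kappa>1 * D)"
    unfolding eq neg P_def D_def collect[symmetric, where j = "h \<bullet> (cnj A2 + B2)" and k = "A \<bullet> A2" and l = "B \<bullet> B2"] inner_minus_right
    by (simp add: norm_mult)
  also have "\<dots> \<ge> C * (4 * \<phi>2 * (2 * x * D) + 4 * \<phi>1 * D) - 4 * \<kappa>1 * D"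
  proof -
    have "P \<le> 2 * x * D"
      using inner_sq_add_inner_sq_le[of h A1 B1] unfolding P_def D_def x_def h_def .
    then have "\<phi>2 * (2 * x * D) \<le> \<phi>2 * P"
      using \<open>\<phi>2 \<le> 0\<close> by (simp add: mult_left_mono_neg)
    then have "4 * \<phi>2 * (2 * x * D) + 4 * \<phi>1 * D \<le> 4 * \<phi>2 * P + 4 * \<phi>1 * D"
      unfolding mult.assoc by linarith
    then have "C * (4 * \<phi>2 * (2 * x * D) + 4 * \<phi>1 * D) \<le> C * (4 * \<phi>2 * P + 4 * \<phi>1 * D)"
      using \<open>0 \<le> C\<close> by (rule mult_left_mono)
    moreover have "\<kappa>2 * ((2 * (A \<bullet> A1 + B \<bullet> B1))\<^sup>2 + (2 * (A \<bullet> (\<i> * A1) + B \<bullet> (\<i> * B1)))\<^sup>2) \<le> 0"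
      using \<open>\<kappa>2 \<le> 0\<close> by (intro mult_nonpos_nonneg) auto
    ultimately show ?thesis
      unfolding parallelogram by (simp add: algebra_simps)
  qed
  moreover have "C * (4 * \<phi>2 * (2 * x * D) + 4 * \<phi>1 * D) - 4 * \<kappa>1 * D = 4 * D * (C * (\<phi>1 + 2 * x * \<phi>2) - \<kappa>1)"
    by (simp add: algebra_simps)
  moreover have "0 \<le> 4 * D * (C * (\<phi>1 + 2 * x * \<phi>2) - \<kappa>1)"
    using assms unfolding D_def by (intro mult_nonneg_nonneg) auto
  ultimately show ?thesis by linarith
qed

text \<open>The substitution \<open>z = exp w\<close> turns circles about 0 into vertical segments
  of length \<open>2 * pi\<close> and the punctured disc into the half plane
  \<open>s \<le> 0\<close>. The Laplacian is then a sum of two pure second derivatives, so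
  \<open>circle_integral_mono\<close> applies. The range \<open>x \<le> 2 * S\<close> in
  \<open>dominated\<close> reflects \<open>|cnj a + b|^2 \<le> 2 (|a|^2 + |b|^2)\<close>.\<close>

lemma harmonic_pair_submean:
  fixes \<phi> \<phi>1 \<phi>2 \<kappa> \<kappa>1 \<kappa>2 :: "real \<Rightarrow> real" and a b :: "complex poly"
  assumes d\<phi>: "\<And>x. 0 \<le> x \<Longrightarrow> (\<phi> has_real_derivative \<phi>1 x) (at x)"
      "\<And>x. 0 \<le> x \<Longrightarrow> (\<phi>1 has_real_derivative \<phi>2 x) (at x)" "continuous_on {0..} \<phi>2"
    and d\<kappa>: "\<And>x. 0 \<le> x \<Longrightarrow> (\<kappa> has_real_derivative \<kappa>1 x) (at x)"
      "\<And>x. 0 \<le> x \<Longrightarrow> (\<kappa>1 has_real_derivative \<kappa>2 x) (at x)" "continuous_on {0..} \<kappa>2"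
    and concave: "\<And>x. 0 \<le> x \<Longrightarrow> \<phi>2 x \<le> 0" "\<And>x. 0 \<le> x \<Longrightarrow> \<kappa>2 x \<le> 0"
    and "0 \<le> C"
    and dominated: "\<And>x S. 0 \<le> x \<Longrightarrow> x \<le> 2 * S \<Longrightarrow> \<kappa>1 S \<le> C * (\<phi>1 x + 2 * x * \<phi>2 x)"
  defines "W \<equiv> (\<lambda>z. C * \<phi> ((norm (cnj (poly a z) + poly b z))\<^sup>2) - \<kappa> ((norm (poly a z))\<^sup>2 + (norm (poly b z))\<^sup>2))"
  shows "2 * pi * W 0 \<le> integral {0..2 * pi} (\<lambda>t. W (cis t))"
proof -
  define A where "A w = poly a (exp w)" for w
  define A1 where "A1 w = exp w * poly (pderiv a) (exp w)" for w
  define A2 where "A2 w = exp w * poly (pderiv a) (exp w) + (exp w)\<^sup>2 * poly (pderiv (pderiv a)) (exp w)" for w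
  define B where "B w = poly b (exp w)" for w
  define B1 where "B1 w = exp w * poly (pderiv b) (exp w)" for w
  define B2 where "B2 w = exp w * poly (pderiv b) (exp w) + (exp w)\<^sup>2 * poly (pderiv (pderiv b)) (exp w)" for w
  have dA: "(A has_field_derivative A1 w) (at w)" "(A1 has_field_derivative A2 w) (at w)"
    and dB: "(B has_field_derivative B1 w) (at w)" "(B1 has_field_derivative B2 w) (at w)" for w
    unfolding A_def A1_def A2_def B_def B1_def B2_def
    by (auto intro!: derivative_eq_intros simp: power2_eq_square algebra_simps)
  have cont: "continuous_on UNIV A" "continuous_on UNIV A1" "continuous_on UNIV A2"
    "continuous_on UNIV B" "continuous_on UNIV B1" "continuous_on UNIV B2"
    unfolding A_def A1_def A2_def B_def B1_def B2_def by (intro continuous_intros)+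
  define P where "P s t = complex_of_real s + \<i> * complex_of_real t" for s t
  have ds: "((\<lambda>s. f (P s t)) has_vector_derivative f' (P s t)) (at s)"
    and dt: "((\<lambda>t. f (P s t)) has_vector_derivative \<i> * f' (P s t)) (at t)"
    if "\<And>w. (f has_field_derivative f' w) (at w)" for f f' s t
  proof -
    have "((\<lambda>s. P s t) has_vector_derivative 1) (at s)"
      unfolding P_def by (auto intro!: derivative_eq_intros)
    from field_vector_diff_chain_at[OF this that]
    show "((\<lambda>s. f (P s t)) has_vector_derivative f' (P s t)) (at s)" by (simp add: o_def)
    have "((\<lambda>t. P s t) has_vector_derivative \<i>) (at t)"
      unfolding P_def by (auto intro!: derivative_eq_intros simp: has_vector_derivative_mult_right)
    from field_vector_diff_chain_at[OF this that]
    show "((\<lambda>t. f (P s t)) has_vector_derivative \<i> * f' (P s t)) (at t)" by (simp add: o_def)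
  qed
  have cont_P: "continuous_on UNIV (\<lambda>(s, t). f (P s t))" if "continuous_on UNIV f" for f :: "complex \<Rightarrow> complex"
    using continuous_on_compose2[OF that, of UNIV "\<lambda>(s, t). P s t"]
    by (simp add: case_prod_unfold P_def continuous_intros)
  define h where "h s t = cnj (A (P s t)) + B (P s t)" for s t
  define X where "X s t = (norm (h s t))\<^sup>2" for s t
  define S where "S s t = (norm (A (P s t)))\<^sup>2 + (norm (B (P s t)))\<^sup>2" for s t
  define Xs where "Xs s t = 2 * (h s t \<bullet> (cnj (A1 (P s t)) + B1 (P s t)))" for s t
  define Xss where "Xss s t = 2 * ((norm (cnj (A1 (P s t)) + B1 (P s t)))\<^sup>2
       + h s t \<bullet> (cnj (A2 (P s t)) + B2 (P s t)))" for s t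
  define Xt where "Xt s t = 2 * (h s t \<bullet> (cnj (\<i> * A1 (P s t)) + \<i> * B1 (P s t)))" for s t
  define Xtt where "Xtt s t = 2 * ((norm (cnj (\<i> * A1 (P s t)) + \<i> * B1 (P s t)))\<^sup>2
       + h s t \<bullet> (cnj (- A2 (P s t)) + - B2 (P s t)))" for s t
  define Ss where "Ss s t = 2 * (A (P s t) \<bullet> A1 (P s t)) + 2 * (B (P s t) \<bullet> B1 (P s t))" for s t
  define Sss where "Sss s t = 2 * ((norm (A1 (P s t)))\<^sup>2 + A (P s t) \<bullet> A2 (P s t))
       + 2 * ((norm (B1 (P s t)))\<^sup>2 + B (P s t) \<bullet> B2 (P s t))" for s t
  define St where "St s t = 2 * (A (P s t) \<bullet> (\<i> * A1 (P s t))) + 2 * (B (P s t) \<bullet> (\<i> * B1 (P s t)))" for s t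
  define Stt where "Stt s t = 2 * ((norm (\<i> * A1 (P s t)))\<^sup>2 + A (P s t) \<bullet> (- A2 (P s t)))
       + 2 * ((norm (\<i> * B1 (P s t)))\<^sup>2 + B (P s t) \<bullet> (- B2 (P s t)))" for s t
  note dP = dA[THEN ds] dA[THEN dt] dB[THEN ds] dB[THEN dt]
  \<comment> \<open>Each derivative in \<open>t\<close> contributes a factor \<open>\<i>\<close>,
    hence the sign of the second one.\<close>
  have dt2: "((\<lambda>t. \<i> * f' (P s t)) has_vector_derivative - f'' (P s t)) (at t)"
    if "\<And>w. (f' has_field_derivative f'' w) (at w)" for f' f'' s t
    using has_vector_derivative_mult_right[OF dt[OF that], of \<i>] by simp
  note dP2 = dA(2)[THEN dt2] dB(2)[THEN dt2]
  have dX: "((\<lambda>s. X s t) has_real_derivative Xs s t) (at s)"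
      "((\<lambda>s. Xs s t) has_real_derivative Xss s t) (at s)"
      "((\<lambda>t. X s t) has_real_derivative Xt s t) (at t)"
      "((\<lambda>t. Xt s t) has_real_derivative Xtt s t) (at t)" for s t
    unfolding X_def Xs_def Xss_def Xt_def Xtt_def h_def
    by (rule norm_sq_derivs, (rule has_vector_derivative_add has_vector_derivative_cnj dP dP2)+)+
  have dS: "((\<lambda>s. S s t) has_real_derivative Ss s t) (at s)"
      "((\<lambda>s. Ss s t) has_real_derivative Sss s t) (at s)"
      "((\<lambda>t. S s t) has_real_derivative St s t) (at t)"
      "((\<lambda>t. St s t) has_real_derivative Stt s t) (at t)" for s t
    unfolding S_def Ss_def Sss_def St_def Stt_def
    by (rule DERIV_add, (rule norm_sq_derivs, (rule dP dP2)+)+)+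
  have pos: "0 \<le> X s t" "0 \<le> S s t" for s t
    by (auto simp: X_def S_def)
  define V where "V s t = C * \<phi> (X s t) - \<kappa> (S s t)" for s t
  define Vs where "Vs s t = C * (\<phi>1 (X s t) * Xs s t) - \<kappa>1 (S s t) * Ss s t" for s t
  define Vt where "Vt s t = C * (\<phi>1 (X s t) * Xt s t) - \<kappa>1 (S s t) * St s t" for s t
  define Vss where "Vss s t = C * (\<phi>2 (X s t) * (Xs s t)\<^sup>2 + \<phi>1 (X s t) * Xss s t)
       - (\<kappa>2 (S s t) * (Ss s t)\<^sup>2 + \<kappa>1 (S s t) * Sss s t)" for s t
  define Vtt where "Vtt s t = C * (\<phi>2 (X s t) * (Xt s t)\<^sup>2 + \<phi>1 (X s t) * Xtt s t)
       - (\<kappa>2 (S s t) * (St s t)\<^sup>2 + \<kappa>1 (S s t) * Stt s t)" for s t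
  have dV: "((\<lambda>s. V s t) has_real_derivative Vs s t) (at s)"
      "((\<lambda>s. Vs s t) has_real_derivative Vss s t) (at s)"
      "((\<lambda>t. V s t) has_real_derivative Vt s t) (at t)"
      "((\<lambda>t. Vt s t) has_real_derivative Vtt s t) (at t)" for s t
  proof -
    note Xs = compose_second_deriv[of "\<lambda>s. X s t" "\<lambda>s. Xs s t" "\<lambda>s. Xss s t", OF dX(1,2) pos(1) d\<phi>(1,2)]
      and Xt = compose_second_deriv[of "\<lambda>t. X s t" "\<lambda>t. Xt s t" "\<lambda>t. Xtt s t", OF dX(3,4) pos(1) d\<phi>(1,2)]
      and Ss = compose_second_deriv[of "\<lambda>s. S s t" "\<lambda>s. Ss s t" "\<lambda>s. Sss s t", OF dS(1,2) pos(2) d\<kappa>(1,2)]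
      and St = compose_second_deriv[of "\<lambda>t. S s t" "\<lambda>t. St s t" "\<lambda>t. Stt s t", OF dS(3,4) pos(2) d\<kappa>(1,2)]
    show "((\<lambda>s. V s t) has_real_derivative Vs s t) (at s)"
      unfolding V_def Vs_def by (rule DERIV_diff[OF DERIV_cmult[OF Xs(1)] Ss(1)])
    show "((\<lambda>s. Vs s t) has_real_derivative Vss s t) (at s)"
      unfolding Vs_def Vss_def by (rule DERIV_diff[OF DERIV_cmult[OF Xs(2)] Ss(2)])
    show "((\<lambda>t. V s t) has_real_derivative Vt s t) (at t)"
      unfolding V_def Vt_def by (rule DERIV_diff[OF DERIV_cmult[OF Xt(1)] St(1)])
    show "((\<lambda>t. Vt s t) has_real_derivative Vtt s t) (at t)"
      unfolding Vt_def Vtt_def by (rule DERIV_diff[OF DERIV_cmult[OF Xt(2)] St(2)])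
  qed
  have cont_nonneg: "continuous_on {0..} \<phi>" "continuous_on {0..} \<phi>1" "continuous_on {0..} \<kappa>" "continuous_on {0..} \<kappa>1"
    using d\<phi>(1,2) d\<kappa>(1,2) by (auto intro!: continuous_at_imp_continuous_on DERIV_continuous)
  note cont_P' = cont[THEN cont_P, unfolded case_prod_unfold]
  have cX: "continuous_on UNIV (\<lambda>p. X (fst p) (snd p))" "continuous_on UNIV (\<lambda>p. S (fst p) (snd p))"
    "continuous_on UNIV (\<lambda>p. Xs (fst p) (snd p))" "continuous_on UNIV (\<lambda>p. Ss (fst p) (snd p))"
    "continuous_on UNIV (\<lambda>p. Xss (fst p) (snd p))" "continuous_on UNIV (\<lambda>p. Sss (fst p) (snd p))"
    unfolding X_def S_def Xs_def Ss_def Xss_def Sss_def h_def by (intro continuous_intros cont_P')+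
  have compX: "continuous_on UNIV (\<lambda>p. f (X (fst p) (snd p)))" if "continuous_on {0..} f" for f :: "real \<Rightarrow> real"
    by (rule continuous_on_compose2[OF that cX(1)]) (auto simp: pos)
  have compS: "continuous_on UNIV (\<lambda>p. f (S (fst p) (snd p)))" if "continuous_on {0..} f" for f :: "real \<Rightarrow> real"
    by (rule continuous_on_compose2[OF that cX(2)]) (auto simp: pos)
  have cV: "continuous_on UNIV (\<lambda>(s, t). Vs s t)" "continuous_on UNIV (\<lambda>(s, t). Vss s t)"
    unfolding Vs_def Vss_def case_prod_unfold
    by (intro continuous_on_diff continuous_on_add continuous_on_mult continuous_on_power continuous_on_const
        cX compX compS cont_nonneg d\<phi>(3) d\<kappa>(3))+
  have contW: "continuous_on UNIV W"
    unfolding W_def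
    by (intro continuous_on_diff continuous_on_mult continuous_on_const
        continuous_on_compose2[OF cont_nonneg(1), where s = UNIV] continuous_on_compose2[OF cont_nonneg(3), where s = UNIV])
      (auto intro!: continuous_intros)
  have V_W: "V s t = W (complex_of_real (exp s) * cis t)" for s t
  proof -
    have "exp (P s t) = complex_of_real (exp s) * cis t"
      by (simp only: P_def exp_add exp_of_real cis_conv_exp)
    then show ?thesis
      by (simp add: V_def W_def X_def S_def h_def A_def B_def)
  qed
  \<comment> \<open>Compactness of the closed disc supplies the upper bound as \<open>s\<close>
    tends to minus infinity.\<close>
  have "bounded (W ` cball 0 1)"
    using compact_continuous_image[OF continuous_on_subset[OF contW subset_UNIV] compact_cball]
    by (rule compact_imp_bounded)
  then obtain M where M: "\<And>z. z \<in> cball 0 1 \<Longrightarrow> norm (W z) \<le> M"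
    unfolding bounded_iff by blast
  have "integral {0..2 * pi} (V s) \<le> integral {0..2 * pi} (V 0)" if "s \<le> 0" for s
  proof (rule circle_integral_mono[OF dV cV _ _ _ that, of M])
    show "Vt s (2 * pi) = Vt s 0" for s
    proof -
      have "exp (P s (2 * pi)) = exp (P s 0)"
        by (simp add: P_def exp_add mult.commute)
      then show ?thesis
        by (simp add: Vt_def X_def S_def Xt_def St_def h_def A_def B_def A1_def B1_def)
    qed
    show "0 \<le> Vss s t + Vtt s t" for s t
      unfolding Vss_def Vtt_def Xs_def Xss_def Xt_def Xtt_def Ss_def Sss_def St_def Stt_def X_def S_def h_def
    proof (rule harmonic_pair_laplacian)
      define x where "x = (norm (cnj (A (P s t)) + B (P s t)))\<^sup>2"
      define S' where "S' = (norm (A (P s t)))\<^sup>2 + (norm (B (P s t)))\<^sup>2"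
      show "\<phi>2 ((norm (cnj (A (P s t)) + B (P s t)))\<^sup>2) \<le> 0"
        "\<kappa>2 ((norm (A (P s t)))\<^sup>2 + (norm (B (P s t)))\<^sup>2) \<le> 0" "0 \<le> C"
        using concave \<open>0 \<le> C\<close> by auto
      have "x \<le> (norm (cnj (A (P s t)) + B (P s t)))\<^sup>2 + (norm (cnj (A (P s t)) - B (P s t)))\<^sup>2"
        by (simp add: x_def)
      also have "\<dots> = 2 * S'"
        unfolding S'_def by (simp add: cmod_power2) (simp add: power2_eq_square algebra_simps)
      finally have "x \<le> 2 * S'" .
      then show "\<kappa>1 ((norm (A (P s t)))\<^sup>2 + (norm (B (P s t)))\<^sup>2)
         \<le> C * (\<phi>1 ((norm (cnj (A (P s t)) + B (P s t)))\<^sup>2)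
             + 2 * (norm (cnj (A (P s t)) + B (P s t)))\<^sup>2 * \<phi>2 ((norm (cnj (A (P s t)) + B (P s t)))\<^sup>2))"
        using dominated[of x S'] by (simp add: x_def S'_def)
    qed
    show "V s t \<le> M" if "s \<le> 0" for s t
    proof -
      have "complex_of_real (exp s) * cis t \<in> cball 0 1"
        using that by (simp add: norm_mult del: of_real_exp)
      then show ?thesis
        using M unfolding V_W real_norm_def by (meson abs_le_D1)
    qed
  qed
  then have W_le: "integral {0..2 * pi} (\<lambda>t. W (complex_of_real r * cis t)) \<le> integral {0..2 * pi} (\<lambda>t. W (cis t))"
    if "0 < r" "r \<le> 1" for r :: real
  proof -
    have "V (ln r) = (\<lambda>t. W (complex_of_real r * cis t))" "V 0 = (\<lambda>t. W (cis t))"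
      unfolding V_W using that by (auto simp del: of_real_exp)
    moreover have "ln r \<le> 0"
      using that by simp
    ultimately show ?thesis
      using \<open>\<And>s. s \<le> 0 \<Longrightarrow> integral {0..2 * pi} (V s) \<le> integral {0..2 * pi} (V 0)\<close> by metis
  qed
  \<comment> \<open>The logarithmic coordinate never reaches the centre, so the value there is
    obtained as a limit of circle means.\<close>
  have "continuous_on UNIV (\<lambda>(r, t). W (complex_of_real r * cis t))"
    using continuous_on_compose2[OF contW, of UNIV "\<lambda>(r, t). complex_of_real r * cis t"]
    by (simp add: case_prod_unfold continuous_intros)
  then have "continuous_on {0..1} (\<lambda>r. integral {0..2 * pi} (\<lambda>t. W (complex_of_real r * cis t)))"
    using integral_continuous_on_param[of "{0..1}" 0 "2 * pi" "\<lambda>r t. W (complex_of_real r * cis t)"]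
    by (simp add: continuous_on_subset)
  then have "((\<lambda>r. integral {0..2 * pi} (\<lambda>t. W (complex_of_real r * cis t)))
       \<longlongrightarrow> integral {0..2 * pi} (\<lambda>t. W (complex_of_real 0 * cis t))) (at 0 within {0..1})"
    unfolding continuous_on by (rule bspec) simp
  moreover have "\<forall>\<^sub>F r in at 0 within {0..1}. integral {0..2 * pi} (\<lambda>t. W (complex_of_real r * cis t))
      \<le> integral {0..2 * pi} (\<lambda>t. W (cis t))"
    unfolding eventually_at_filter by (rule always_eventually) (auto intro!: W_le)
  moreover have "at (0::real) within {0..1} \<noteq> bot"
    by (simp add: at_within_Icc_at_right)
  ultimately have "integral {0..2 * pi} (\<lambda>t. W (complex_of_real 0 * cis t)) \<le> integral {0..2 * pi} (\<lambda>t. W (cis t))"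
    by (rule tendsto_upperbound)
  then show ?thesis by simp
qed

section \<open>Partial sums on the circle\<close>

lemma integrable_comp_polys:
  fixes g :: "complex \<Rightarrow> complex \<Rightarrow> real"
  assumes "continuous_on UNIV (\<lambda>(u, v). g u v)"
  shows "(\<lambda>t. g (poly a (cis t)) (poly b (cis t))) integrable_on {0..2 * pi}"
proof (rule integrable_continuous_real)
  show "continuous_on {0..2 * pi} (\<lambda>t. g (poly a (cis t)) (poly b (cis t)))"
    using continuous_on_compose2[OF assms, of "{0..2 * pi}" "\<lambda>t. (poly a (cis t), poly b (cis t))"]
    by (simp add: continuous_intros)
qed

text \<open>Dividing by \<open>x + y\<close> reduces this to \<open>u \<le> u powr s\<close> on the
  unit interval.\<close>

lemma powr_subadditive:
  fixes x y s :: real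
  assumes "0 \<le> x" "0 \<le> y" "0 \<le> s" "s \<le> 1"
  shows "(x + y) powr s \<le> x powr s + y powr s"
proof (cases "x + y = 0")
  case False
  then have pos: "0 < x + y" using assms by simp
  have le: "u \<le> u powr s" if "0 \<le> u" "u \<le> 1" for u
    using powr_mono'[of s 1 u] assms that by simp
  have "1 = x / (x + y) + y / (x + y)"
    using False by (simp flip: add_divide_distrib)
  also have "\<dots> \<le> (x / (x + y)) powr s + (y / (x + y)) powr s"
    using assms pos by (intro add_mono le) auto
  also have "\<dots> = (x powr s + y powr s) / (x + y) powr s"
    using assms by (simp add: powr_divide add_divide_distrib)
  finally show ?thesis
    using pos by (simp add: field_simps)
qed (use assms in simp)

text \<open>Up to a unimodular constant \<open>b - cnj a\<close> is the conjugate function of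
  \<open>b + cnj a\<close>, the constant term being counted among the frequencies of
  \<open>cnj a\<close>. The choice is \<open>\<phi>(x) = (\<epsilon> + x)^(p/2)\<close> and
  \<open>\<kappa>(x) = \<phi>(2 x)\<close>, since
  \<open>|b - cnj a|^2 \<le> 2 (|a|^2 + |b|^2)\<close>; the shift \<open>\<epsilon>\<close> removes
  the singularity of the derivatives of \<open>x^(p/2)\<close> at 0. The constant is the quotient of
  the bound \<open>p (\<epsilon> + x)^(p/2 - 1)\<close> for \<open>\<kappa>1\<close> by the lower
  bound \<open>(p/2) (p - 1) (\<epsilon> + x)^(p/2 - 1)\<close> for
  \<open>\<phi>1 + 2 x \<phi>2\<close>.\<close>

lemma conjugate_function_Lp_le_2:
  fixes p :: real and a b :: "complex poly"
  assumes p: "1 < p" "p \<le> 2" and "poly b 0 = 0"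
  shows "integral {0..2 * pi} (\<lambda>t. norm (poly b (cis t) - cnj (poly a (cis t))) powr p)
       \<le> 2 / (p - 1) * integral {0..2 * pi} (\<lambda>t. norm (poly b (cis t) + cnj (poly a (cis t))) powr p)"
    (is "?V \<le> ?C * ?H")
proof -
  have "2 \<le> ?C"
    using p by (simp add: field_simps)
  have main: "?V \<le> ?C * ?H + ?C * (2 * pi) * e" if "0 < e" for e :: real
  proof -
    \<comment> \<open>Chosen so that the error \<open>\<epsilon> powr (p / 2)\<close> left by
      subadditivity is exactly \<open>e\<close>.\<close>
    define \<epsilon> where "\<epsilon> = e powr (2 / p)"
    have "0 < \<epsilon>" "\<epsilon> powr (p / 2) = e"
      using that p by (auto simp: \<epsilon>_def powr_powr)
    define \<phi> where "\<phi> x = (\<epsilon> + x) powr (p / 2)" for x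
    define \<phi>1 where "\<phi>1 x = p / 2 * (\<epsilon> + x) powr (p / 2 - 1)" for x
    define \<phi>2 where "\<phi>2 x = p / 2 * (p / 2 - 1) * (\<epsilon> + x) powr (p / 2 - 2)" for x
    define \<kappa> where "\<kappa> x = \<phi> (2 * x)" for x
    define \<kappa>1 where "\<kappa>1 x = 2 * \<phi>1 (2 * x)" for x
    define \<kappa>2 where "\<kappa>2 x = 4 * \<phi>2 (2 * x)" for x
    have d\<phi>: "(\<phi> has_real_derivative \<phi>1 x) (at x)" "(\<phi>1 has_real_derivative \<phi>2 x) (at x)" if "0 \<le> x" for x
      using that \<open>0 < \<epsilon>\<close> unfolding \<phi>_def \<phi>1_def \<phi>2_def by (auto intro!: derivative_eq_intros)
    have d\<kappa>: "(\<kappa> has_real_derivative \<kappa>1 x) (at x)" "(\<kappa>1 has_real_derivative \<kappa>2 x) (at x)" if "0 \<le> x" for x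
    proof -
      have lin: "((\<lambda>x. 2 * x) has_real_derivative 2) (at x)"
        by (auto intro!: derivative_eq_intros)
      show "(\<kappa> has_real_derivative \<kappa>1 x) (at x)"
        unfolding \<kappa>_def \<kappa>1_def using DERIV_chain2[OF d\<phi>(1) lin] that by (simp add: mult.commute)
      show "(\<kappa>1 has_real_derivative \<kappa>2 x) (at x)"
        unfolding \<kappa>1_def \<kappa>2_def using DERIV_cmult[OF DERIV_chain2[OF d\<phi>(2) lin], of 2] that by (simp add: mult.commute)
    qed
    have c\<phi>: "continuous_on {0..} \<phi>2" "continuous_on {0..} \<kappa>2"
      using \<open>0 < \<epsilon>\<close> unfolding \<phi>2_def \<kappa>2_def by (auto intro!: continuous_intros)
    have concave: "\<phi>2 x \<le> 0" "\<kappa>2 x \<le> 0" if "0 \<le> x" for x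
      using p by (auto simp: \<phi>2_def \<kappa>2_def mult_nonneg_nonpos mult_nonpos_nonneg)
    have dominated: "\<kappa>1 S \<le> ?C * (\<phi>1 x + 2 * x * \<phi>2 x)" if "0 \<le> x" "x \<le> 2 * S" for x S
    proof -
      have split: "(\<epsilon> + x) powr (p / 2 - 1) = (\<epsilon> + x) * (\<epsilon> + x) powr (p / 2 - 2)"
        using \<open>0 < \<epsilon>\<close> that powr_mult_base[of "\<epsilon> + x" "p / 2 - 2"] by simp
      have "\<kappa>1 S \<le> p * (\<epsilon> + x) powr (p / 2 - 1)"
        using p that \<open>0 < \<epsilon>\<close> powr_mono2'[of "1 - p / 2" "\<epsilon> + x" "\<epsilon> + 2 * S"]
        by (auto simp: \<kappa>1_def \<phi>1_def intro!: powr_mono2')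
      also have "\<dots> = ?C * (p / 2 * ((p - 1) * (\<epsilon> + x) * (\<epsilon> + x) powr (p / 2 - 2)))"
        using p by (simp add: split)
      also have "\<dots> \<le> ?C * (p / 2 * ((\<epsilon> + x + (p - 2) * x) * (\<epsilon> + x) powr (p / 2 - 2)))"
      proof -
        have "0 \<le> (2 - p) * \<epsilon>"
          using p \<open>0 < \<epsilon>\<close> by simp
        then have "(p - 1) * (\<epsilon> + x) \<le> \<epsilon> + x + (p - 2) * x"
          by (simp add: algebra_simps)
        then show ?thesis
          using p by (intro mult_left_mono mult_right_mono) auto
      qed
      also have "\<dots> = ?C * (\<phi>1 x + 2 * x * \<phi>2 x)"
      proof -
        have "p / 2 * ((\<epsilon> + x + (p - 2) * x) * P) = p / 2 * ((\<epsilon> + x) * P) + 2 * x * (p / 2 * (p / 2 - 1) * P)" for P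
          by (simp add: algebra_simps)
        then show ?thesis
          unfolding \<phi>1_def \<phi>2_def split by (simp only:)
      qed
      finally show ?thesis .
    qed
    have "0 \<le> ?C" using p by simp
    note submean = harmonic_pair_submean[OF d\<phi> c\<phi>(1) d\<kappa> c\<phi>(2) concave \<open>0 \<le> ?C\<close> dominated, of a b]
    \<comment> \<open>Since \<open>b\<close> vanishes at the centre, \<open>|h|^2\<close> and
      \<open>|a|^2 + |b|^2\<close> coincide there; this inequality makes the central value of the
      subharmonic function nonnegative.\<close>
    have at_0: "\<kappa> (y\<^sup>2) \<le> ?C * \<phi> (y\<^sup>2)" for y
    proof -
      have "\<kappa> (y\<^sup>2) \<le> (2 * (\<epsilon> + y\<^sup>2)) powr (p / 2)"
        unfolding \<kappa>_def \<phi>_def using p \<open>0 < \<epsilon>\<close> by (intro powr_mono2) auto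
      also have "\<dots> = 2 powr (p / 2) * \<phi> (y\<^sup>2)"
        unfolding \<phi>_def by (rule powr_mult)
      also have "\<dots> \<le> ?C * \<phi> (y\<^sup>2)"
      proof (rule mult_right_mono)
        have "2 powr (p / 2) \<le> (2::real) powr 1"
          using p by (intro powr_mono) auto
        then show "2 powr (p / 2) \<le> ?C"
          using \<open>2 \<le> ?C\<close> by simp
      qed (simp add: \<phi>_def)
      finally show ?thesis .
    qed
    have int\<phi>: "(\<lambda>t. \<phi> ((norm (cnj (poly a (cis t)) + poly b (cis t)))\<^sup>2)) integrable_on {0..2 * pi}"
      using p \<open>0 < \<epsilon>\<close> unfolding \<phi>_def
      by (intro integrable_comp_polys[where g = "\<lambda>u v. (\<epsilon> + (norm (cnj u + v))\<^sup>2) powr (p / 2)"])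
        (auto simp: case_prod_unfold intro!: continuous_intros, metis add_pos_nonneg less_irrefl zero_le_power2)
    have int\<kappa>: "(\<lambda>t. \<kappa> ((norm (poly a (cis t)))\<^sup>2 + (norm (poly b (cis t)))\<^sup>2)) integrable_on {0..2 * pi}"
      using p \<open>0 < \<epsilon>\<close> unfolding \<phi>_def \<kappa>_def
      by (intro integrable_comp_polys[where g = "\<lambda>u v. (\<epsilon> + 2 * ((norm u)\<^sup>2 + (norm v)\<^sup>2)) powr (p / 2)"])
        (auto simp: case_prod_unfold intro!: continuous_intros, smt (verit) zero_le_power2)
    have intH: "(\<lambda>t. norm (poly b (cis t) + cnj (poly a (cis t))) powr p) integrable_on {0..2 * pi}"
      using p by (intro integrable_comp_polys[where g = "\<lambda>u v. norm (v + cnj u) powr p"])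
        (auto simp: case_prod_unfold intro!: continuous_intros continuous_on_powr')
    have intV: "(\<lambda>t. norm (poly b (cis t) - cnj (poly a (cis t))) powr p) integrable_on {0..2 * pi}"
      using p by (intro integrable_comp_polys[where g = "\<lambda>u v. norm (v - cnj u) powr p"])
        (auto simp: case_prod_unfold intro!: continuous_intros continuous_on_powr')
    have powr_sq: "(y\<^sup>2) powr (p / 2) = y powr p" if "0 \<le> y" for y :: real
      using that by (cases "y = 0") (auto simp: powr_powr simp flip: powr_numeral)
    have "?V \<le> integral {0..2 * pi} (\<lambda>t. \<kappa> ((norm (poly a (cis t)))\<^sup>2 + (norm (poly b (cis t)))\<^sup>2))"
    proof (intro integral_le intV int\<kappa>)
      fix t
      define u where "u = poly a (cis t)"
      define v where "v = poly b (cis t)"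
      have "(norm (v - cnj u))\<^sup>2 \<le> (norm (v - cnj u))\<^sup>2 + (norm (v + cnj u))\<^sup>2" by simp
      also have "\<dots> = 2 * ((norm u)\<^sup>2 + (norm v)\<^sup>2)"
        by (simp add: cmod_power2) (simp add: power2_eq_square algebra_simps)
      finally have "(norm (v - cnj u))\<^sup>2 \<le> \<epsilon> + 2 * ((norm u)\<^sup>2 + (norm v)\<^sup>2)"
        using \<open>0 < \<epsilon>\<close> by simp
      then have "((norm (v - cnj u))\<^sup>2) powr (p / 2) \<le> \<kappa> ((norm u)\<^sup>2 + (norm v)\<^sup>2)"
        unfolding \<kappa>_def \<phi>_def using p by (intro powr_mono2) auto
      then show "norm (v - cnj u) powr p \<le> \<kappa> ((norm u)\<^sup>2 + (norm v)\<^sup>2)"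
        by (simp add: powr_sq)
    qed
    also have "\<dots> \<le> integral {0..2 * pi} (\<lambda>t. ?C * \<phi> ((norm (cnj (poly a (cis t)) + poly b (cis t)))\<^sup>2))"
    proof -
      have "0 \<le> 2 * pi * (?C * \<phi> ((norm (cnj (poly a 0) + poly b 0))\<^sup>2) - \<kappa> ((norm (poly a 0))\<^sup>2 + (norm (poly b 0))\<^sup>2))"
        using at_0[of "norm (poly a 0)"] \<open>poly b 0 = 0\<close> by simp
      also note submean
      also have "integral {0..2 * pi} (\<lambda>t. ?C * \<phi> ((norm (cnj (poly a (cis t)) + poly b (cis t)))\<^sup>2)
            - \<kappa> ((norm (poly a (cis t)))\<^sup>2 + (norm (poly b (cis t)))\<^sup>2))
         = integral {0..2 * pi} (\<lambda>t. ?C * \<phi> ((norm (cnj (poly a (cis t)) + poly b (cis t)))\<^sup>2))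
          - integral {0..2 * pi} (\<lambda>t. \<kappa> ((norm (poly a (cis t)))\<^sup>2 + (norm (poly b (cis t)))\<^sup>2))"
        by (intro integral_diff integrable_on_mult_right int\<phi> int\<kappa>)
      finally show ?thesis by simp
    qed
    also have "\<dots> = ?C * integral {0..2 * pi} (\<lambda>t. \<phi> ((norm (cnj (poly a (cis t)) + poly b (cis t)))\<^sup>2))"
      by (rule integral_mult_right)
    also have "\<dots> \<le> ?C * integral {0..2 * pi} (\<lambda>t. norm (poly b (cis t) + cnj (poly a (cis t))) powr p + e)"
    proof (intro mult_left_mono[OF _ \<open>0 \<le> ?C\<close>] integral_le int\<phi> integrable_add intH integrable_const_ivl)
      fix t
      define y where "y = norm (poly b (cis t) + cnj (poly a (cis t)))"
      have "(\<epsilon> + y\<^sup>2) powr (p / 2) \<le> \<epsilon> powr (p / 2) + (y\<^sup>2) powr (p / 2)"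
        using p \<open>0 < \<epsilon>\<close> by (intro powr_subadditive) auto
      then show "\<phi> ((norm (cnj (poly a (cis t)) + poly b (cis t)))\<^sup>2) \<le> norm (poly b (cis t) + cnj (poly a (cis t))) powr p + e"
        using \<open>\<epsilon> powr (p / 2) = e\<close> by (simp add: \<phi>_def y_def powr_sq add.commute)
    qed
    also have "\<dots> = ?C * (?H + 2 * pi * e)"
      using integral_add[OF intH integrable_const_ivl, of e] by simp
    finally show ?thesis by (simp add: algebra_simps)
  qed
  show ?thesis
  proof (rule field_le_epsilon)
    fix e :: real assume "0 < e"
    have "c * (e / c) = e" if "c \<noteq> 0" for c :: real
      using that by simp
    moreover have "?C * (2 * pi) \<noteq> 0"
      using p by simp
    ultimately have eq: "?C * (2 * pi) * (e / (?C * (2 * pi))) = e"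
      by blast
    have "0 < e / (?C * (2 * pi))"
      using p \<open>0 < e\<close> by simp
    then show "?V \<le> ?C * ?H + e"
      using main[of "e / (?C * (2 * pi))"] unfolding eq by simp
  qed
qed

text \<open>Put \<open>h = b + cnj a\<close> and \<open>v = b - cnj a\<close>. The pair
  \<open>(- a * a, b * b)\<close> has sum \<open>h v\<close> and difference \<open>w\<close> with
  \<open>v^2 = 2 w - h^2\<close>, so the bound at \<open>p\<close> for this pair controls the
  integral of \<open>|v|^(2 p)\<close> by those of \<open>|h v|^p\<close> and
  \<open>|h|^(2 p)\<close>. Starting from \<open>(1, 2]\<close>, doubling reaches every
  exponent.\<close>

lemma conjugate_function_Lp:
  fixes p :: real
  assumes "1 < p"
  shows "\<exists>C\<ge>0. \<forall>a b. poly b 0 = 0 \<longrightarrow>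
     integral {0..2 * pi} (\<lambda>t. norm (poly b (cis t) - cnj (poly a (cis t))) powr p)
       \<le> C * integral {0..2 * pi} (\<lambda>t. norm (poly b (cis t) + cnj (poly a (cis t))) powr p)"
proof -
  define St where "St p \<longleftrightarrow> (\<exists>C\<ge>0. \<forall>a b. poly b 0 = 0 \<longrightarrow>
     integral {0..2 * pi} (\<lambda>t. norm (poly b (cis t) - cnj (poly a (cis t))) powr p)
       \<le> C * integral {0..2 * pi} (\<lambda>t. norm (poly b (cis t) + cnj (poly a (cis t))) powr p))" for p
  have base: "St p" if "1 < p" "p \<le> 2" for p
    unfolding St_def using conjugate_function_Lp_le_2[OF that] that
    by (intro exI[of _ "2 / (p - 1)"]) auto
  have step: "St (2 * p)" if "1 < p" "St p" for p
  proof -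
    obtain C where "0 \<le> C" and C: "\<And>a b. poly b 0 = 0 \<Longrightarrow>
     integral {0..2 * pi} (\<lambda>t. norm (poly b (cis t) - cnj (poly a (cis t))) powr p)
       \<le> C * integral {0..2 * pi} (\<lambda>t. norm (poly b (cis t) + cnj (poly a (cis t))) powr p)"
      using \<open>St p\<close> unfolding St_def by blast
    define D where "D = 4 powr p * C"
    have "0 \<le> D" using \<open>0 \<le> C\<close> by (simp add: D_def)
    have "integral {0..2 * pi} (\<lambda>t. norm (poly b (cis t) - cnj (poly a (cis t))) powr (2 * p))
       \<le> (D * D + 2 * 2 powr p) * integral {0..2 * pi} (\<lambda>t. norm (poly b (cis t) + cnj (poly a (cis t))) powr (2 * p))"
      (is "?V \<le> _ * ?H") if "poly b 0 = 0" for a b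
    proof -
      define h where "h t = poly b (cis t) + cnj (poly a (cis t))" for t
      define v where "v t = poly b (cis t) - cnj (poly a (cis t))" for t
      define w where "w t = poly (b * b) (cis t) - cnj (poly (- (a * a)) (cis t))" for t
      have integrable: "(\<lambda>t. norm (h t) powr (2 * p)) integrable_on {0..2 * pi}"
        "(\<lambda>t. norm (v t) powr (2 * p)) integrable_on {0..2 * pi}"
        "(\<lambda>t. norm (w t) powr p) integrable_on {0..2 * pi}"
        "(\<lambda>t. norm (h t * v t) powr p) integrable_on {0..2 * pi}"
        using \<open>1 < p\<close> unfolding h_def v_def w_def
        by (auto intro!: integrable_continuous_real continuous_intros continuous_on_powr')
      have w: "(v t)\<^sup>2 = 2 * w t - (h t)\<^sup>2" for t
        by (simp add: v_def w_def h_def power2_eq_square algebra_simps)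
      have sq_powr: "norm (z\<^sup>2) powr p = norm z powr (2 * p)" for z :: complex
        by (simp add: norm_power powr_powr flip: powr_numeral)
      have v_le: "norm (v t) powr (2 * p) \<le> 4 powr p * norm (w t) powr p + 2 powr p * norm (h t) powr (2 * p)" for t
      proof -
        have "norm ((v t)\<^sup>2) \<le> norm (2 * w t) + norm ((h t)\<^sup>2)"
          unfolding w by (rule norm_triangle_ineq4)
        also have "\<dots> \<le> 2 * max (2 * norm (w t)) (norm ((h t)\<^sup>2))"
          by (simp add: norm_mult)
        finally have "norm ((v t)\<^sup>2) powr p \<le> (2 * max (2 * norm (w t)) (norm ((h t)\<^sup>2))) powr p"
          using \<open>1 < p\<close> by (intro powr_mono2) auto
        also have "\<dots> \<le> (4 * norm (w t)) powr p + (2 * norm ((h t)\<^sup>2)) powr p"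
          by (cases "2 * norm (w t) \<le> norm ((h t)\<^sup>2)") (auto simp: max_def)
        finally show ?thesis
          by (simp add: powr_mult sq_powr)
      qed
      have "integral {0..2 * pi} (\<lambda>t. norm (w t) powr p) \<le> C * integral {0..2 * pi} (\<lambda>t. norm (h t * v t) powr p)"
      proof -
        have "poly (b * b) (cis t) + cnj (poly (- (a * a)) (cis t)) = h t * v t" for t
          by (simp add: h_def v_def algebra_simps)
        then show ?thesis
          using C[of "b * b" "- (a * a)"] that by (simp only: w_def poly_mult) simp
      qed
      then have w_le: "4 powr p * integral {0..2 * pi} (\<lambda>t. norm (w t) powr p) \<le> D * integral {0..2 * pi} (\<lambda>t. norm (h t * v t) powr p)"
        unfolding D_def mult.assoc by (intro mult_left_mono) auto
      \<comment> \<open>Weighted so that the part with \<open>v\<close>, having factor 1/2, can be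
        absorbed into the left side.\<close>
      have hv: "D * norm (h t * v t) powr p \<le> (D * D / 2) * norm (h t) powr (2 * p) + (1 / 2) * norm (v t) powr (2 * p)" for t
      proof -
        have "0 \<le> (D * norm (h t) powr p - norm (v t) powr p)\<^sup>2" by simp
        then show ?thesis
          by (simp add: norm_mult powr_mult power2_eq_square algebra_simps flip: powr_add)
      qed
      have "?V \<le> integral {0..2 * pi} (\<lambda>t. 4 powr p * norm (w t) powr p + 2 powr p * norm (h t) powr (2 * p))"
        unfolding v_def[symmetric] using v_le by (intro integral_le integrable integrable_add integrable_on_mult_right)
      also have "\<dots> = 4 powr p * integral {0..2 * pi} (\<lambda>t. norm (w t) powr p) + 2 powr p * ?H"
        unfolding h_def[symmetric] by (subst integral_add) (auto intro!: integrable integrable_on_mult_right)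
      also have "\<dots> \<le> integral {0..2 * pi} (\<lambda>t. D * norm (h t * v t) powr p) + 2 powr p * ?H"
        using w_le by simp
      also have "integral {0..2 * pi} (\<lambda>t. D * norm (h t * v t) powr p)
          \<le> integral {0..2 * pi} (\<lambda>t. (D * D / 2) * norm (h t) powr (2 * p) + (1 / 2) * norm (v t) powr (2 * p))"
        using hv by (intro integral_le integrable integrable_add integrable_on_mult_right)
      also have "\<dots> = (D * D / 2) * ?H + (1 / 2) * ?V"
        unfolding h_def[symmetric] v_def[symmetric]
        by (subst integral_add; (intro integrable integrable_on_mult_right)?; simp only: integral_mult_right)
      finally show ?thesis by (simp add: algebra_simps)
    qed
    then show ?thesis
      unfolding St_def using \<open>0 \<le> D\<close> by (intro exI[of _ "D * D + 2 * 2 powr p"]) auto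
  qed
  have "\<forall>p. 1 < p \<longrightarrow> p \<le> 2 ^ Suc n \<longrightarrow> St p" for n :: nat
  proof (induction n)
    case 0
    then show ?case using base by simp
  next
    case (Suc n)
    show ?case
    proof (intro allI impI)
      fix p :: real assume "1 < p" "p \<le> 2 ^ Suc (Suc n)"
      then show "St p"
        using base[of p] step[of "p / 2"] Suc by (cases "p \<le> 2") auto
    qed
  qed
  moreover obtain n where "p < 2 ^ n"
    using real_arch_pow[of 2 p] by auto
  then have "p \<le> 2 ^ Suc n"
    using zero_le_power[of "2::real" n] unfolding power_Suc by linarith
  ultimately show ?thesis
    using \<open>1 < p\<close> unfolding St_def by blast
qed

text \<open>For \<open>\<phi>(x) = sqrt (1 + x) - 1\<close> one has
  \<open>\<phi>1 + 2 x \<phi>2 = (1 + x)^(-3/2) / 2\<close>, and for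
  \<open>\<kappa>(S) = S / (1 + S)\<close> the derivative is
  \<open>(1 + S)^(-2) \<le> 4 (1 + x)^(-2)\<close> when \<open>x \<le> 2 S\<close>; hence the
  constant 8. The L^1 norm on the right comes from \<open>sqrt (1 + y^2) - 1 \<le> y\<close>. The
  left integrand is at least 1/2 where \<open>|a| \<ge> 1\<close>, which is all that a weak type
  bound needs.\<close>

lemma conjugate_function_weak:
  fixes a b :: "complex poly"
  assumes "poly b 0 = 0"
  shows "integral {0..2 * pi} (\<lambda>t. (norm (poly a (cis t)))\<^sup>2 / (1 + (norm (poly a (cis t)))\<^sup>2))
       \<le> 8 * integral {0..2 * pi} (\<lambda>t. norm (poly b (cis t) + cnj (poly a (cis t))))"
    (is "?V \<le> 8 * ?H")
proof -
  define \<phi> :: "real \<Rightarrow> real" where "\<phi> x = (1 + x) powr (1 / 2) - 1" for x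
  define \<phi>1 :: "real \<Rightarrow> real" where "\<phi>1 x = 1 / 2 * (1 + x) powr (- 1 / 2)" for x
  define \<phi>2 :: "real \<Rightarrow> real" where "\<phi>2 x = - 1 / 4 * (1 + x) powr (- 3 / 2)" for x
  define \<kappa> :: "real \<Rightarrow> real" where "\<kappa> x = 1 - inverse (1 + x)" for x
  define \<kappa>1 :: "real \<Rightarrow> real" where "\<kappa>1 x = inverse (1 + x) ^ 2" for x
  define \<kappa>2 :: "real \<Rightarrow> real" where "\<kappa>2 x = - 2 * inverse (1 + x) ^ 3" for x
  have d\<phi>: "(\<phi> has_real_derivative \<phi>1 x) (at x)" "(\<phi>1 has_real_derivative \<phi>2 x) (at x)" if "0 \<le> x" for x
    using that unfolding \<phi>_def \<phi>1_def \<phi>2_def by (auto intro!: derivative_eq_intros)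
  have d\<kappa>: "(\<kappa> has_real_derivative \<kappa>1 x) (at x)" "(\<kappa>1 has_real_derivative \<kappa>2 x) (at x)" if "0 \<le> x" for x
    using that unfolding \<kappa>_def \<kappa>1_def \<kappa>2_def
    by (auto intro!: derivative_eq_intros simp: power2_eq_square power3_eq_cube)
  have \<kappa>_eq: "\<kappa> x = x / (1 + x)" if "0 \<le> x" for x
    using that by (simp add: \<kappa>_def field_simps)
  have c\<phi>: "continuous_on {0..} \<phi>2" "continuous_on {0..} \<kappa>2"
    unfolding \<phi>2_def \<kappa>2_def by (auto intro!: continuous_intros)
  have concave: "\<phi>2 x \<le> 0" "\<kappa>2 x \<le> 0" if "0 \<le> x" for x
    using that by (auto simp: \<phi>2_def \<kappa>2_def)
  have dominated: "\<kappa>1 S \<le> 8 * (\<phi>1 x + 2 * x * \<phi>2 x)" if "0 \<le> x" "x \<le> 2 * S" for x S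
  proof -
    have split: "(1 + x) powr (- 1 / 2) = (1 + x) * (1 + x) powr (- 3 / 2)"
      using that powr_mult_base[of "1 + x" "- 3 / 2"] by simp
    have "1 / (2 * (1 + S))\<^sup>2 \<le> 1 / (1 + x)\<^sup>2"
      using that by (intro divide_left_mono power_mono) auto
    moreover have "(inverse y)\<^sup>2 = 4 * (1 / (2 * y)\<^sup>2)" for y :: real
      by (cases "y = 0") (simp_all add: field_simps)
    then have "\<kappa>1 S = 4 * (1 / (2 * (1 + S))\<^sup>2)"
      unfolding \<kappa>1_def .
    ultimately have "\<kappa>1 S \<le> 4 * (1 / (1 + x)\<^sup>2)"
      by linarith
    also have "1 / (1 + x)\<^sup>2 = (1 + x) powr (- 2)"
      using that by (simp add: powr_minus_divide)
    also have "\<dots> \<le> (1 + x) powr (- 3 / 2)"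
      using that by (intro powr_mono) auto
    also have "4 * (1 + x) powr (- 3 / 2) = 8 * (\<phi>1 x + 2 * x * \<phi>2 x)"
      unfolding \<phi>1_def \<phi>2_def split by (simp add: algebra_simps)
    finally show ?thesis by simp
  qed
  note submean = harmonic_pair_submean[OF d\<phi> c\<phi>(1) d\<kappa> c\<phi>(2) concave _ dominated, of a b]
  have at_0: "\<kappa> (y\<^sup>2) \<le> 8 * \<phi> (y\<^sup>2)" for y
  proof -
    \<comment> \<open>In terms of \<open>s\<close> both sides carry the factor
      \<open>s - 1\<close>.\<close>
    define s where "s = sqrt (1 + y\<^sup>2)"
    have s: "1 \<le> s" "y\<^sup>2 = s\<^sup>2 - 1"
      by (auto simp: s_def)
    have "\<kappa> (y\<^sup>2) = y\<^sup>2 / (1 + y\<^sup>2)"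
      by (simp add: \<kappa>_eq)
    also have "\<dots> = (s - 1) * ((s + 1) / s\<^sup>2)"
      unfolding s(2) by (simp add: power2_eq_square algebra_simps)
    also have "\<dots> \<le> (s - 1) * 8"
    proof (rule mult_left_mono)
      have "s \<le> s\<^sup>2" using s(1) by (simp add: power2_eq_square)
      then show "(s + 1) / s\<^sup>2 \<le> 8" using s(1) by (simp add: divide_le_eq)
    qed (use s in auto)
    also have "\<dots> = 8 * \<phi> (y\<^sup>2)"
      by (simp add: \<phi>_def s_def powr_half_sqrt)
    finally show ?thesis .
  qed
  have int\<phi>: "(\<lambda>t. \<phi> ((norm (cnj (poly a (cis t)) + poly b (cis t)))\<^sup>2)) integrable_on {0..2 * pi}"
    unfolding \<phi>_def by (intro integrable_continuous_real) (auto intro!: continuous_intros simp: add_nonneg_eq_0_iff)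
  have int\<kappa>: "(\<lambda>t. \<kappa> ((norm (poly a (cis t)))\<^sup>2 + (norm (poly b (cis t)))\<^sup>2)) integrable_on {0..2 * pi}"
    unfolding \<kappa>_def by (intro integrable_continuous_real) (auto intro!: continuous_intros simp: add_nonneg_eq_0_iff)
  have intV: "(\<lambda>t. (norm (poly a (cis t)))\<^sup>2 / (1 + (norm (poly a (cis t)))\<^sup>2)) integrable_on {0..2 * pi}"
    by (intro integrable_continuous_real) (auto intro!: continuous_intros simp: add_nonneg_eq_0_iff)
  have intH: "(\<lambda>t. norm (poly b (cis t) + cnj (poly a (cis t)))) integrable_on {0..2 * pi}"
    by (intro integrable_continuous_real) (auto intro!: continuous_intros)
  have "?V \<le> integral {0..2 * pi} (\<lambda>t. \<kappa> ((norm (poly a (cis t)))\<^sup>2 + (norm (poly b (cis t)))\<^sup>2))"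
  proof (intro integral_le intV int\<kappa>)
    fix t
    have "x / (1 + x) \<le> (x + y) / (1 + (x + y))" if "0 \<le> x" "0 \<le> y" for x y :: real
      using that by (simp add: field_simps add_nonneg_pos)
    then show "(norm (poly a (cis t)))\<^sup>2 / (1 + (norm (poly a (cis t)))\<^sup>2) \<le> \<kappa> ((norm (poly a (cis t)))\<^sup>2 + (norm (poly b (cis t)))\<^sup>2)"
      by (simp add: \<kappa>_eq)
  qed
  also have "\<dots> \<le> integral {0..2 * pi} (\<lambda>t. 8 * \<phi> ((norm (cnj (poly a (cis t)) + poly b (cis t)))\<^sup>2))"
  proof -
    have "0 \<le> 2 * pi * (8 * \<phi> ((norm (cnj (poly a 0) + poly b 0))\<^sup>2) - \<kappa> ((norm (poly a 0))\<^sup>2 + (norm (poly b 0))\<^sup>2))"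
      using at_0[of "norm (poly a 0)"] \<open>poly b 0 = 0\<close> by simp
    also note submean
    also have "integral {0..2 * pi} (\<lambda>t. 8 * \<phi> ((norm (cnj (poly a (cis t)) + poly b (cis t)))\<^sup>2)
          - \<kappa> ((norm (poly a (cis t)))\<^sup>2 + (norm (poly b (cis t)))\<^sup>2))
       = integral {0..2 * pi} (\<lambda>t. 8 * \<phi> ((norm (cnj (poly a (cis t)) + poly b (cis t)))\<^sup>2))
        - integral {0..2 * pi} (\<lambda>t. \<kappa> ((norm (poly a (cis t)))\<^sup>2 + (norm (poly b (cis t)))\<^sup>2))"
      by (intro integral_diff integrable_on_mult_right int\<phi> int\<kappa>)
    finally show ?thesis by simp
  qed
  also have "\<dots> = 8 * integral {0..2 * pi} (\<lambda>t. \<phi> ((norm (cnj (poly a (cis t)) + poly b (cis t)))\<^sup>2))"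
    by (rule integral_mult_right)
  also have "\<dots> \<le> 8 * ?H"
  proof (intro mult_left_mono integral_le int\<phi> intH)
    fix t
    have "sqrt (1 + y\<^sup>2) - 1 \<le> y" if "0 \<le> y" for y :: real
      using that real_le_lsqrt[of "1 + y" "1 + y\<^sup>2"] by (simp add: power2_eq_square algebra_simps)
    then show "\<phi> ((norm (cnj (poly a (cis t)) + poly b (cis t)))\<^sup>2) \<le> norm (poly b (cis t) + cnj (poly a (cis t)))"
      by (simp add: \<phi>_def powr_half_sqrt add.commute)
  qed auto
  finally show ?thesis .
qed

text \<open>Division by \<open>cis t ^ N\<close> makes the frequencies \<open>k \<le> N\<close>
  nonpositive, and they form \<open>cnj a\<close>; the others become positive and form
  \<open>b\<close>, whence \<open>b(0) = 0\<close>. Cutting at degree \<open>N\<close> is thus the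
  same as separating \<open>cnj a\<close> from \<open>b\<close>, with moduli unchanged.\<close>

lemma partial_sum_conjugate_decomposition:
  fixes c :: "nat \<Rightarrow> complex"
  obtains a b where "poly b 0 = 0"
    "\<And>t. norm (\<Sum>k\<le>K. c k * cis t ^ k) = norm (poly b (cis t) + cnj (poly a (cis t)))"
    "\<And>t. norm (\<Sum>k\<le>K. if k \<le> N then c k * cis t ^ k else 0) = norm (poly a (cis t))"
proof -
  define a where "a = (\<Sum>k\<le>K. if k \<le> N then monom (cnj (c k)) (N - k) else 0)"
  define b where "b = (\<Sum>k\<le>K. if k \<le> N then 0 else monom (c k) (k - N))"
  have cis_pow_diff: "cis t ^ N * cnj (cis t ^ (N - k)) = cis t ^ k" if "k \<le> N" for k t
  proof -
    have "cis t ^ (N - k) * cnj (cis t ^ (N - k)) = 1"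
      by (simp add: cis_cnj cis_mult flip: power_mult_distrib)
    moreover have "cis t ^ N = cis t ^ k * cis t ^ (N - k)"
      using that by (simp flip: power_add)
    ultimately show ?thesis
      by (simp only: mult.assoc mult_1_right)
  qed
  have a: "cis t ^ N * cnj (poly a (cis t)) = (\<Sum>k\<le>K. if k \<le> N then c k * cis t ^ k else 0)" for t
    unfolding a_def poly_sum cnj_sum sum_distrib_left
    using cis_pow_diff[of _ t]
    by (intro sum.cong) (auto simp: poly_monom mult.left_commute simp del: complex_cnj_power)
  have b: "cis t ^ N * poly b (cis t) = (\<Sum>k\<le>K. if k \<le> N then 0 else c k * cis t ^ k)" for t
    unfolding b_def poly_sum sum_distrib_left
    by (intro sum.cong) (auto simp: poly_monom mult.left_commute simp flip: power_add)
  show ?thesis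
  proof (rule that[of b a])
    show "poly b 0 = 0"
      by (auto simp: b_def poly_sum poly_monom intro!: sum.neutral)
    fix t
    have "(\<Sum>k\<le>K. c k * cis t ^ k) = cis t ^ N * (poly b (cis t) + cnj (poly a (cis t)))"
      unfolding distrib_left a b sum.distrib[symmetric] by (intro sum.cong) auto
    then show "norm (\<Sum>k\<le>K. c k * cis t ^ k) = norm (poly b (cis t) + cnj (poly a (cis t)))"
      by (simp add: norm_mult norm_power)
    show "norm (\<Sum>k\<le>K. if k \<le> N then c k * cis t ^ k else 0) = norm (poly a (cis t))"
      unfolding a[symmetric] by (simp add: norm_mult norm_power)
  qed
qed

lemma partial_sum_Lp:
  fixes p :: real
  assumes "1 < p"
  shows "\<exists>C\<ge>0. \<forall>c K N. integral {0..2 * pi} (\<lambda>t. norm (\<Sum>k\<le>K. if k \<le> N then c k * cis t ^ k else 0) powr p)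
     \<le> C * integral {0..2 * pi} (\<lambda>t. norm (\<Sum>k\<le>K. c k * cis t ^ k) powr p)"
proof -
  obtain C where "0 \<le> C" and C: "\<And>a b. poly b 0 = 0 \<Longrightarrow>
     integral {0..2 * pi} (\<lambda>t. norm (poly b (cis t) - cnj (poly a (cis t))) powr p)
       \<le> C * integral {0..2 * pi} (\<lambda>t. norm (poly b (cis t) + cnj (poly a (cis t))) powr p)"
    using conjugate_function_Lp[OF assms] by blast
  have "integral {0..2 * pi} (\<lambda>t. norm (\<Sum>k\<le>K. if k \<le> N then c k * cis t ^ k else 0) powr p)
     \<le> (1 + C) * integral {0..2 * pi} (\<lambda>t. norm (\<Sum>k\<le>K. c k * cis t ^ k) powr p)" for c K N
  proof -
    obtain a b where "poly b 0 = 0"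
      and q: "\<And>t. norm (\<Sum>k\<le>K. c k * cis t ^ k) = norm (poly b (cis t) + cnj (poly a (cis t)))"
      and s: "\<And>t. norm (\<Sum>k\<le>K. if k \<le> N then c k * cis t ^ k else 0) = norm (poly a (cis t))"
      by (rule partial_sum_conjugate_decomposition[where c = c and K = K and N = N], rule that)
    define h where "h t = poly b (cis t) + cnj (poly a (cis t))" for t
    define v where "v t = poly b (cis t) - cnj (poly a (cis t))" for t
    have integrable: "(\<lambda>t. norm (h t) powr p) integrable_on {0..2 * pi}"
      "(\<lambda>t. norm (v t) powr p) integrable_on {0..2 * pi}"
      "(\<lambda>t. norm (poly a (cis t)) powr p) integrable_on {0..2 * pi}"
      using \<open>1 < p\<close> unfolding h_def v_def
      by (auto intro!: integrable_continuous_real continuous_intros continuous_on_powr')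
    have "integral {0..2 * pi} (\<lambda>t. norm (poly a (cis t)) powr p) \<le> integral {0..2 * pi} (\<lambda>t. norm (h t) powr p + norm (v t) powr p)"
    proof (intro integral_le integrable_add integrable)
      fix t
      have "norm (poly a (cis t)) = norm ((h t - v t) / 2)"
        by (simp add: h_def v_def)
      also have "\<dots> \<le> (norm (h t) + norm (v t)) / 2"
        by (simp add: norm_divide norm_triangle_ineq4)
      also have "\<dots> \<le> max (norm (h t)) (norm (v t))"
        by simp
      finally have "norm (poly a (cis t)) powr p \<le> max (norm (h t)) (norm (v t)) powr p"
        using \<open>1 < p\<close> by (intro powr_mono2) auto
      also have "\<dots> \<le> norm (h t) powr p + norm (v t) powr p"
        by (auto simp: max_def)
      finally show "norm (poly a (cis t)) powr p \<le> norm (h t) powr p + norm (v t) powr p" .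
    qed
    also have "\<dots> = integral {0..2 * pi} (\<lambda>t. norm (h t) powr p) + integral {0..2 * pi} (\<lambda>t. norm (v t) powr p)"
      by (intro integral_add integrable)
    also have "\<dots> \<le> (1 + C) * integral {0..2 * pi} (\<lambda>t. norm (h t) powr p)"
      using C[OF \<open>poly b 0 = 0\<close>, of a] by (simp add: h_def v_def algebra_simps)
    finally show ?thesis
      unfolding q s h_def .
  qed
  then show ?thesis
    using \<open>0 \<le> C\<close> by (intro exI[of _ "1 + C"]) auto
qed

lemma partial_sum_weak:
  "integral {0..2 * pi} (\<lambda>t. (norm (\<Sum>k\<le>K. if k \<le> N then c k * cis t ^ k else 0))\<^sup>2
        / (1 + (norm (\<Sum>k\<le>K. if k \<le> N then c k * cis t ^ k else 0))\<^sup>2))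
     \<le> 8 * integral {0..2 * pi} (\<lambda>t. norm (\<Sum>k\<le>K. c k * cis t ^ k))"
proof -
  obtain a b where "poly b 0 = 0"
    and q: "\<And>t. norm (\<Sum>k\<le>K. c k * cis t ^ k) = norm (poly b (cis t) + cnj (poly a (cis t)))"
    and s: "\<And>t. norm (\<Sum>k\<le>K. if k \<le> N then c k * cis t ^ k else 0) = norm (poly a (cis t))"
    by (rule partial_sum_conjugate_decomposition[where c = c and K = K and N = N], rule that)
  then show ?thesis
    unfolding q s using conjugate_function_weak by blast
qed

section \<open>Surface measure on the sphere\<close>

lemma nn_integral_lborel_translate:
  fixes f :: "'a::euclidean_space \<Rightarrow> ennreal"
  assumes [measurable]: "f \<in> borel_measurable borel"
  shows "(\<integral>\<^sup>+x. f (c + x) \<partial>lborel) = (\<integral>\<^sup>+x. f x \<partial>lborel)"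
proof -
  have "(\<integral>\<^sup>+x. f x \<partial>lborel) = (\<integral>\<^sup>+x. f x \<partial>distr lborel borel ((+) c))"
    by (simp add: lborel_distr_plus)
  also have "\<dots> = (\<integral>\<^sup>+x. f (c + x) \<partial>lborel)"
    by (subst nn_integral_distr) auto
  finally show ?thesis by simp
qed

text \<open>Uniqueness of translation invariant measures: integrate the function equal to \<open>1\<close> at \<open>(x, y)\<close>
  if \<open>x - T y\<close> lies in the unit ball and \<open>x \<in> B\<close> in both orders.\<close>
lemma lborel_distr_linear_isometry:
  fixes T :: "'a::euclidean_space \<Rightarrow> 'a"
  assumes "linear T" and isometry: "\<And>x. norm (T x) = norm x"
  shows "distr lborel borel T = lborel"
proof (rule measure_eqI)
  fix B assume "B \<in> sets (distr lborel borel T)"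
  then have B[measurable]: "B \<in> sets borel" by simp
  have contT: "continuous_on UNIV T"
    using \<open>linear T\<close> by (simp add: linear_continuous_on linear_conv_bounded_linear)
  then have T[measurable]: "T \<in> borel \<rightarrow>\<^sub>M borel"
    by (rule borel_measurable_continuous_onI)
  have "inj T"
    using isometry linear_injective_0[OF \<open>linear T\<close>] by (metis norm_eq_zero)
  then have "surj T"
    using eucl.linear_inj_imp_surj[OF \<open>linear T\<close>] by blast
  then obtain S where S: "\<And>x. T (S x) = x" by (metis surj_def)
  define A where "A = ball (0::'a) 1"
  have A[measurable]: "A \<in> sets borel" by (simp add: A_def)
  have A_finite: "emeasure lborel A \<noteq> 0" "emeasure lborel A \<noteq> top"
    using less_imp_neq[OF unit_ball_vol_pos[of "real DIM('a)"]] by (auto simp: A_def emeasure_ball)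
  define \<nu> where "\<nu> = (\<integral>\<^sup>+y. indicator B (T y) \<partial>lborel)"
  have [measurable]: "(\<lambda>(x, y). indicator A (x - T y) * indicator B x :: ennreal) \<in> borel_measurable (lborel \<Otimes>\<^sub>M lborel)"
    by measurable
  have "(\<integral>\<^sup>+y. (\<integral>\<^sup>+x. indicator A (x - T y) * indicator B x \<partial>lborel) \<partial>lborel)
      = (\<integral>\<^sup>+y. (\<integral>\<^sup>+x. indicator A x * indicator B (x + T y) \<partial>lborel) \<partial>lborel)"
  proof (rule nn_integral_cong)
    fix y
    show "(\<integral>\<^sup>+x. indicator A (x - T y) * indicator B x \<partial>lborel) = (\<integral>\<^sup>+x. indicator A x * indicator B (x + T y) \<partial>lborel)"
      using nn_integral_lborel_translate[of "\<lambda>x. indicator A (x - T y) * indicator B x" "T y"]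
      by (simp add: add.commute)
  qed
  also have "\<dots> = (\<integral>\<^sup>+x. (\<integral>\<^sup>+y. indicator A x * indicator B (x + T y) \<partial>lborel) \<partial>lborel)"
    by (rule lborel_pair.Fubini'[symmetric]) measurable
  also have "\<dots> = (\<integral>\<^sup>+x. indicator A x * \<nu> \<partial>lborel)"
  proof (rule nn_integral_cong)
    \<comment> \<open>Surjectivity of \<open>T\<close> moves the shift by \<open>x\<close> inside,
      where translation invariance in \<open>y\<close> removes it.\<close>
    fix x
    have "(\<integral>\<^sup>+y. indicator B (x + T y) \<partial>lborel) = (\<integral>\<^sup>+y. indicator B (T (S x + y)) \<partial>lborel)"
      by (simp add: linear_add[OF \<open>linear T\<close>] S)
    also have "\<dots> = \<nu>"
      unfolding \<nu>_def by (rule nn_integral_lborel_translate) measurable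
    finally show "(\<integral>\<^sup>+y. indicator A x * indicator B (x + T y) \<partial>lborel) = indicator A x * \<nu>"
      by (subst nn_integral_cmult) auto
  qed
  also have "\<dots> = \<nu> * emeasure lborel A"
    by (subst nn_integral_multc) (auto simp: mult.commute)
  finally have eq1: "(\<integral>\<^sup>+y. (\<integral>\<^sup>+x. indicator A (x - T y) * indicator B x \<partial>lborel) \<partial>lborel) = \<nu> * emeasure lborel A" .
  have "(\<integral>\<^sup>+y. (\<integral>\<^sup>+x. indicator A (x - T y) * indicator B x \<partial>lborel) \<partial>lborel)
      = (\<integral>\<^sup>+x. (\<integral>\<^sup>+y. indicator A (x - T y) * indicator B x \<partial>lborel) \<partial>lborel)"
    by (rule lborel_pair.Fubini'[symmetric]) measurable
  also have "\<dots> = (\<integral>\<^sup>+x. indicator B x * emeasure lborel A \<partial>lborel)"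
  proof (rule nn_integral_cong)
    fix x
    \<comment> \<open>After the shift of \<open>y\<close> only \<open>- T y\<close> is left, and the
      isometry turns membership of \<open>- T y\<close> in the unit ball into membership of
      \<open>y\<close>.\<close>
    have "x - T (S x + y) = - T y" for y
      by (simp add: linear_add[OF \<open>linear T\<close>] S)
    then have "indicator A (x - T (S x + y)) = (indicator A y :: ennreal)" for y
      by (simp add: A_def indicator_def isometry)
    moreover have "(\<integral>\<^sup>+y. indicator A (x - T (S x + y)) \<partial>lborel) = (\<integral>\<^sup>+y. indicator A (x - T y) \<partial>lborel)"
      by (rule nn_integral_lborel_translate) measurable
    ultimately have "(\<integral>\<^sup>+y. indicator A (x - T y) \<partial>lborel) = emeasure lborel A"
      by simp
    then show "(\<integral>\<^sup>+y. indicator A (x - T y) * indicator B x \<partial>lborel) = indicator B x * emeasure lborel A"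
      by (subst nn_integral_multc) (auto simp: mult.commute)
  qed
  also have "\<dots> = emeasure lborel B * emeasure lborel A"
    by (subst nn_integral_multc) auto
  finally have "\<nu> * emeasure lborel A = emeasure lborel B * emeasure lborel A"
    using eq1 by simp
  then have "\<nu> = emeasure lborel B"
    using A_finite by (simp add: ennreal_mult_cancel_left mult.commute[of _ "emeasure lborel A"])
  moreover have "emeasure (distr lborel borel T) B = \<nu>"
  proof -
    have "(\<integral>\<^sup>+y. indicator B y \<partial>distr lborel borel T) = \<nu>"
      unfolding \<nu>_def by (rule nn_integral_distr) auto
    then show ?thesis by simp
  qed
  ultimately show "emeasure (distr lborel borel T) B = emeasure lborel B" by simp
qed simp

lemma normalize_measurable:
  "(\<lambda>x. x /\<^sub>R norm x) \<in> restrict_space lborel (cball 0 1 - {0}) \<rightarrow>\<^sub>M restrict_space borel (sphere (0::complex ^ 'm::finite) 1)"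
proof (rule measurable_restrict_space2)
  have "(\<lambda>x::complex ^ 'm. x /\<^sub>R norm x) \<in> borel \<rightarrow>\<^sub>M borel"
    by measurable
  then show "(\<lambda>x::complex ^ 'm. x /\<^sub>R norm x) \<in> restrict_space lborel (cball 0 1 - {0}) \<rightarrow>\<^sub>M borel"
    by (intro measurable_restrict_space1) simp
qed (auto simp: space_restrict_space)

lemma space_sphere_measure [simp]: "space sphere_measure = sphere 0 1"
  by (simp add: sphere_measure_def space_scale_measure space_restrict_space)

lemma sets_sphere_measure [measurable_cong]: "sets sphere_measure = sets (restrict_space borel (sphere 0 1))"
  by (simp add: sphere_measure_def)

text \<open>With a constant density in place of \<open>scale_measure\<close> the rules for Bochner
  integrals against densities apply.\<close>

lemma sphere_measure_eq_density:
  "sphere_measure = density (distr (restrict_space lborel (cball 0 1 - {0}))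
      (restrict_space borel (sphere 0 1)) (\<lambda>x::complex ^ 'm::finite. x /\<^sub>R norm x)) (\<lambda>_. ennreal (real (2 * CARD('m))))"
proof (rule measure_eqI)
  fix A assume "A \<in> sets (sphere_measure :: (complex ^ 'm) measure)"
  then show "emeasure sphere_measure A = emeasure (density (distr (restrict_space lborel (cball 0 1 - {0}))
      (restrict_space borel (sphere 0 1)) (\<lambda>x::complex ^ 'm::finite. x /\<^sub>R norm x)) (\<lambda>_. ennreal (real (2 * CARD('m))))) A"
    by (subst emeasure_density_const) (auto simp: sphere_measure_def)
qed (simp add: sphere_measure_def)

text \<open>The bridge to Lebesgue measure: rotation invariance, full support and orthogonality of
  eigenfunctions are proved for the degree 0 extension on the punctured ball and brought back to the
  sphere by this formula.\<close>

lemma sphere_integral: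
  fixes f :: "complex ^ 'm::finite \<Rightarrow> 'b::{banach, second_countable_topology}"
  assumes "f \<in> borel_measurable sphere_measure"
  shows "integral\<^sup>L sphere_measure f
       = real (2 * CARD('m)) *\<^sub>R (\<integral>x. indicator (cball 0 1 - {0}) x *\<^sub>R f (x /\<^sub>R norm x) \<partial>lborel)"
proof -
  have f: "f \<in> borel_measurable (restrict_space borel (sphere 0 1))"
    using assms by (simp cong: measurable_cong_sets add: sets_sphere_measure)
  have "integral\<^sup>L sphere_measure f = (\<integral>x. real (2 * CARD('m)) *\<^sub>R f x
      \<partial>distr (restrict_space lborel (cball 0 1 - {0})) (restrict_space borel (sphere 0 1)) (\<lambda>x::complex ^ 'm::finite. x /\<^sub>R norm x))"
    unfolding sphere_measure_eq_density using f by (subst integral_density) auto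
  also have "\<dots> = (\<integral>x. real (2 * CARD('m)) *\<^sub>R f (x /\<^sub>R norm x) \<partial>restrict_space lborel (cball 0 1 - {0}))"
    using f by (intro integral_distr normalize_measurable) auto
  also have "\<dots> = (\<integral>x. indicator (cball 0 1 - {0}) x *\<^sub>R (real (2 * CARD('m)) *\<^sub>R f (x /\<^sub>R norm x)) \<partial>lborel)"
    by (rule integral_restrict_space) simp
  also have "\<dots> = (\<integral>x. real (2 * CARD('m)) *\<^sub>R (indicator (cball 0 1 - {0}) x *\<^sub>R f (x /\<^sub>R norm x)) \<partial>lborel)"
    by (simp add: mult.commute)
  finally show ?thesis
    by (simp del: scaleR_scaleR of_nat_mult)
qed

lemma finite_measure_sphere_measure: "finite_measure (sphere_measure :: (complex ^ 'm::finite) measure)"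
proof
  let ?N = "\<lambda>x::complex ^ 'm. x /\<^sub>R norm x"
  have eq: "emeasure sphere_measure (space (sphere_measure :: (complex ^ 'm) measure))
     = ennreal (real (2 * CARD('m))) * emeasure (distr (restrict_space lborel (cball 0 1 - {0})) (restrict_space borel (sphere 0 1)) ?N) (sphere 0 1)"
    unfolding space_sphere_measure by (simp add: sphere_measure_def)
  have "emeasure (distr (restrict_space lborel (cball 0 1 - {0})) (restrict_space borel (sphere 0 1)) ?N) (sphere 0 1)
      = emeasure (restrict_space lborel (cball 0 1 - {0})) (?N -` sphere 0 1 \<inter> space (restrict_space lborel (cball 0 1 - {0})))"
    by (rule emeasure_distr[OF normalize_measurable]) (auto simp: sets_restrict_space)
  also have "\<dots> \<le> emeasure (restrict_space lborel (cball 0 1 - {0})) (space (restrict_space lborel (cball (0::complex ^ 'm) 1 - {0})))"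
    by (rule emeasure_space)
  also have "\<dots> \<le> emeasure lborel (cball (0::complex ^ 'm) 1)"
    by (subst emeasure_restrict_space) (auto simp: space_restrict_space intro!: emeasure_mono)
  also have "\<dots> < \<infinity>"
    by (rule emeasure_lborel_cball_finite)
  finally have "emeasure (distr (restrict_space lborel (cball 0 1 - {0})) (restrict_space borel (sphere 0 1)) ?N) (sphere 0 1) < \<infinity>" .
  then show "emeasure sphere_measure (space (sphere_measure :: (complex ^ 'm) measure)) \<noteq> \<infinity>"
    unfolding eq by (simp add: ennreal_mult_eq_top_iff)
qed

lemma sphere_measurable_continuous:
  assumes "continuous_on (sphere 0 1) f"
  shows "f \<in> borel_measurable sphere_measure"
  using borel_measurable_continuous_on_restrict[OF assms] by (simp cong: measurable_cong_sets add: sets_sphere_measure)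

lemma sphere_integrable_bounded:
  fixes f :: "complex ^ 'm::finite \<Rightarrow> 'b::{banach, second_countable_topology}"
  assumes "f \<in> borel_measurable sphere_measure" "\<And>x. x \<in> sphere 0 1 \<Longrightarrow> norm (f x) \<le> B"
  shows "integrable sphere_measure f"
  using assms by (intro finite_measure.integrable_const_bound[OF finite_measure_sphere_measure, where B = B]) auto

lemma sphere_bounded_continuous:
  fixes f :: "complex ^ 'm::finite \<Rightarrow> 'b::real_normed_vector"
  assumes "continuous_on (sphere 0 1) f"
  obtains B where "0 \<le> B" "\<And>x. x \<in> sphere 0 1 \<Longrightarrow> norm (f x) \<le> B"
proof -
  have "bounded (f ` sphere 0 1)"
    using compact_continuous_image[OF assms compact_sphere] by (rule compact_imp_bounded)
  then obtain B where "\<And>x. x \<in> sphere 0 1 \<Longrightarrow> norm (f x) \<le> B"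
    unfolding bounded_iff by blast
  then show ?thesis
    using that[of "max B 0"] by (meson max.cobounded1 max.cobounded2 order_trans)
qed

lemma sphere_integrable_continuous:
  fixes f :: "complex ^ 'm::finite \<Rightarrow> 'b::{banach, second_countable_topology}"
  assumes "continuous_on (sphere 0 1) f"
  shows "integrable sphere_measure f"
  by (metis assms sphere_bounded_continuous sphere_integrable_bounded sphere_measurable_continuous)

text \<open>One family of rotations with two uses: a constant \<open>u\<close> rotates a complex
  slice, and a \<open>u\<close> that differs from 1 in a single coordinate separates
  monomials.\<close>

definition torus_act :: "('m \<Rightarrow> complex) \<Rightarrow> complex ^ 'm \<Rightarrow> complex ^ 'm::finite" where
  "torus_act u z = (\<chi> i. u i * z $ i)"

lemma linear_torus_act: "linear (torus_act u)"
  by (auto simp: linear_iff torus_act_def vec_eq_iff algebra_simps)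

lemma norm_torus_act: "(\<And>i. norm (u i) = 1) \<Longrightarrow> norm (torus_act u z) = norm z"
  by (simp add: norm_vec_def torus_act_def norm_mult)

text \<open>\<open>torus_act u\<close> is a linear isometry and commutes with scaling, so it
  preserves Lebesgue measure, the punctured ball and the normalization onto the sphere.\<close>

lemma sphere_integral_torus_act:
  fixes f :: "complex ^ 'm::finite \<Rightarrow> 'b::{banach, second_countable_topology}"
  assumes f: "f \<in> borel_measurable sphere_measure" and u: "\<And>i. norm (u i) = 1"
  shows "(\<integral>x. f (torus_act u x) \<partial>sphere_measure) = integral\<^sup>L sphere_measure f"
proof -
  have cont: "continuous_on UNIV (torus_act u)"
    using linear_torus_act[of u] by (simp add: linear_continuous_on linear_conv_bounded_linear)
  have meas: "torus_act u \<in> borel \<rightarrow>\<^sub>M borel"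
    using cont by (rule borel_measurable_continuous_onI)
  have meas_sphere: "torus_act u \<in> sphere_measure \<rightarrow>\<^sub>M sphere_measure"
  proof -
    have "torus_act u \<in> restrict_space borel (sphere 0 1) \<rightarrow>\<^sub>M restrict_space borel (sphere 0 1)"
      using meas by (intro measurable_restrict_space3) (auto simp: norm_torus_act u)
    then show ?thesis
      by (simp cong: measurable_cong_sets add: sets_sphere_measure)
  qed
  define g where "g x = indicator (cball 0 1 - {0}) x *\<^sub>R f (x /\<^sub>R norm x)" for x
  have g: "g \<in> borel_measurable borel"
  proof -
    have "(\<lambda>x. f (x /\<^sub>R norm x)) \<in> borel_measurable (restrict_space lborel (cball 0 1 - {0}))"
      using measurable_compose[OF normalize_measurable] f by (simp cong: measurable_cong_sets add: sets_sphere_measure)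
    then show ?thesis
      unfolding g_def by (subst (asm) borel_measurable_restrict_space_iff) auto
  qed
  have scale: "torus_act u (c *\<^sub>R x) = c *\<^sub>R torus_act u x" for c x
    using linear_torus_act by (rule linear_scale)
  have "(\<integral>x. f (torus_act u x) \<partial>sphere_measure)
      = real (2 * CARD('m)) *\<^sub>R (\<integral>x. indicator (cball 0 1 - {0}) x *\<^sub>R f (torus_act u (x /\<^sub>R norm x)) \<partial>lborel)"
    using measurable_compose[OF meas_sphere f] by (rule sphere_integral)
  also have "(\<integral>x. indicator (cball 0 1 - {0}) x *\<^sub>R f (torus_act u (x /\<^sub>R norm x)) \<partial>lborel) = (\<integral>x. g (torus_act u x) \<partial>lborel)"
  proof (intro Bochner_Integration.integral_cong refl)
    fix x
    have "torus_act u x = 0 \<longleftrightarrow> x = 0"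
      by (metis norm_torus_act u norm_eq_zero)
    then show "indicator (cball 0 1 - {0}) x *\<^sub>R f (torus_act u (x /\<^sub>R norm x)) = g (torus_act u x)"
      by (simp add: g_def scale norm_torus_act u indicator_def)
  qed
  also have "\<dots> = integral\<^sup>L (distr lborel borel (torus_act u)) g"
    using meas g by (intro integral_distr[symmetric]) auto
  also have "\<dots> = integral\<^sup>L lborel g"
    by (simp add: lborel_distr_linear_isometry[OF linear_torus_act] norm_torus_act u)
  finally show ?thesis
    unfolding sphere_integral[OF f] g_def .
qed

text \<open>Full support of the surface measure: the cone over the set where \<open>f\<close>
  exceeds half of a positive value is open and nonempty in the ball, hence not a null set. It turns
  vanishing L^2 norms into pointwise equality, as the uniqueness behind \<open>riesz0\<close>
  requires.\<close>

lemma sphere_integral_eq_0_imp: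
  fixes f :: "complex ^ 'm::finite \<Rightarrow> real"
  assumes cont: "continuous_on (sphere 0 1) f" and nonneg: "\<And>x. x \<in> sphere 0 1 \<Longrightarrow> 0 \<le> f x"
    and zero: "integral\<^sup>L sphere_measure f = 0" and x: "x \<in> sphere 0 1"
  shows "f x = 0"
proof (rule ccontr)
  assume "f x \<noteq> 0"
  then have "0 < f x" using nonneg[OF x] by simp
  define V where "V = {y \<in> ball 0 1 - {0}. f (y /\<^sub>R norm y) \<in> {f x / 2<..}}"
  have contN: "continuous_on (- {0}) (\<lambda>y::complex ^ 'm. y /\<^sub>R norm y)"
    by (intro continuous_intros) auto
  have cont_f: "continuous_on (ball 0 1 - {0}) (\<lambda>y. f (y /\<^sub>R norm y))"
    by (rule continuous_on_compose2[OF cont continuous_on_subset[OF contN]]) (auto, metis left_inverse norm_eq_zero)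
  have "open V"
    unfolding V_def using continuous_openin_preimage_gen[OF cont_f, of "{f x / 2<..}"]
    by (simp add: openin_open_eq open_Diff vimage_def Int_def)
  moreover have "(1 / 2) *\<^sub>R x \<in> V"
    using x \<open>0 < f x\<close> by (auto simp: V_def)
  ultimately have V: "\<not> negligible V" "V \<in> sets borel"
    by (auto dest: open_not_negligible)
  have "integral\<^sup>L sphere_measure f
      = real (2 * CARD('m)) *\<^sub>R (\<integral>x. indicator (cball 0 1 - {0}) x *\<^sub>R f (x /\<^sub>R norm x) \<partial>lborel)"
    by (rule sphere_integral[OF sphere_measurable_continuous[OF cont]])
  then have zero': "(\<integral>x. indicator (cball 0 1 - {0}) x *\<^sub>R f (x /\<^sub>R norm x) \<partial>lborel) = 0"
    using zero by simp
  obtain B where B: "0 \<le> B" "\<And>x. x \<in> sphere 0 1 \<Longrightarrow> norm (f x) \<le> B"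
    using sphere_bounded_continuous[OF cont] by blast
  have "integrable lborel (\<lambda>x. indicator (cball 0 1 - {0}) x *\<^sub>R f (x /\<^sub>R norm x))"
  proof (rule Bochner_Integration.integrable_bound)
    show "integrable lborel (\<lambda>x::complex ^ 'm. indicator (cball 0 1) x *\<^sub>R B)"
      by (intro integrable_real_indicator integrable_scaleR_left) (use emeasure_lborel_cball_finite[of "0::complex ^ 'm" 1] in auto)
    have "continuous_on (cball 0 1 - {0}) (\<lambda>y. f (y /\<^sub>R norm y))"
      by (rule continuous_on_compose2[OF cont continuous_on_subset[OF contN]]) (auto, metis left_inverse norm_eq_zero)
    then show "(\<lambda>x. indicator (cball 0 1 - {0}) x *\<^sub>R f (x /\<^sub>R norm x)) \<in> borel_measurable lborel"
      using borel_measurable_continuous_on_indicator[of "cball 0 1 - {0}" "\<lambda>y. f (y /\<^sub>R norm y)"] by simp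
    show "AE x in lborel. norm (indicator (cball 0 1 - {0}) x *\<^sub>R f (x /\<^sub>R norm x)) \<le> norm (indicator (cball 0 1) x *\<^sub>R B)"
      using B by (intro AE_I2) (auto simp: indicator_def)
  qed
  then have "AE x in lborel. indicator (cball 0 1 - {0}) x *\<^sub>R f (x /\<^sub>R norm x) = 0"
    using zero' nonneg by (subst (asm) integral_nonneg_eq_0_iff_AE) (auto simp: indicator_def)
  then have "AE x in lborel. x \<notin> V"
    using \<open>0 < f x\<close> by (elim AE_mp) (auto intro!: AE_I2 simp: V_def indicator_def)
  then have "V \<in> null_sets lborel"
    using V(2) AE_iff_null_sets[of V lborel] by simp
  then show False
    using V(1) by (simp add: negligible_iff_null_sets null_sets_completionI)
qed

section \<open>Green's identity for homogeneous functions\<close>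

text \<open>The difference quotients integrate to zero by translation invariance and converge boundedly.\<close>
lemma integral_directional_derivative_eq_0:
  fixes g g' :: "'a::euclidean_space \<Rightarrow> 'b::euclidean_space"
  assumes contg: "continuous_on UNIV g" and contg': "continuous_on UNIV g'"
    and deriv: "\<And>x t. ((\<lambda>t. g (x + t *\<^sub>R b)) has_vector_derivative g' (x + t *\<^sub>R b)) (at t)"
    and supp: "\<And>x. r < norm x \<Longrightarrow> g x = 0"
  shows "integrable lborel g'" "integral\<^sup>L lborel g' = 0"
proof -
  have [measurable]: "g \<in> borel_measurable borel" "g' \<in> borel_measurable borel"
    using contg contg' by (auto intro: borel_measurable_continuous_onI)
  have int_cball: "integrable lborel (\<lambda>x::'a. indicator (cball 0 s) x * (M::real))" for s M
    using emeasure_lborel_cball_finite[of "0::'a" s] by (intro integrable_mult_left integrable_real_indicator) auto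
  have bdd: "\<exists>M\<ge>0. \<forall>x\<in>cball 0 s. norm (f x) \<le> M" if "continuous_on UNIV f" for s and f :: "'a \<Rightarrow> 'b"
  proof -
    have "bounded (f ` cball 0 s)"
      using compact_continuous_image[OF continuous_on_subset[OF that subset_UNIV] compact_cball] by (rule compact_imp_bounded)
    then obtain M where "\<forall>x\<in>cball 0 s. norm (f x) \<le> M"
      unfolding bounded_iff by blast
    then show ?thesis
      by (intro exI[of _ "max M 0"]) (meson max.cobounded1 max.cobounded2 order_trans)
  qed
  have int_g: "integrable lborel g"
  proof -
    obtain M where M: "0 \<le> M" "\<forall>x\<in>cball 0 r. norm (g x) \<le> M"
      using bdd[OF contg] by blast
    show ?thesis
    proof (rule Bochner_Integration.integrable_bound[OF int_cball[of r M]])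
      show "AE x in lborel. norm (g x) \<le> norm (indicator (cball 0 r) x * M)"
        using M supp by (intro AE_I2) (auto simp: indicator_def not_le)
    qed simp
  qed
  \<comment> \<open>Beyond radius \<open>s\<close> neither \<open>x\<close> nor
    \<open>x + t b\<close> with \<open>0 \<le> t \<le> 1\<close> lies in the ball of radius
    \<open>r\<close>, so all difference quotients vanish there.\<close>
  define s where "s = r + norm b"
  obtain M where M: "0 \<le> M" "\<forall>x\<in>cball 0 (s + norm b). norm (g' x) \<le> M"
    using bdd[OF contg'] by blast
  define q where "q n x = real (Suc n) *\<^sub>R (g (x + (1 / real (Suc n)) *\<^sub>R b) - g x)" for n x
  have [measurable]: "q n \<in> borel_measurable borel" for n
    unfolding q_def by measurable
  have q_bound: "norm (q n x) \<le> indicator (cball 0 s) x * M" for n x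
  proof (cases "norm x \<le> s")
    case True
    define h where "h = 1 / real (Suc n)"
    have h: "0 \<le> h" "h \<le> 1" "real (Suc n) * h = 1" by (auto simp: h_def)
    have "norm (g (x + h *\<^sub>R b) - g (x + 0 *\<^sub>R b)) \<le> M * norm (h - 0)"
    proof (rule differentiable_bound[where S = "{0..h}" and f = "\<lambda>t. g (x + t *\<^sub>R b)" and f' = "\<lambda>t u. u *\<^sub>R g' (x + t *\<^sub>R b)"])
      fix t assume t: "t \<in> {0..h}"
      show "((\<lambda>t. g (x + t *\<^sub>R b)) has_derivative (\<lambda>u. u *\<^sub>R g' (x + t *\<^sub>R b))) (at t within {0..h})"
        using deriv[of x t] unfolding has_vector_derivative_def by (rule has_derivative_at_withinI)
      have "norm (x + t *\<^sub>R b) \<le> norm x + norm (t *\<^sub>R b)"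
        by (rule norm_triangle_ineq)
      also have "\<dots> \<le> s + norm b"
        using True t h by (auto intro!: add_mono mult_left_le_one_le)
      finally have "norm (g' (x + t *\<^sub>R b)) \<le> M"
        using M by auto
      then show "onorm (\<lambda>u. u *\<^sub>R g' (x + t *\<^sub>R b)) \<le> M"
        by (subst onorm_scaleR_left) (auto simp: onorm_id bounded_linear_ident)
    qed (use h in auto)
    then have "real (Suc n) * norm (g (x + h *\<^sub>R b) - g x) \<le> real (Suc n) * (M * h)"
      using h by (intro mult_left_mono) auto
    also have "\<dots> = M"
      using h(3) by (metis mult.commute mult.left_commute mult_1_right)
    finally show ?thesis
      using True by (simp add: q_def h_def)
  next
    case False
    have "norm x \<le> norm (x + t *\<^sub>R b) + norm b" if "0 \<le> t" "t \<le> 1" for t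
    proof -
      have "norm (t *\<^sub>R b) \<le> norm b"
        using that by (auto intro: mult_left_le_one_le)
      then show ?thesis
        using norm_triangle_ineq4[of "x + t *\<^sub>R b" "t *\<^sub>R b"] by simp
    qed
    from this[of "1 / real (Suc n)"] this[of 0] have "r < norm (x + (1 / real (Suc n)) *\<^sub>R b)" "r < norm x"
      using False norm_ge_zero[of b] unfolding s_def by (simp, linarith?)+
    then have "g (x + (1 / real (Suc n)) *\<^sub>R b) = 0" "g x = 0"
      using supp by auto
    then have "q n x = 0"
      unfolding q_def by simp
    then show ?thesis using M by simp
  qed
  have q_lim: "(\<lambda>n. q n x) \<longlonglongrightarrow> g' x" for x
  proof -
    have "((\<lambda>t. g (x + t *\<^sub>R b)) has_vector_derivative g' x) (at 0)"
      using deriv[of x 0] by simp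
    then have lim: "((\<lambda>h. norm (g (x + h *\<^sub>R b) - g x - h *\<^sub>R g' x) / norm h) \<longlongrightarrow> 0) (at 0)"
      unfolding has_vector_derivative_def has_derivative_at by simp
    have "((\<lambda>h. norm ((g (x + h *\<^sub>R b) - g x) /\<^sub>R h - g' x)) \<longlongrightarrow> 0) (at 0)"
    proof (rule Lim_transform_eventually[OF lim])
      have "norm (g (x + h *\<^sub>R b) - g x - h *\<^sub>R g' x) / norm h = norm ((g (x + h *\<^sub>R b) - g x) /\<^sub>R h - g' x)" if "h \<noteq> 0" for h
      proof -
        have "(g (x + h *\<^sub>R b) - g x) /\<^sub>R h - g' x = (g (x + h *\<^sub>R b) - g x - h *\<^sub>R g' x) /\<^sub>R h"
          using that by (simp add: scaleR_right_diff_distrib)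
        then show ?thesis
          by (simp add: divide_inverse mult.commute)
      qed
      then show "\<forall>\<^sub>F h in at 0. norm (g (x + h *\<^sub>R b) - g x - h *\<^sub>R g' x) / norm h = norm ((g (x + h *\<^sub>R b) - g x) /\<^sub>R h - g' x)"
        by (simp add: eventually_at_filter)
    qed
    then have "((\<lambda>h. (g (x + h *\<^sub>R b) - g x) /\<^sub>R h) \<longlongrightarrow> g' x) (at 0)"
      by (rule LIM_zero_cancel[OF tendsto_norm_zero_cancel])
    moreover have "filterlim (\<lambda>n. 1 / real (Suc n)) (at 0) sequentially"
      using LIMSEQ_inverse_real_of_nat by (auto simp: filterlim_at inverse_eq_divide)
    ultimately have "(\<lambda>n. (g (x + (1 / real (Suc n)) *\<^sub>R b) - g x) /\<^sub>R (1 / real (Suc n))) \<longlonglongrightarrow> g' x"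
      by (rule filterlim_compose)
    then show ?thesis
      by (simp add: q_def)
  qed
  have int_q: "integral\<^sup>L lborel (q n) = 0" for n
  proof -
    define c where "c = (1 / real (Suc n)) *\<^sub>R b"
    have "integrable (distr lborel borel ((+) c)) g"
      using int_g by (simp add: lborel_distr_plus)
    then have int_c: "integrable lborel (\<lambda>x. g (x + c))"
      by (subst (asm) integrable_distr_eq) (auto simp: add.commute)
    have "integral\<^sup>L (distr lborel borel ((+) c)) g = (\<integral>x. g (c + x) \<partial>lborel)"
      by (rule integral_distr) auto
    then have "(\<integral>x. g (x + c) \<partial>lborel) = integral\<^sup>L lborel g"
      by (simp add: lborel_distr_plus add.commute)
    then show ?thesis
      using int_g int_c unfolding q_def c_def[symmetric] by simp
  qed
  have "AE x in lborel. (\<lambda>n. q n x) \<longlonglongrightarrow> g' x" "\<And>n. AE x in lborel. norm (q n x) \<le> indicator (cball 0 s) x * M"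
    using q_lim q_bound by auto
  note dom = _ _ int_cball[of s M] this
  show "integrable lborel g'"
    by (rule integrable_dominated_convergence[OF dom]) auto
  have "(\<lambda>n. integral\<^sup>L lborel (q n)) \<longlonglongrightarrow> integral\<^sup>L lborel g'"
    by (rule integral_dominated_convergence[OF dom]) auto
  then show "integral\<^sup>L lborel g' = 0"
    unfolding int_q by (simp add: LIMSEQ_const_iff)
qed

lemma C2_onD:
  assumes "C2_on U u"
  shows "open U"
    and "\<And>x. x \<in> U \<Longrightarrow> (u has_derivative frechet_derivative u (at x)) (at x)"
    and "\<And>x b. x \<in> U \<Longrightarrow> b \<in> Basis \<Longrightarrow> ((\<lambda>x. frechet_derivative u (at x) b) has_derivative
          frechet_derivative (\<lambda>y. frechet_derivative u (at y) b) (at x)) (at x)"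
    and "\<And>b c. b \<in> Basis \<Longrightarrow> c \<in> Basis \<Longrightarrow>
          continuous_on U (\<lambda>x. frechet_derivative (\<lambda>y. frechet_derivative u (at y) b) (at x) c)"
proof -
  show "open U" using assms by (simp add: C2_on_def)
  then show "\<And>x. x \<in> U \<Longrightarrow> (u has_derivative frechet_derivative u (at x)) (at x)"
    "\<And>x b. x \<in> U \<Longrightarrow> b \<in> Basis \<Longrightarrow> ((\<lambda>x. frechet_derivative u (at x) b) has_derivative
          frechet_derivative (\<lambda>y. frechet_derivative u (at y) b) (at x)) (at x)"
    using assms unfolding C2_on_def
    by (auto simp: differentiable_on_eq_differentiable_at frechet_derivative_works)
  show "\<And>b c. b \<in> Basis \<Longrightarrow> c \<in> Basis \<Longrightarrow>
          continuous_on U (\<lambda>x. frechet_derivative (\<lambda>y. frechet_derivative u (at y) b) (at x) c)"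
    using assms by (auto simp: C2_on_def)
qed

text \<open>Explicit candidates \<open>u1\<close>, \<open>u2\<close> replace
  \<open>frechet_derivative\<close>; openness of \<open>U\<close> is what allows the first
  identification to be differentiated once more.\<close>

lemma
  assumes "open U"
    and u: "\<And>x. x \<in> U \<Longrightarrow> (u has_derivative u1 x) (at x)"
    and u1: "\<And>x b. x \<in> U \<Longrightarrow> b \<in> Basis \<Longrightarrow> ((\<lambda>x. u1 x b) has_derivative u2 b x) (at x)"
    and cont: "\<And>b c. b \<in> Basis \<Longrightarrow> c \<in> Basis \<Longrightarrow> continuous_on U (\<lambda>x. u2 b x c)"
  shows C2_onI: "C2_on U u"
    and laplacian_eqI: "\<And>x. x \<in> U \<Longrightarrow> laplacian u x = (\<Sum>b\<in>Basis. u2 b x b)"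
proof -
  have fu: "frechet_derivative u (at x) = u1 x" if "x \<in> U" for x
    using frechet_derivative_at[OF u[OF that]] by simp
  have fu1: "((\<lambda>y. frechet_derivative u (at y) b) has_derivative u2 b x) (at x)" if "x \<in> U" "b \<in> Basis" for x b
    using u1[OF that] \<open>open U\<close> \<open>x \<in> U\<close> by (rule has_derivative_transform_within_open) (simp add: fu)
  have fu2: "frechet_derivative (\<lambda>y. frechet_derivative u (at y) b) (at x) = u2 b x" if "x \<in> U" "b \<in> Basis" for x b
    using frechet_derivative_at[OF fu1[OF that]] by simp
  show "C2_on U u"
    unfolding C2_on_def differentiable_on_eq_differentiable_at[OF \<open>open U\<close>]
    using \<open>open U\<close> u fu1 cont by (auto simp: differentiable_def fu2 cong: continuous_on_cong)
  show "laplacian u x = (\<Sum>b\<in>Basis. u2 b x b)" if "x \<in> U" for x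
    using that by (simp add: laplacian_def fu2)
qed

text \<open>Differentiating \<open>u (t x) = u x\<close> in \<open>t\<close> at 1 gives Euler's
  relation for degree 0; differentiating twice in \<open>x\<close> makes the Laplacian homogeneous
  of degree -2. The latter spreads an eigenvalue equation from the unit sphere to all
  \<open>x \<noteq> 0\<close>.\<close>

lemma homogeneous_derivatives:
  fixes u :: "complex ^ 'm::finite \<Rightarrow> complex"
  assumes C2: "C2_on (- {0}) u" and hom: "\<And>t x. 0 < t \<Longrightarrow> u (t *\<^sub>R x) = u x"
    and "x \<noteq> 0"
  shows "frechet_derivative u (at x) x = 0"
    and "0 < t \<Longrightarrow> t\<^sup>2 *\<^sub>R laplacian u (t *\<^sub>R x) = laplacian u x"
proof -
  note D = C2_onD[OF C2]
  have scale: "((\<lambda>x. t *\<^sub>R x) has_derivative (\<lambda>v. t *\<^sub>R v)) (at x)" for x :: "complex ^ 'm" and t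
    by (auto intro!: derivative_eq_intros)
  show "frechet_derivative u (at x) x = 0"
  proof -
    have "((\<lambda>t. t *\<^sub>R x) has_derivative (\<lambda>h. h *\<^sub>R x)) (at 1)"
      by (auto intro!: derivative_eq_intros)
    then have "((\<lambda>t. u (t *\<^sub>R x)) has_derivative (\<lambda>h. frechet_derivative u (at x) (h *\<^sub>R x))) (at 1)"
      using has_derivative_compose[of "\<lambda>t. t *\<^sub>R x" "\<lambda>h. h *\<^sub>R x" 1 UNIV u "frechet_derivative u (at x)"] D(2)[of x] \<open>x \<noteq> 0\<close>
      by simp
    then have "((\<lambda>t. u x) has_derivative (\<lambda>h. frechet_derivative u (at x) (h *\<^sub>R x))) (at 1)"
      by (rule has_derivative_transform_within_open[where s = "{0<..}"]) (auto simp: hom)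
    then have "(\<lambda>h. frechet_derivative u (at x) (h *\<^sub>R x)) = (\<lambda>h. 0)"
      by (rule has_derivative_unique) (rule has_derivative_const)
    then show ?thesis
      by (metis scaleR_one)
  qed
  assume "0 < t"
  have first: "t *\<^sub>R frechet_derivative u (at (t *\<^sub>R y)) v = frechet_derivative u (at y) v" if "y \<noteq> 0" for y v
  proof -
    have "((\<lambda>y. u (t *\<^sub>R y)) has_derivative (\<lambda>v. frechet_derivative u (at (t *\<^sub>R y)) (t *\<^sub>R v))) (at y)"
      using has_derivative_compose[OF scale D(2)] that \<open>0 < t\<close> by auto
    then have "(u has_derivative (\<lambda>v. frechet_derivative u (at (t *\<^sub>R y)) (t *\<^sub>R v))) (at y)"
      using hom \<open>0 < t\<close> by simp
    then have "frechet_derivative u (at y) = (\<lambda>v. frechet_derivative u (at (t *\<^sub>R y)) (t *\<^sub>R v))"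
      using D(2)[of y] that by (auto intro: has_derivative_unique)
    moreover have "linear (frechet_derivative u (at (t *\<^sub>R y)))"
      using D(2)[of "t *\<^sub>R y"] that \<open>0 < t\<close> by (auto intro: has_derivative_linear)
    ultimately show ?thesis
      by (simp add: linear_scale)
  qed
  have second: "t\<^sup>2 *\<^sub>R frechet_derivative (\<lambda>y. frechet_derivative u (at y) b) (at (t *\<^sub>R x)) b
      = frechet_derivative (\<lambda>y. frechet_derivative u (at y) b) (at x) b" if "b \<in> Basis" for b
  proof -
    let ?D = "\<lambda>y. frechet_derivative u (at y) b"
    let ?DD = "\<lambda>x. frechet_derivative ?D (at x)"
    have "((\<lambda>y. t *\<^sub>R ?D (t *\<^sub>R y)) has_derivative (\<lambda>v. t *\<^sub>R ?DD (t *\<^sub>R x) (t *\<^sub>R v))) (at x)"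
      using has_derivative_scaleR_right[OF has_derivative_compose[OF scale D(3)]] that \<open>x \<noteq> 0\<close> \<open>0 < t\<close> by auto
    then have "(?D has_derivative (\<lambda>v. t *\<^sub>R ?DD (t *\<^sub>R x) (t *\<^sub>R v))) (at x)"
      by (rule has_derivative_transform_within_open[where s = "- {0}"]) (use \<open>x \<noteq> 0\<close> first in auto)
    then have "?DD x = (\<lambda>v. t *\<^sub>R ?DD (t *\<^sub>R x) (t *\<^sub>R v))"
      using D(3)[of x b] that \<open>x \<noteq> 0\<close> by (auto intro: has_derivative_unique)
    moreover have "linear (?DD (t *\<^sub>R x))"
      using D(3)[of "t *\<^sub>R x" b] that \<open>x \<noteq> 0\<close> \<open>0 < t\<close> by (auto intro: has_derivative_linear)
    ultimately show ?thesis
      by (simp add: linear_scale power2_eq_square)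
  qed
  show "t\<^sup>2 *\<^sub>R laplacian u (t *\<^sub>R x) = laplacian u x"
    unfolding laplacian_def scaleR_right.sum by (intro sum.cong refl second)
qed

text \<open>Up to the factor \<open>\<nu> - \<mu>\<close> the integrand is the divergence of
  \<open>\<Phi>(|x|^2) (w grad u - u grad w)\<close> with \<open>\<Phi>(s) = s \<eta>(s)\<close>.
  The term with the derivative of \<open>\<Phi>\<close> meets only radial derivatives of
  \<open>u\<close> and \<open>w\<close>, which vanish by homogeneity, and the weight
  \<open>s\<close> supplies the \<open>|x|^2\<close> of the eigenvalue equations. The cutoff gives
  compact support away from the singularity at 0.\<close>

lemma green_homogeneous:
  fixes u w :: "complex ^ 'm::finite \<Rightarrow> complex" and \<eta> \<eta>' :: "real \<Rightarrow> real"
  assumes u: "C2_on (- {0}) u" "\<And>t x. 0 < t \<Longrightarrow> u (t *\<^sub>R x) = u x"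
      "\<And>x. x \<noteq> 0 \<Longrightarrow> (norm x)\<^sup>2 *\<^sub>R laplacian u x = - of_real \<mu> * u x"
    and w: "C2_on (- {0}) w" "\<And>t x. 0 < t \<Longrightarrow> w (t *\<^sub>R x) = w x"
      "\<And>x. x \<noteq> 0 \<Longrightarrow> (norm x)\<^sup>2 *\<^sub>R laplacian w x = - of_real \<nu> * w x"
    and \<eta>: "\<And>s. (\<eta> has_real_derivative \<eta>' s) (at s)" "continuous_on UNIV \<eta>'"
    and supp: "0 < \<alpha>" "\<And>s. s < \<alpha> \<Longrightarrow> \<eta> s = 0" "\<And>s. \<beta> < s \<Longrightarrow> \<eta> s = 0"
    and "\<mu> \<noteq> \<nu>"
  shows "(\<integral>x. \<eta> (x \<bullet> x) *\<^sub>R (u x * w x) \<partial>lborel) = 0"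
proof -
  define D where "D f b x = frechet_derivative f (at x) b" for f :: "complex ^ 'm \<Rightarrow> complex" and b x
  define DD where "DD f b x = frechet_derivative (D f b) (at x) b" for f :: "complex ^ 'm \<Rightarrow> complex" and b x
  have DD_D: "\<And>x b. x \<noteq> 0 \<Longrightarrow> b \<in> Basis \<Longrightarrow> (D f b has_derivative frechet_derivative (D f b) (at x)) (at x)"
    and D_f: "\<And>x. x \<noteq> 0 \<Longrightarrow> (f has_derivative frechet_derivative f (at x)) (at x)"
    and cont_DD: "\<And>b. b \<in> Basis \<Longrightarrow> continuous_on (- {0}) (DD f b)"
    if "C2_on (- {0}) f" for f
    using C2_onD[OF that] by (auto simp: D_def[abs_def] DD_def[abs_def])
  define \<Phi> where "\<Phi> s = s * \<eta> s" for s
  define \<Phi>' where "\<Phi>' s = \<eta> s + s * \<eta>' s" for s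
  have d\<Phi>: "(\<Phi> has_real_derivative \<Phi>' s) (at s)" for s
    unfolding \<Phi>_def \<Phi>'_def using DERIV_mult[OF DERIV_ident \<eta>(1)] by (simp add: mult.commute)
  \<comment> \<open>\<open>\<eta>\<close> vanishes on an open half line, hence so does its
    derivative.\<close>
  have \<eta>'_0: "\<eta>' s = 0" if "s < \<alpha>" for s
  proof (rule DERIV_unique[OF \<eta>(1)])
    show "(\<eta> has_real_derivative 0) (at s)"
      using DERIV_const[of 0] by (rule has_field_derivative_transform_within_open[where S = "{..<\<alpha>}"]) (use that supp in auto)
  qed
  have cont\<eta>: "continuous_on UNIV \<eta>"
    using \<eta>(1) by (auto intro!: continuous_at_imp_continuous_on DERIV_continuous)
  define h where "h b x = \<Phi> (x \<bullet> x) *\<^sub>R (w x * D u b x - u x * D w b x)" for b x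
  define h' where "h' b x = (2 * (x \<bullet> b) * \<Phi>' (x \<bullet> x)) *\<^sub>R (w x * D u b x - u x * D w b x)
      + \<Phi> (x \<bullet> x) *\<^sub>R (w x * DD u b x - u x * DD w b x)" for b x
  have near_0: "x \<bullet> x < \<alpha> \<Longrightarrow> \<Phi> (x \<bullet> x) = 0 \<and> \<Phi>' (x \<bullet> x) = 0" for x :: "complex ^ 'm"
    using supp \<eta>'_0 by (simp add: \<Phi>_def \<Phi>'_def)
  have open_near: "open {x::complex ^ 'm. x \<bullet> x < \<alpha>}"
    by (intro open_Collect_less continuous_intros)
  \<comment> \<open>\<open>u\<close> and \<open>w\<close> are regular only off the origin;
    regularity of the field is checked there and extended by 0 across the ball on which the cutoff
    vanishes.\<close>
  have cover: "UNIV = (- {0}) \<union> {x::complex ^ 'm. x \<bullet> x < \<alpha>}"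
    using supp(1) by auto
  have h_deriv: "((\<lambda>t. h b (x + t *\<^sub>R b)) has_vector_derivative h' b (x + t *\<^sub>R b)) (at t)" if b: "b \<in> Basis" for b x t
  proof -
    define y where "y = x + t *\<^sub>R b"
    have line: "((\<lambda>t. x + t *\<^sub>R b) has_derivative (\<lambda>s. s *\<^sub>R b)) (at t)"
      by (auto intro!: derivative_eq_intros)
    have along: "((\<lambda>t. f (x + t *\<^sub>R b)) has_vector_derivative f' b) (at t)"
      if "(f has_derivative f') (at y)" for f :: "complex ^ 'm \<Rightarrow> complex" and f'
    proof -
      have "((\<lambda>t. f (x + t *\<^sub>R b)) has_derivative (\<lambda>s. f' (s *\<^sub>R b))) (at t)"
        using has_derivative_compose[OF line, of f f'] that by (simp add: y_def)
      moreover have "f' (s *\<^sub>R b) = s *\<^sub>R f' b" for s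
        using has_derivative_linear[OF that] by (rule linear_scale)
      ultimately show ?thesis
        by (simp add: has_vector_derivative_def)
    qed
    show ?thesis
    proof (cases "y = 0")
      case True
      have "((\<lambda>t. h b (x + t *\<^sub>R b)) has_vector_derivative 0) (at t)"
      proof (rule has_vector_derivative_transform_within_open[where f = "\<lambda>_. 0" and S = "{t. (x + t *\<^sub>R b) \<bullet> (x + t *\<^sub>R b) < \<alpha>}"])
        show "open {t. (x + t *\<^sub>R b) \<bullet> (x + t *\<^sub>R b) < \<alpha>}"
          by (intro open_Collect_less continuous_intros)
      qed (use True supp(1) near_0 in \<open>auto simp: y_def h_def\<close>)
      moreover have "h' b y = 0"
        using near_0[of y] True supp(1) by (simp add: h'_def)
      ultimately show ?thesis by (simp add: y_def)
    next
      case False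
      have "((\<lambda>t. (x + t *\<^sub>R b) \<bullet> (x + t *\<^sub>R b)) has_real_derivative 2 * (y \<bullet> b)) (at t)"
        unfolding has_field_derivative_def y_def
        by (rule has_derivative_eq_rhs[OF has_derivative_inner[OF line line]]) (auto simp: inner_commute algebra_simps)
      from DERIV_chain2[OF d\<Phi> this]
      have "((\<lambda>t. \<Phi> ((x + t *\<^sub>R b) \<bullet> (x + t *\<^sub>R b))) has_real_derivative \<Phi>' (y \<bullet> y) * (2 * (y \<bullet> b))) (at t)"
        by (simp add: y_def)
      note d\<Phi>' = this
      have du: "((\<lambda>t. u (x + t *\<^sub>R b)) has_vector_derivative D u b y) (at t)"
          "((\<lambda>t. D u b (x + t *\<^sub>R b)) has_vector_derivative DD u b y) (at t)"
        and dw: "((\<lambda>t. w (x + t *\<^sub>R b)) has_vector_derivative D w b y) (at t)"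
          "((\<lambda>t. D w b (x + t *\<^sub>R b)) has_vector_derivative DD w b y) (at t)"
        using along[OF D_f[OF u(1) False]] along[OF D_f[OF w(1) False]] along[OF DD_D[OF u(1) False b]] along[OF DD_D[OF w(1) False b]]
        by (auto simp: D_def DD_def)
      have "((\<lambda>t. h b (x + t *\<^sub>R b)) has_vector_derivative
         \<Phi> (y \<bullet> y) *\<^sub>R (w y * DD u b y + D w b y * D u b y - (u y * DD w b y + D u b y * D w b y))
          + (\<Phi>' (y \<bullet> y) * (2 * (y \<bullet> b))) *\<^sub>R (w y * D u b y - u y * D w b y)) (at t)"
        unfolding h_def
        using has_vector_derivative_scaleR[OF d\<Phi>' has_vector_derivative_diff[OF has_vector_derivative_mult[OF dw(1) du(2)] has_vector_derivative_mult[OF du(1) dw(2)]]]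
        by (simp add: y_def)
      then show ?thesis
        by (simp add: h'_def y_def algebra_simps)
    qed
  qed
  have cont_u: "continuous_on (- {0}) f" "b \<in> Basis \<Longrightarrow> continuous_on (- {0}) (D f b)"
    if "C2_on (- {0}) f" for f b
    using D_f[OF that] DD_D[OF that]
    by (auto intro!: continuous_at_imp_continuous_on has_derivative_continuous)
  have contI: "continuous_on UNIV f" if "continuous_on (- {0}) f" "\<And>x. x \<bullet> x < \<alpha> \<Longrightarrow> f x = 0" for f :: "complex ^ 'm \<Rightarrow> complex"
  proof -
    have "continuous_on {x. x \<bullet> x < \<alpha>} f \<longleftrightarrow> continuous_on {x::complex ^ 'm. x \<bullet> x < \<alpha>} (\<lambda>_. 0 :: complex)"
      using that(2) by (intro continuous_on_cong) auto
    then have "continuous_on {x. x \<bullet> x < \<alpha>} f"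
      by simp
    then show ?thesis
      unfolding cover using that(1) open_near by (intro continuous_on_open_Un) auto
  qed
  have cont_inner: "continuous_on A (\<lambda>x::complex ^ 'm. f (x \<bullet> x))" if "continuous_on UNIV f" for f :: "real \<Rightarrow> real" and A
    by (rule continuous_on_compose2[OF that]) (auto intro!: continuous_intros)
  have cont\<Phi>: "continuous_on UNIV \<Phi>" "continuous_on UNIV \<Phi>'"
    unfolding \<Phi>_def \<Phi>'_def using cont\<eta> \<eta>(2) by (auto intro!: continuous_intros)
  have cont_h: "continuous_on UNIV (h b)" "continuous_on UNIV (h' b)" if "b \<in> Basis" for b
  proof -
    show "continuous_on UNIV (h b)"
      using that near_0 unfolding h_def
      by (intro contI continuous_intros cont_inner cont\<Phi> cont_u u(1) w(1)) auto
    show "continuous_on UNIV (h' b)"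
      using that near_0 unfolding h'_def
      by (intro contI continuous_intros cont_inner cont\<Phi> cont_u u(1) w(1) cont_DD) auto
  qed
  have h_supp: "h b x = 0" if "sqrt \<bar>\<beta>\<bar> < norm x" for b x
  proof -
    have "\<bar>\<beta>\<bar> < (norm x)\<^sup>2"
      using that real_less_lsqrt[of "norm x" "\<bar>\<beta>\<bar>"] by (metis abs_ge_zero norm_ge_zero not_le real_le_rsqrt)
    then have "\<beta> < x \<bullet> x"
      by (simp add: power2_norm_eq_inner)
    then show ?thesis
      using supp(3) by (simp add: h_def \<Phi>_def)
  qed
  have zero: "integrable lborel (h' b)" "integral\<^sup>L lborel (h' b) = 0" if "b \<in> Basis" for b
    using integral_directional_derivative_eq_0[OF cont_h(1)[OF that] cont_h(2)[OF that] h_deriv[OF that] h_supp]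
    by auto
  have sum_h': "(\<Sum>b\<in>Basis. h' b x) = (\<nu> - \<mu>) *\<^sub>R (\<eta> (x \<bullet> x) *\<^sub>R (u x * w x))" for x
  proof (cases "x = 0")
    case True
    then show ?thesis
      using near_0[of x] supp(1,2) by (simp add: h'_def)
  next
    case False
    have radial: "(\<Sum>b\<in>Basis. (x \<bullet> b) *\<^sub>R D f b x) = 0" if "C2_on (- {0}) f" "\<And>t x. 0 < t \<Longrightarrow> f (t *\<^sub>R x) = f x" for f
    proof -
      have "linear (frechet_derivative f (at x))"
        using D_f[OF that(1) False] by (rule has_derivative_linear)
      then have "(\<Sum>b\<in>Basis. (x \<bullet> b) *\<^sub>R D f b x) = frechet_derivative f (at x) (\<Sum>b\<in>Basis. (x \<bullet> b) *\<^sub>R b)"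
        by (simp add: linear_sum linear_scale D_def)
      also have "\<dots> = 0"
        using homogeneous_derivatives(1)[OF that False] by (simp add: euclidean_representation)
      finally show ?thesis .
    qed
    have lap: "(\<Sum>b\<in>Basis. DD f b x) = laplacian f x" for f
      by (simp add: laplacian_def DD_def D_def[abs_def])
    have "h' b x = (2 * \<Phi>' (x \<bullet> x)) *\<^sub>R (w x * ((x \<bullet> b) *\<^sub>R D u b x) - u x * ((x \<bullet> b) *\<^sub>R D w b x))
      + \<Phi> (x \<bullet> x) *\<^sub>R (w x * DD u b x - u x * DD w b x)" for b
      by (simp add: h'_def scaleR_right_diff_distrib mult.commute mult.left_commute)
    then have "(\<Sum>b\<in>Basis. h' b x) = (2 * \<Phi>' (x \<bullet> x)) *\<^sub>R (w x * (\<Sum>b\<in>Basis. (x \<bullet> b) *\<^sub>R D u b x) - u x * (\<Sum>b\<in>Basis. (x \<bullet> b) *\<^sub>R D w b x))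
      + \<Phi> (x \<bullet> x) *\<^sub>R (w x * (\<Sum>b\<in>Basis. DD u b x) - u x * (\<Sum>b\<in>Basis. DD w b x))"
      by (simp only: sum.distrib sum_subtractf sum_distrib_left scaleR_right.sum scaleR_right_diff_distrib)
    also have "\<dots> = \<eta> (x \<bullet> x) *\<^sub>R (w x * ((norm x)\<^sup>2 *\<^sub>R laplacian u x) - u x * ((norm x)\<^sup>2 *\<^sub>R laplacian w x))"
    proof -
      have "(\<Sum>b\<in>Basis. (x \<bullet> b) *\<^sub>R D u b x) = 0" "(\<Sum>b\<in>Basis. (x \<bullet> b) *\<^sub>R D w b x) = 0"
        using radial u(1,2) w(1,2) by blast+
      then show ?thesis
        by (simp only: lap) (simp add: \<Phi>_def power2_norm_eq_inner scaleR_right_diff_distrib mult.commute)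
    qed
    also have "\<dots> = (\<nu> - \<mu>) *\<^sub>R (\<eta> (x \<bullet> x) *\<^sub>R (u x * w x))"
      unfolding u(3)[OF False] w(3)[OF False] by (simp add: scaleR_conv_of_real algebra_simps)
    finally show ?thesis .
  qed
  have "0 = (\<Sum>b\<in>Basis. integral\<^sup>L lborel (h' b))"
    using zero(2) by simp
  also have "\<dots> = (\<integral>x. (\<Sum>b\<in>Basis. h' b x) \<partial>lborel)"
    using zero(1) by (subst Bochner_Integration.integral_sum) auto
  also have "\<dots> = (\<nu> - \<mu>) *\<^sub>R (\<integral>x. \<eta> (x \<bullet> x) *\<^sub>R (u x * w x) \<partial>lborel)"
    unfolding sum_h' by (rule integral_scaleR_right)
  finally show ?thesis
    using \<open>\<mu> \<noteq> \<nu>\<close> by simp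
qed

section \<open>Orthogonality of eigenfunctions\<close>

lemma LB_eigenfun_ext:
  assumes "LB_eigenfun Y \<mu>"
  defines "u \<equiv> (\<lambda>y. Y (y /\<^sub>R norm y))"
  shows "C2_on (- {0}) u" and "\<And>t x. 0 < t \<Longrightarrow> u (t *\<^sub>R x) = u x"
    and "\<And>x. x \<noteq> 0 \<Longrightarrow> (norm x)\<^sup>2 *\<^sub>R laplacian u x = - of_real \<mu> * u x"
    and "continuous_on (sphere 0 1) Y" "u \<in> borel_measurable borel"
proof -
  show C2: "C2_on (- {0}) u"
    using assms unfolding LB_eigenfun_def u_def by simp
  show hom: "u (t *\<^sub>R x) = u x" if "0 < t" for t x
  proof -
    have "inverse (norm (t *\<^sub>R x)) * t = inverse (norm x)"
      using that by (simp add: field_simps)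
    then show ?thesis
      unfolding u_def scaleR_scaleR by (rule arg_cong[where f = "\<lambda>c. Y (c *\<^sub>R x)"])
  qed
  have u_unit: "u x = Y x" if "x \<in> sphere 0 1" for x
    using that by (simp add: u_def)
  show "(norm x)\<^sup>2 *\<^sub>R laplacian u x = - of_real \<mu> * u x" if "x \<noteq> 0" for x
  proof -
    define t where "t = 1 / norm x"
    have "0 < t" "t *\<^sub>R x \<in> sphere 0 1"
      using that by (auto simp: t_def)
    have "laplacian u (t *\<^sub>R x) = - laplace_beltrami Y (t *\<^sub>R x)"
      by (simp add: laplace_beltrami_def u_def)
    also have "\<dots> = - of_real \<mu> * u x"
    proof -
      have "laplace_beltrami Y (t *\<^sub>R x) = of_real \<mu> * Y (t *\<^sub>R x)"
        using assms(1) \<open>t *\<^sub>R x \<in> sphere 0 1\<close> unfolding LB_eigenfun_def by blast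
      also have "Y (t *\<^sub>R x) = u x"
        using u_unit[OF \<open>t *\<^sub>R x \<in> sphere 0 1\<close>] hom[OF \<open>0 < t\<close>] by metis
      finally show ?thesis by simp
    qed
    finally have "(norm x)\<^sup>2 *\<^sub>R laplacian u x = (norm x)\<^sup>2 *\<^sub>R (t\<^sup>2 *\<^sub>R (- of_real \<mu> * u x))"
      using homogeneous_derivatives(2)[OF C2 hom that \<open>0 < t\<close>] by simp
    also have "\<dots> = - of_real \<mu> * u x"
      using that by (simp add: t_def power_one_over)
    finally show ?thesis .
  qed
  have cont: "continuous_on (- {0}) u"
    using C2_onD(2)[OF C2] by (auto intro!: continuous_at_imp_continuous_on has_derivative_continuous)
  then have "continuous_on (sphere 0 1) u"
    by (rule continuous_on_subset) auto
  then show "continuous_on (sphere 0 1) Y"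
    by (rule continuous_on_eq) (rule u_unit)
  \<comment> \<open>Since \<open>inverse 0 = 0\<close>, the extension takes the value
    \<open>Y 0\<close> at the origin, and this is 0 because eigenfunctions vanish off the
    sphere.\<close>
  have "u 0 = 0"
    using assms(1) by (simp add: u_def LB_eigenfun_def)
  then have "u = (\<lambda>x. indicator (- {0}) x *\<^sub>R u x)"
    by (auto simp: indicator_def)
  then show "u \<in> borel_measurable borel"
    using borel_measurable_continuous_on_indicator[OF _ cont] by simp
qed

text \<open>The cutoffs converge boundedly to the indicator of \<open>(0, 1]\<close>; truncating a square makes them \<open>C\<^sup>1\<close>.\<close>
lemma radial_cutoff:
  fixes n :: nat
  defines "j \<equiv> real (Suc n)"
  defines "P \<equiv> (\<lambda>s::real. j\<^sup>2 * (s * (1 + 1 / j - s)) - 1)"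
  defines "\<eta> \<equiv> (\<lambda>s. (max 0 (P s))\<^sup>2 / (1 + (P s)\<^sup>2))"
  shows "\<exists>\<eta>'. (\<forall>s. (\<eta> has_real_derivative \<eta>' s) (at s)) \<and> continuous_on UNIV \<eta>'"
    and "s < 1 / (2 * j\<^sup>2) \<Longrightarrow> \<eta> s = 0"
    and "1 + 1 / j < s \<Longrightarrow> \<eta> s = 0"
    and "0 \<le> \<eta> s" "\<eta> s \<le> 1"
    and "0 < s \<Longrightarrow> s \<le> 1 \<Longrightarrow> 1 < j * s \<Longrightarrow> 1 - 1 / (1 + (j * s - 1)\<^sup>2) \<le> \<eta> s"
proof -
  have "0 < j" "0 < 1 / j" "1 / j \<le> 1" by (auto simp: j_def)
  \<comment> \<open>The positive part has a corner at 0, its square does not: the difference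
    quotient there is at most \<open>|h|\<close>.\<close>
  have dmax: "((\<lambda>y. (max 0 y)\<^sup>2) has_real_derivative 2 * max 0 y) (at y)" for y :: real
  proof (cases "y = 0")
    case True
    have "(\<lambda>h. (max 0 h)\<^sup>2 / h) \<midarrow>0\<rightarrow> (0::real)"
    proof (rule Lim_null_comparison)
      show "\<forall>\<^sub>F h in at 0. norm ((max 0 h)\<^sup>2 / h) \<le> \<bar>h :: real\<bar>"
        by (intro always_eventually) (auto simp: max_def power2_eq_square)
      show "((\<lambda>h. \<bar>h::real\<bar>) \<longlongrightarrow> 0) (at 0)"
        using tendsto_rabs[OF tendsto_ident_at[of "0::real" UNIV]] by simp
    qed
    then show ?thesis
      using True by (simp add: has_field_derivative_def field_has_derivative_at DERIV_def)
  next
    case False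
    show ?thesis
    proof (cases "0 < y")
      case True
      have "((\<lambda>y. y\<^sup>2) has_real_derivative 2 * max 0 y) (at y)"
        using True by (auto intro!: derivative_eq_intros)
      then show ?thesis
        by (rule has_field_derivative_transform_within_open[where S = "{0<..}"]) (use True in auto)
    next
      case False
      with \<open>y \<noteq> 0\<close> have "((\<lambda>y. 0) has_real_derivative 2 * max 0 y) (at y)"
        by (simp add: max_def)
      then show ?thesis
        by (rule has_field_derivative_transform_within_open[where S = "{..<0}"]) (use False \<open>y \<noteq> 0\<close> in auto)
    qed
  qed
  have pos: "1 + (P s)\<^sup>2 \<noteq> 0" for s
    using zero_le_power2[of "P s"] by linarith
  define P' where "P' s = j\<^sup>2 * (1 + 1 / j - 2 * s)" for s
  have dP: "(P has_real_derivative P' s) (at s)" for s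
    unfolding P_def P'_def using \<open>0 < j\<close> by (auto intro!: derivative_eq_intros simp: algebra_simps)
  define \<eta>' where "\<eta>' s = ((2 * max 0 (P s) * P' s) * (1 + (P s)\<^sup>2) - (max 0 (P s))\<^sup>2 * (2 * P s * P' s))
      / ((1 + (P s)\<^sup>2) * (1 + (P s)\<^sup>2))" for s
  have "(\<eta> has_real_derivative \<eta>' s) (at s)" for s
  proof -
    have num: "((\<lambda>s. (max 0 (P s))\<^sup>2) has_real_derivative 2 * max 0 (P s) * P' s) (at s)"
      by (rule DERIV_chain2[OF dmax dP])
    have den: "((\<lambda>s. 1 + (P s)\<^sup>2) has_real_derivative 2 * P s * P' s) (at s)"
      by (auto intro!: derivative_eq_intros dP)
    show ?thesis
      unfolding \<eta>_def \<eta>'_def by (rule DERIV_divide[OF num den pos])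
  qed
  moreover have "continuous_on UNIV \<eta>'"
    unfolding \<eta>'_def P'_def P_def using pos unfolding P_def by (intro continuous_intros) auto
  ultimately show "\<exists>\<eta>'. (\<forall>s. (\<eta> has_real_derivative \<eta>' s) (at s)) \<and> continuous_on UNIV \<eta>'"
    by blast
  \<comment> \<open>\<open>P\<close> is nonpositive to the left of \<open>1 / (2 j^2)\<close> and to
    the right of \<open>1 + 1 / j\<close>, and at least \<open>j s - 1\<close> on
    \<open>(0, 1]\<close>. So the support shrinks to the unit interval as \<open>j\<close> grows,
    while the values on \<open>(0, 1]\<close> tend to 1.\<close>
  have zero: "\<eta> s = 0" if "P s \<le> 0" for s
    using that by (simp add: \<eta>_def max_def)
  show "\<eta> s = 0" if "s < 1 / (2 * j\<^sup>2)"
  proof (rule zero, cases "s \<le> 0")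
    case True
    then have "s * (1 + 1 / j - s) \<le> 0"
      using \<open>0 < 1 / j\<close> by (intro mult_nonpos_nonneg) linarith+
    then have "j\<^sup>2 * (s * (1 + 1 / j - s)) \<le> 0"
      by (rule mult_nonneg_nonpos[rotated]) simp
    then show "P s \<le> 0" by (simp add: P_def)
  next
    case False
    have "j\<^sup>2 * (s * (1 + 1 / j - s)) \<le> j\<^sup>2 * (s * 2)"
      using False \<open>1 / j \<le> 1\<close> by (intro mult_left_mono) auto
    also have "\<dots> \<le> 1"
      using that \<open>0 < j\<close> by (simp add: field_simps)
    finally show "P s \<le> 0" by (simp add: P_def)
  qed
  show "\<eta> s = 0" if "1 + 1 / j < s"
  proof (rule zero)
    have "0 < s" using that \<open>0 < 1 / j\<close> by linarith
    then have "s * (1 + 1 / j - s) \<le> 0"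
      using that by (intro mult_nonneg_nonpos) auto
    then have "j\<^sup>2 * (s * (1 + 1 / j - s)) \<le> 0"
      by (rule mult_nonneg_nonpos[rotated]) simp
    then show "P s \<le> 0" by (simp add: P_def)
  qed
  show "0 \<le> \<eta> s" by (simp add: \<eta>_def)
  have "(max 0 y)\<^sup>2 \<le> y\<^sup>2" for y :: real by (simp add: max_def)
  then show "\<eta> s \<le> 1"
    unfolding \<eta>_def by (simp add: divide_le_eq add_pos_nonneg add_increasing)
  show "1 - 1 / (1 + (j * s - 1)\<^sup>2) \<le> \<eta> s" if "0 < s" "s \<le> 1" "1 < j * s"
  proof -
    have "j * s = j\<^sup>2 * (s * (1 / j))"
      using \<open>0 < j\<close> by (simp add: power2_eq_square)
    also have "\<dots> \<le> j\<^sup>2 * (s * (1 + 1 / j - s))"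
      using that by (intro mult_left_mono) auto
    finally have le: "j * s - 1 \<le> P s" by (simp add: P_def)
    then have "0 \<le> P s" using that by simp
    then have "\<eta> s = 1 - 1 / (1 + (P s)\<^sup>2)"
      using pos by (simp add: \<eta>_def max_def field_simps)
    moreover have "1 / (1 + (P s)\<^sup>2) \<le> 1 / (1 + (j * s - 1)\<^sup>2)"
      using le that by (intro divide_left_mono add_left_mono power_mono) (auto simp: add_pos_nonneg)
    ultimately show ?thesis by linarith
  qed
qed

text \<open>The cutoffs in \<open>green_homogeneous\<close> converge to the indicator of the
  punctured unit ball, which is the domain in \<open>sphere_integral\<close>. The pairing is
  bilinear here; conjugation is added by \<open>LB_eigenfun_cnj\<close>.\<close>

lemma LB_eigenfun_orthogonal:
  assumes Y: "LB_eigenfun Y \<mu>" and Z: "LB_eigenfun Z \<nu>" and "\<mu> \<noteq> \<nu>"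
  shows "(\<integral>x. Y x * Z x \<partial>sphere_measure) = 0"
proof -
  define u where "u y = Y (y /\<^sub>R norm y)" for y
  define w where "w y = Z (y /\<^sub>R norm y)" for y
  note u = LB_eigenfun_ext[OF Y, folded u_def] and w = LB_eigenfun_ext[OF Z, folded w_def]
  define P where "P n s = (real (Suc n))\<^sup>2 * (s * (1 + 1 / real (Suc n) - s)) - 1" for n and s :: real
  define \<eta> where "\<eta> n s = (max 0 (P n s))\<^sup>2 / (1 + (P n s)\<^sup>2)" for n s
  note \<eta> = radial_cutoff[folded P_def, folded \<eta>_def]
  have zero: "(\<integral>x. \<eta> n (x \<bullet> x) *\<^sub>R (u x * w x) \<partial>lborel) = 0" for n
  proof -
    obtain \<eta>' where \<eta>': "\<And>s. (\<eta> n has_real_derivative \<eta>' s) (at s)" "continuous_on UNIV \<eta>'"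
      using \<eta>(1)[of n] by (auto simp: \<eta>_def[abs_def])
    show ?thesis
    proof (rule green_homogeneous[OF u(1-3) w(1-3) \<eta>', where \<alpha> = "1 / (2 * (real (Suc n))\<^sup>2)" and \<beta> = "1 + 1 / real (Suc n)"])
    qed (use \<eta>(2,3) \<open>\<mu> \<noteq> \<nu>\<close> in auto)
  qed
  obtain A where A: "0 \<le> A" "\<And>x. x \<in> sphere 0 1 \<Longrightarrow> norm (Y x) \<le> A"
    using sphere_bounded_continuous[OF u(4)] by blast
  obtain B where B: "0 \<le> B" "\<And>x. x \<in> sphere 0 1 \<Longrightarrow> norm (Z x) \<le> B"
    using sphere_bounded_continuous[OF w(4)] by blast
  have sphere_normalize: "x /\<^sub>R norm x \<in> sphere 0 1" if "x \<noteq> 0" for x :: "complex ^ 'a"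
    using that by simp
  have uw_le: "norm (u x * w x) \<le> A * B" for x
  proof (cases "x = 0")
    case True
    then show ?thesis using A(1) B(1) Y by (simp add: u_def LB_eigenfun_def)
  next
    case False
    then show ?thesis
      unfolding u_def w_def norm_mult using A B sphere_normalize[OF False] by (intro mult_mono) auto
  qed
  have \<eta>_lim: "(\<lambda>n. \<eta> n (x \<bullet> x) *\<^sub>R (u x * w x)) \<longlonglongrightarrow> indicator (cball 0 1 - {0}) x *\<^sub>R (u x * w x)" for x
  proof (intro tendsto_scaleR tendsto_const)
    consider "x = 0" | "0 < x \<bullet> x" "x \<bullet> x \<le> 1" | "1 < x \<bullet> x"
      by (metis inner_gt_zero_iff not_le)
    then show "(\<lambda>n. \<eta> n (x \<bullet> x)) \<longlonglongrightarrow> indicator (cball 0 1 - {0}) x"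
    proof cases
      case 1
      then show ?thesis using \<eta>(2)[of 0] by simp
    next
      case 2
      define s where "s = x \<bullet> x"
      have "x \<in> cball 0 1 - {0}"
        using 2 by (auto simp: norm_eq_sqrt_inner)
      have inf: "filterlim (\<lambda>n. real (Suc n) * s - 1) at_top sequentially"
      proof -
        have "filterlim (\<lambda>n. s * real (Suc n)) at_top sequentially"
          using 2 by (intro filterlim_tendsto_pos_mult_at_top[OF tendsto_const] filterlim_compose[OF filterlim_real_sequentially filterlim_Suc]) (simp add: s_def)
        from filterlim_tendsto_add_at_top[OF tendsto_const[of "-1"] this]
        show ?thesis by (simp add: mult.commute)
      qed
      have "(\<lambda>n. 1 - 1 / (1 + (real (Suc n) * s - 1)\<^sup>2)) \<longlonglongrightarrow> 1 - 0"
        by (intro tendsto_diff tendsto_const tendsto_divide_0[OF tendsto_const] filterlim_at_top_imp_at_infinity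
            filterlim_tendsto_add_at_top[OF tendsto_const] filterlim_pow_at_top inf) simp
      then have lower: "(\<lambda>n. 1 - 1 / (1 + (real (Suc n) * s - 1)\<^sup>2)) \<longlonglongrightarrow> 1"
        by simp
      have "(\<lambda>n. \<eta> n s) \<longlonglongrightarrow> 1"
      proof (rule tendsto_sandwich[OF _ _ lower tendsto_const])
        show "\<forall>\<^sub>F n in sequentially. 1 - 1 / (1 + (real (Suc n) * s - 1)\<^sup>2) \<le> \<eta> n s"
          using filterlim_at_top_dense[THEN iffD1, OF inf, rule_format, of 0]
        proof (rule eventually_mono)
          fix n assume "0 < real (Suc n) * s - 1"
          then show "1 - 1 / (1 + (real (Suc n) * s - 1)\<^sup>2) \<le> \<eta> n s"
            using \<eta>(6)[of s n] 2 by (simp add: s_def)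
        qed
        show "\<forall>\<^sub>F n in sequentially. \<eta> n s \<le> 1"
          using \<eta>(5) by simp
      qed
      then show ?thesis
        using \<open>x \<in> cball 0 1 - {0}\<close> by (simp add: s_def)
    next
      case 3
      have "x \<notin> cball 0 1 - {0}"
        using 3 by (auto simp: norm_eq_sqrt_inner)
      have "\<forall>\<^sub>F n in sequentially. 1 / real (Suc n) < x \<bullet> x - 1"
        using order_tendstoD(2)[OF LIMSEQ_inverse_real_of_nat, of "x \<bullet> x - 1"] 3 by (simp add: inverse_eq_divide)
      then have "\<forall>\<^sub>F n in sequentially. \<eta> n (x \<bullet> x) = 0"
        by (rule eventually_mono) (rule \<eta>(3), simp)
      then show ?thesis
        using \<open>x \<notin> cball 0 1 - {0}\<close> by (simp add: tendsto_eventually)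
    qed
  qed
  have \<eta>_meas: "\<eta> n \<in> borel_measurable borel" for n
  proof -
    obtain \<eta>' where "\<And>s. (\<eta> n has_real_derivative \<eta>' s) (at s)"
      using \<eta>(1)[of n] by (auto simp: \<eta>_def[abs_def])
    then show ?thesis
      by (intro borel_measurable_continuous_onI continuous_at_imp_continuous_on ballI) (rule DERIV_isCont)
  qed
  have uw_meas: "(\<lambda>x. u x * w x) \<in> borel_measurable borel"
    by (intro borel_measurable_times u(5) w(5))
  have "(\<lambda>n. (\<integral>x. \<eta> n (x \<bullet> x) *\<^sub>R (u x * w x) \<partial>lborel)) \<longlonglongrightarrow> (\<integral>x. indicator (cball 0 1 - {0}) x *\<^sub>R (u x * w x) \<partial>lborel)"
  \<comment> \<open>All cutoffs vanish for \<open>x \<bullet> x > 2\<close>, because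
    \<open>1 + 1 / real (Suc n) \<le> 2\<close>.\<close>
  proof (rule integral_dominated_convergence[where w = "\<lambda>x. indicator (cball 0 (sqrt 2)) x * (A * B)"])
    show "integrable lborel (\<lambda>x::complex ^ 'a. indicator (cball 0 (sqrt 2)) x * (A * B))"
      using emeasure_lborel_cball_finite[of "0::complex ^ 'a" "sqrt 2"] by (intro integrable_mult_left integrable_real_indicator) auto
    fix n
    show "AE x in lborel. norm (\<eta> n (x \<bullet> x) *\<^sub>R (u x * w x)) \<le> indicator (cball 0 (sqrt 2)) x * (A * B)"
    proof (intro AE_I2)
      fix x
      show "norm (\<eta> n (x \<bullet> x) *\<^sub>R (u x * w x)) \<le> indicator (cball 0 (sqrt 2)) x * (A * B)"
      proof (cases "norm x \<le> sqrt 2")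
        case True
        have "norm (\<eta> n (x \<bullet> x) *\<^sub>R (u x * w x)) \<le> 1 * (A * B)"
          unfolding norm_scaleR using \<eta>(4,5)[of n "x \<bullet> x"] uw_le by (intro mult_mono) auto
        then show ?thesis using True by simp
      next
        case False
        have "1 + 1 / real (Suc n) \<le> 2" by simp
        moreover have "2 < x \<bullet> x"
          using False by (simp add: norm_eq_sqrt_inner)
        ultimately have "\<eta> n (x \<bullet> x) = 0"
          by (intro \<eta>(3)) linarith
        then show ?thesis using A(1) B(1) by simp
      qed
    qed
    show "(\<lambda>x. \<eta> n (x \<bullet> x) *\<^sub>R (u x * w x)) \<in> borel_measurable lborel"
      using uw_meas by (auto intro!: borel_measurable_scaleR measurable_compose[OF _ \<eta>_meas])
  qed (use \<eta>_lim uw_meas in \<open>auto intro!: borel_measurable_scaleR borel_measurable_indicator\<close>)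
  then have "(\<integral>x. indicator (cball 0 1 - {0}) x *\<^sub>R (u x * w x) \<partial>lborel) = 0"
    unfolding zero by (simp add: LIMSEQ_const_iff)
  moreover have "(\<integral>x. Y x * Z x \<partial>sphere_measure)
     = real (2 * CARD('a)) *\<^sub>R (\<integral>x. indicator (cball 0 1 - {0}) x *\<^sub>R (u x * w x) \<partial>lborel)"
    unfolding u_def w_def
    using u(4) w(4) by (intro sphere_integral sphere_measurable_continuous continuous_on_mult)
  ultimately show ?thesis by simp
qed

text \<open>The eigenvalue is real, so conjugation respects the equation; this turns bilinear
  orthogonality into Hermitian orthogonality.\<close>

lemma LB_eigenfun_cnj:
  assumes "LB_eigenfun Y \<mu>"
  shows "LB_eigenfun (\<lambda>x. cnj (Y x)) \<mu>"
proof -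
  define u where "u y = Y (y /\<^sub>R norm y)" for y
  have C2: "C2_on (- {0}) u"
    using assms by (simp add: LB_eigenfun_def u_def[abs_def])
  note D = C2_onD[OF C2]
  note conds = D(1) has_derivative_cnj[OF D(2)] has_derivative_cnj[OF D(3)] continuous_on_cnj[OF D(4)]
  have 1: "C2_on (- {0}) (\<lambda>y. cnj (u y))"
    by (rule C2_onI[OF conds])
  have 2: "laplacian (\<lambda>y. cnj (u y)) x = cnj (laplacian u x)" if "x \<noteq> 0" for x
    using laplacian_eqI[OF conds, of x] that by (simp add: laplacian_def)
  have "laplace_beltrami (\<lambda>x. cnj (Y x)) x = of_real \<mu> * cnj (Y x)" if "x \<in> sphere 0 1" for x
  proof -
    have "x \<noteq> 0" using that by auto
    have "laplace_beltrami (\<lambda>x. cnj (Y x)) x = cnj (laplace_beltrami Y x)"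
      using 2[OF \<open>x \<noteq> 0\<close>] by (simp add: laplace_beltrami_def u_def[abs_def])
    then show ?thesis
      using assms that by (simp add: LB_eigenfun_def)
  qed
  then show ?thesis
    using assms 1 unfolding LB_eigenfun_def u_def[abs_def] by simp
qed

section \<open>Monomials as eigenfunctions\<close>

text \<open>Pairs the real directions \<open>1\<close> and \<open>\<i>\<close> of each complex
  coordinate, in which the second derivatives of a holomorphic function cancel.\<close>

lemma sum_Basis_vec:
  fixes f :: "complex ^ 'm::finite \<Rightarrow> 'b::ab_group_add"
  shows "(\<Sum>b\<in>Basis. f b) = (\<Sum>i\<in>UNIV. f (axis i 1) + f (axis i \<i>))"
proof -
  have Basis_eq: "(Basis :: (complex ^ 'm) set) = (\<lambda>(i, u). axis i u) ` (UNIV \<times> {1, \<i>})"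
    by (auto simp: Basis_vec_def Basis_complex_def)
  have "inj_on (\<lambda>(i::'m, u::complex). axis i u) (UNIV \<times> {1, \<i>})"
    by (auto simp: inj_on_def axis_eq_axis)
  then have "(\<Sum>b\<in>Basis. f b) = (\<Sum>p\<in>UNIV \<times> {1, \<i>}. f (axis (fst p) (snd p)))"
    unfolding Basis_eq by (subst sum.reindex) (auto simp: case_prod_unfold)
  also have "\<dots> = (\<Sum>i\<in>UNIV. \<Sum>u\<in>{1, \<i>}. f (axis i u))"
    by (subst sum.cartesian_product) (simp add: case_prod_unfold)
  also have "\<dots> = (\<Sum>i\<in>UNIV. f (axis i 1) + f (axis i \<i>))"
    by simp
  finally show ?thesis .
qed

text \<open>Away from the origin \<open>Y (y / |y|) = M y * |y|\<^sup>-\<^sup>k\<close>, and \<open>|y|\<^sup>-\<^sup>s = (y \<bullet> y) powr (- s / 2)\<close>.\<close>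
lemma LB_eigenfun_homogeneous_harmonic:
  fixes M :: "complex ^ 'm::finite \<Rightarrow> complex"
  assumes M1: "\<And>y. (M has_derivative M1 y) (at y)"
    and M2: "\<And>y b. b \<in> Basis \<Longrightarrow> ((\<lambda>y. M1 y b) has_derivative M2 b y) (at y)"
    and cont: "\<And>b c. b \<in> Basis \<Longrightarrow> c \<in> Basis \<Longrightarrow> continuous_on UNIV (\<lambda>y. M2 b y c)"
    and harmonic: "\<And>y. (\<Sum>b\<in>Basis. M2 b y b) = 0"
    and euler: "\<And>y. M1 y y = of_nat k * M y"
    and hom: "\<And>t y. 0 < t \<Longrightarrow> M (t *\<^sub>R y) = of_real t ^ k * M y"
  shows "LB_eigenfun (\<lambda>x. if x \<in> sphere 0 1 then M x else 0) (real k * (real k + 2 * real CARD('m) - 2))"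
proof -
  define Y where "Y x = (if x \<in> sphere 0 1 then M x else 0)" for x
  define K where "K = real k"
  \<comment> \<open>\<open>\<rho> s y\<close> is \<open>|y|^(-s)\<close>; its derivative in
    direction \<open>v\<close> is \<open>- s |y|^(-s - 2) (y \<bullet> v)\<close>, so each
    differentiation raises the index by 2.\<close>
  define \<rho> where "\<rho> s y = (y \<bullet> y) powr (- s / 2)" for s and y :: "complex ^ 'm"
  define u where "u y = Y (y /\<^sub>R norm y)" for y
  define u1 where "u1 y v = \<rho> K y *\<^sub>R M1 y v + (- K * \<rho> (K + 2) y * (y \<bullet> v)) *\<^sub>R M y" for y v
  define u2 where "u2 b y v = \<rho> K y *\<^sub>R M2 b y v + (- K * \<rho> (K + 2) y * (y \<bullet> v)) *\<^sub>R M1 y b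
      + ((- K * \<rho> (K + 2) y * (y \<bullet> b)) *\<^sub>R M1 y v
         + (- K * (- (K + 2) * \<rho> (K + 4) y * (y \<bullet> v)) * (y \<bullet> b) + (- K * \<rho> (K + 2) y) * (v \<bullet> b)) *\<^sub>R M y)" for b y v
  have d\<rho>: "(\<rho> s has_derivative (\<lambda>v. - s * \<rho> (s + 2) y * (y \<bullet> v))) (at y)" if "y \<noteq> 0" for s y
  proof -
    have inner: "((\<lambda>y. y \<bullet> y) has_derivative (\<lambda>v. 2 * (y \<bullet> v))) (at y)"
      by (auto intro!: derivative_eq_intros simp: inner_commute)
    have pos: "0 < y \<bullet> y" using that by simp
    then have "((\<lambda>r. r powr (- s / 2)) has_real_derivative (- s / 2) * (y \<bullet> y) powr (- s / 2 - 1)) (at (y \<bullet> y))"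
      by (rule has_real_derivative_powr)
    then have "((\<lambda>r. r powr (- s / 2)) has_derivative (*) ((- s / 2) * (y \<bullet> y) powr (- s / 2 - 1))) (at (y \<bullet> y))"
      by (simp only: has_field_derivative_def)
    from has_derivative_compose[OF inner this]
    have "((\<lambda>y. (y \<bullet> y) powr (- s / 2)) has_derivative (\<lambda>v. (- s / 2) * (y \<bullet> y) powr (- s / 2 - 1) * (2 * (y \<bullet> v)))) (at y)" .
    moreover have "- (s + 2) / 2 = - s / 2 - 1" by (simp add: field_simps)
    then have "\<rho> (s + 2) y = (y \<bullet> y) powr (- s / 2 - 1)"
      unfolding \<rho>_def by (rule arg_cong)
    ultimately show ?thesis
      unfolding \<rho>_def[of s, abs_def] by (simp add: mult.assoc)
  qed
  have u_eq: "u y = \<rho> K y *\<^sub>R M y" if "y \<noteq> 0" for y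
  proof -
    have "u y = M (inverse (norm y) *\<^sub>R y)"
      using that by (simp add: u_def Y_def)
    also have "\<dots> = of_real (inverse (norm y) ^ k) * M y"
      using that by (subst hom) auto
    also have "inverse (norm y) ^ k = \<rho> K y"
    proof -
      have "y \<bullet> y = norm y powr 2"
        using that by (simp add: power2_norm_eq_inner)
      then have "\<rho> K y = norm y powr (- K)"
        unfolding \<rho>_def by (simp only: powr_powr) simp
      then show ?thesis
        using that by (simp add: K_def powr_minus powr_realpow power_inverse)
    qed
    finally show ?thesis by (simp add: scaleR_conv_of_real)
  qed
  have du: "(u has_derivative u1 y) (at y)" if "y \<in> - {0}" for y
  proof -
    have "((\<lambda>y. \<rho> K y *\<^sub>R M y) has_derivative (\<lambda>v. \<rho> K y *\<^sub>R M1 y v + (- K * \<rho> (K + 2) y * (y \<bullet> v)) *\<^sub>R M y)) (at y)"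
      using that by (intro has_derivative_scaleR d\<rho> M1) auto
    then show ?thesis
      unfolding u1_def[abs_def] by (rule has_derivative_transform_within_open[where s = "- {0}"]) (use that u_eq in auto)
  qed
  have du1: "((\<lambda>y. u1 y b) has_derivative u2 b y) (at y)" if "y \<in> - {0}" "b \<in> Basis" for y b
  proof -
    have "((\<lambda>y. - K * \<rho> (K + 2) y * (y \<bullet> b)) has_derivative
       (\<lambda>v. - K * (- (K + 2) * \<rho> (K + 4) y * (y \<bullet> v)) * (y \<bullet> b) + (- K * \<rho> (K + 2) y) * (v \<bullet> b))) (at y)"
    proof -
      have "((\<lambda>y. - K * \<rho> (K + 2) y) has_derivative (\<lambda>v. - K * (- (K + 2) * \<rho> (K + 2 + 2) y * (y \<bullet> v)))) (at y)"
        using that by (intro has_derivative_mult_right d\<rho>) auto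
      from has_derivative_mult[OF this has_derivative_inner_left[OF has_derivative_ident]]
      show ?thesis
        by (rule has_derivative_eq_rhs) (auto simp: algebra_simps)
    qed
    then show ?thesis
      unfolding u1_def u2_def[abs_def] using that by (intro has_derivative_add has_derivative_scaleR d\<rho> M1 M2) auto
  qed
  have cont\<rho>: "continuous_on (- {0}) (\<rho> s)" for s
    unfolding \<rho>_def[abs_def] by (intro continuous_intros) auto
  have contM: "continuous_on A M" "b \<in> Basis \<Longrightarrow> continuous_on A (\<lambda>y. M1 y b)" for A b
    using M1 M2 by (auto intro!: continuous_at_imp_continuous_on has_derivative_continuous)
  have cont_u2: "continuous_on (- {0}) (\<lambda>y. u2 b y c)" if "b \<in> Basis" "c \<in> Basis" for b c
    unfolding u2_def
    by (intro continuous_intros cont\<rho> contM that continuous_on_subset[OF cont[OF that] subset_UNIV])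
  have "open (- {0 :: complex ^ 'm})" by (simp add: open_Compl)
  note conds = this du du1 cont_u2
  have C2: "C2_on (- {0}) u"
    by (rule C2_onI[OF conds])
  have "laplace_beltrami Y x = of_real (K * (K + 2 * real CARD('m) - 2)) * Y x" if "x \<in> sphere 0 1" for x
  proof -
    have x: "x \<noteq> 0" "x \<bullet> x = 1" "\<And>s. \<rho> s x = 1"
      using that by (auto simp: \<rho>_def norm_eq_1)
    have lin: "linear (M1 x)"
      using M1 by (rule has_derivative_linear)
    have u2_bb: "u2 b x b = M2 b x b - (2 * K) *\<^sub>R ((x \<bullet> b) *\<^sub>R M1 x b) + ((K * (K + 2)) * ((x \<bullet> b) * (x \<bullet> b))) *\<^sub>R M x - K *\<^sub>R M x"
      if "b \<in> Basis" for b
      using that by (simp add: u2_def x scaleR_conv_of_real algebra_simps)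
    \<comment> \<open>On the unit sphere the terms add up, by Euler's relation, to
      \<open>- 2 K^2 + K (K + 2) - 2 m K = - K (K + 2 m - 2)\<close> times \<open>M x\<close>, with
      \<open>m = CARD('m)\<close>.\<close>
    have "laplacian u x = (\<Sum>b\<in>Basis. u2 b x b)"
      using laplacian_eqI[OF conds, of x] x by simp
    also have "\<dots> = (\<Sum>b\<in>Basis. M2 b x b) - (2 * K) *\<^sub>R (\<Sum>b\<in>Basis. (x \<bullet> b) *\<^sub>R M1 x b)
        + ((K * (K + 2)) * (\<Sum>b\<in>Basis. (x \<bullet> b) * (x \<bullet> b))) *\<^sub>R M x - (\<Sum>b\<in>(Basis::(complex ^ 'm) set). K *\<^sub>R M x)"
      using u2_bb by (simp add: sum.distrib sum_subtractf scaleR_right.sum scaleR_left.sum sum_distrib_left del: sum_constant)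
    also have "(\<Sum>b\<in>Basis. (x \<bullet> b) *\<^sub>R M1 x b) = M1 x (\<Sum>b\<in>Basis. (x \<bullet> b) *\<^sub>R b)"
      using lin by (simp add: linear_sum linear_scale)
    also have "\<dots> = of_real K * M x"
      by (simp add: euclidean_representation euler K_def)
    also have "(\<Sum>b\<in>Basis. (x \<bullet> b) * (x \<bullet> b)) = 1"
      using x(2) by (simp flip: euclidean_inner)
    also have "(\<Sum>b\<in>(Basis::(complex ^ 'm) set). K *\<^sub>R M x) = (2 * CARD('m) * K) *\<^sub>R M x"
      by (simp add: scaleR_conv_of_real)
    finally have "laplacian u x = - (of_real (K * (K + 2 * real CARD('m) - 2)) * M x)"
      by (simp add: harmonic scaleR_conv_of_real algebra_simps)
    moreover have "laplace_beltrami Y x = - laplacian u x" "Y x = M x"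
      using that by (auto simp: laplace_beltrami_def u_def[abs_def] Y_def[of x])
    ultimately show ?thesis by simp
  qed
  then have "LB_eigenfun Y (K * (K + 2 * real CARD('m) - 2))"
    unfolding LB_eigenfun_def using C2 by (auto simp: Y_def u_def[abs_def])
  then show ?thesis
    by (simp add: Y_def[abs_def] K_def)
qed

section \<open>Holomorphic monomials\<close>

definition zmonom :: "('m \<Rightarrow> nat) \<Rightarrow> complex ^ 'm::finite \<Rightarrow> complex" where
  "zmonom \<alpha> z = (\<Prod>i\<in>UNIV. z $ i ^ \<alpha> i)"

definition mdeg :: "('m::finite \<Rightarrow> nat) \<Rightarrow> nat" where
  "mdeg \<alpha> = (\<Sum>i\<in>UNIV. \<alpha> i)"

text \<open>Truncated subtraction leaves \<open>\<alpha>\<close> unchanged when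
  \<open>\<alpha> i = 0\<close>; in the derivatives a factor \<open>\<alpha> i\<close> makes such
  terms vanish.\<close>

definition lower_index :: "'m \<Rightarrow> ('m \<Rightarrow> nat) \<Rightarrow> 'm \<Rightarrow> nat" where
  "lower_index i \<alpha> = \<alpha>(i := \<alpha> i - 1)"

lemma zmonom_lower:
  "of_nat (\<alpha> i) * (z $ i * zmonom (lower_index i \<alpha>) z) = of_nat (\<alpha> i) * zmonom \<alpha> z"
proof (cases "\<alpha> i")
  case (Suc n)
  have "zmonom (lower_index i \<alpha>) z = z $ i ^ n * (\<Prod>j\<in>UNIV - {i}. z $ j ^ \<alpha> j)"
    unfolding zmonom_def lower_index_def by (subst prod.remove[of _ i]) (auto simp: Suc intro!: prod.cong)
  moreover have "zmonom \<alpha> z = z $ i ^ Suc n * (\<Prod>j\<in>UNIV - {i}. z $ j ^ \<alpha> j)"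
    unfolding zmonom_def by (subst prod.remove[of _ i]) (auto simp: Suc)
  ultimately show ?thesis by simp
qed simp

lemma zmonom_has_derivative:
  "(zmonom \<alpha> has_derivative (\<lambda>v. \<Sum>i\<in>UNIV. of_nat (\<alpha> i) * v $ i * zmonom (lower_index i \<alpha>) y)) (at y)"
proof -
  have nth: "((\<lambda>z. z $ i ^ \<alpha> i) has_derivative (\<lambda>v. of_nat (\<alpha> i) * v $ i * y $ i ^ (\<alpha> i - 1))) (at y)" for i
  proof -
    have "((\<lambda>z. z $ i) has_derivative (\<lambda>v. v $ i)) (at y)"
      using bounded_linear_vec_nth[of i] by (rule bounded_linear_imp_has_derivative)
    from has_derivative_power[OF this, of "\<alpha> i"] show ?thesis
      by (rule has_derivative_eq_rhs) (auto simp: algebra_simps)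
  qed
  have prod: "y $ i ^ (\<alpha> i - 1) * (\<Prod>j\<in>UNIV - {i}. y $ j ^ \<alpha> j) = zmonom (lower_index i \<alpha>) y" for i
    unfolding zmonom_def lower_index_def by (subst (2) prod.remove[of _ i]) (auto intro!: prod.cong)
  have "zmonom \<alpha> = (\<lambda>z. \<Prod>i\<in>UNIV. z $ i ^ \<alpha> i)"
    by (simp add: zmonom_def fun_eq_iff)
  then show ?thesis
    using has_derivative_prod[OF nth, of "\<lambda>i. i" UNIV] by (simp add: mult.assoc prod[unfolded One_nat_def])
qed

lemma continuous_on_zmonom [continuous_intros]: "continuous_on A (zmonom \<alpha>)"
  using zmonom_has_derivative by (auto intro!: continuous_at_imp_continuous_on has_derivative_continuous)

lemma zmonom_scale: "zmonom \<alpha> (c *s z) = c ^ mdeg \<alpha> * zmonom \<alpha> z"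
  by (simp add: zmonom_def mdeg_def power_mult_distrib prod.distrib power_sum)

lemma norm_zmonom_le_1: "z \<in> cball 0 1 \<Longrightarrow> norm (zmonom \<alpha> z) \<le> 1"
proof -
  assume "z \<in> cball 0 1"
  then have "norm (z $ i) \<le> 1" for i
    using Finite_Cartesian_Product.norm_nth_le[of z i] by simp
  then show ?thesis
    unfolding zmonom_def prod_norm[symmetric] by (intro prod_le_1) (auto simp: norm_power power_le_one)
qed

text \<open>Holomorphic monomials are harmonic and homogeneous of degree
  \<open>mdeg \<alpha>\<close>. They are set to 0 off the sphere because \<open>LB_eigenfun\<close>
  asks for it.\<close>

lemma LB_eigenfun_zmonom:
  fixes \<alpha> :: "'m::finite \<Rightarrow> nat"
  shows "LB_eigenfun (\<lambda>x. if x \<in> sphere 0 1 then zmonom \<alpha> x else 0)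
    (real (mdeg \<alpha>) * (real (mdeg \<alpha>) + 2 * real CARD('m) - 2))"
proof (rule LB_eigenfun_homogeneous_harmonic[OF zmonom_has_derivative])
  fix y b :: "complex ^ 'm"
  show "((\<lambda>y. \<Sum>i\<in>UNIV. of_nat (\<alpha> i) * b $ i * zmonom (lower_index i \<alpha>) y) has_derivative
     (\<lambda>c. \<Sum>i\<in>UNIV. of_nat (\<alpha> i) * b $ i *
        (\<Sum>j\<in>UNIV. of_nat (lower_index i \<alpha> j) * c $ j * zmonom (lower_index j (lower_index i \<alpha>)) y))) (at y)"
    by (intro has_derivative_sum has_derivative_mult_right zmonom_has_derivative)
next
  show "continuous_on UNIV (\<lambda>y. \<Sum>i\<in>UNIV. of_nat (\<alpha> i) * b $ i *
        (\<Sum>j\<in>UNIV. of_nat (lower_index i \<alpha> j) * c $ j * zmonom (lower_index j (lower_index i \<alpha>)) y))" for b c :: "complex ^ 'm"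
    by (intro continuous_intros)
  fix y :: "complex ^ 'm"
  have axis: "(\<Sum>j\<in>UNIV. f j * axis i w $ j * g j) = w * (f i * g i)" for f g :: "'m \<Rightarrow> complex" and i w
    by (subst sum.remove[of _ i]) (auto simp: axis_def intro!: sum.neutral)
  show "(\<Sum>b\<in>Basis. \<Sum>i\<in>UNIV. of_nat (\<alpha> i) * b $ i *
        (\<Sum>j\<in>UNIV. of_nat (lower_index i \<alpha> j) * b $ j * zmonom (lower_index j (lower_index i \<alpha>)) y)) = 0"
  proof -
    \<comment> \<open>The second derivative in direction \<open>\<i>\<close> is minus the one in
      direction 1.\<close>
    have "\<i> * (a * (\<i> * b)) = - (a * b)" for a b
      by (metis i_squared mult.assoc mult.commute mult_minus_left mult_1)
    then show ?thesis
      unfolding sum_Basis_vec axis by (simp add: mult.assoc)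
  qed
  show "(\<Sum>i\<in>UNIV. of_nat (\<alpha> i) * y $ i * zmonom (lower_index i \<alpha>) y) = of_nat (mdeg \<alpha>) * zmonom \<alpha> y"
    by (simp add: mult.assoc zmonom_lower mdeg_def sum_distrib_right)
  show "zmonom \<alpha> (t *\<^sub>R y) = of_real t ^ mdeg \<alpha> * zmonom \<alpha> y" if "0 < t" for t
    using zmonom_scale[of \<alpha> "of_real t" y] by (simp add: vector_scalar_mult_def scaleR_vec_def scaleR_conv_of_real)
qed

section \<open>Density of polynomials in the ball algebra\<close>

definition poly_fun :: "(complex ^ 'm::finite \<Rightarrow> complex) set" where
  "poly_fun = {Q. \<exists>A c. finite A \<and> (\<forall>z. Q z = (\<Sum>\<alpha>\<in>A. c \<alpha> * zmonom \<alpha> z))}"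

lemma poly_fun_zmonom: "(\<lambda>z. c * zmonom \<alpha> z) \<in> poly_fun"
  unfolding poly_fun_def by (intro CollectI exI[of _ "{\<alpha>}"] exI[of _ "\<lambda>_. c"]) simp

lemma poly_fun_add:
  assumes "P \<in> poly_fun" "Q \<in> poly_fun"
  shows "(\<lambda>z. P z + Q z) \<in> poly_fun"
proof -
  obtain A c where A: "finite A" "\<And>z. P z = (\<Sum>\<alpha>\<in>A. c \<alpha> * zmonom \<alpha> z)"
    using assms(1) unfolding poly_fun_def by blast
  obtain B d where B: "finite B" "\<And>z. Q z = (\<Sum>\<alpha>\<in>B. d \<alpha> * zmonom \<alpha> z)"
    using assms(2) unfolding poly_fun_def by blast
  have ext: "(\<Sum>\<alpha>\<in>D. f \<alpha> * zmonom \<alpha> z) = (\<Sum>\<alpha>\<in>A \<union> B. (if \<alpha> \<in> D then f \<alpha> else 0) * zmonom \<alpha> z)"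
    if "D \<subseteq> A \<union> B" for D f z
    using A(1) B(1) that by (intro sum.mono_neutral_cong_left) auto
  show ?thesis
    unfolding poly_fun_def
  proof (intro CollectI exI conjI allI)
    fix z
    show "P z + Q z = (\<Sum>\<alpha>\<in>A \<union> B. ((if \<alpha> \<in> A then c \<alpha> else 0) + (if \<alpha> \<in> B then d \<alpha> else 0)) * zmonom \<alpha> z)"
      unfolding A(2) B(2) ext[of A, simplified] ext[of B, simplified] by (simp add: sum.distrib distrib_right)
  qed (use A B in auto)
qed

lemma poly_fun_sum:
  assumes "finite I" "\<And>i. i \<in> I \<Longrightarrow> f i \<in> poly_fun"
  shows "(\<lambda>z. \<Sum>i\<in>I. f i z) \<in> poly_fun"
  using assms
proof (induction I rule: finite_induct)
  case empty
  have "(\<lambda>z. 0 * zmonom (\<lambda>_. 0) z) \<in> poly_fun" by (rule poly_fun_zmonom)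
  then show ?case by simp
next
  case (insert i I)
  then show ?case using poly_fun_add[of "f i" "\<lambda>z. \<Sum>i\<in>I. f i z"] by simp
qed

lemma poly_fun_cmult_coord:
  assumes "Q \<in> poly_fun"
  shows "(\<lambda>z. c * z $ i ^ k * Q z) \<in> poly_fun"
proof -
  obtain A d where A: "finite A" "\<And>z. Q z = (\<Sum>\<alpha>\<in>A. d \<alpha> * zmonom \<alpha> z)"
    using assms unfolding poly_fun_def by blast
  have "z $ i ^ k * zmonom \<alpha> z = zmonom (\<alpha>(i := \<alpha> i + k)) z" for \<alpha> z
    unfolding zmonom_def by (subst (1 2) prod.remove[of _ i]) (auto simp: power_add intro!: prod.cong)
  then have "c * z $ i ^ k * Q z = (\<Sum>\<alpha>\<in>A. (c * d \<alpha>) * zmonom (\<alpha>(i := \<alpha> i + k)) z)" for z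
    unfolding A(2) sum_distrib_left by (intro sum.cong refl) (metis (no_types) mult.assoc mult.left_commute)
  then show ?thesis
    by (simp only: poly_fun_sum[OF A(1) poly_fun_zmonom])
qed

text \<open>Interpolation at the nodes \<open>0, ..., k\<close>, with basis polynomials that depend
  on \<open>k\<close> only: it expresses the dependence on one coordinate through finitely many
  slices in which that coordinate is frozen.\<close>

lemma lagrange_interpolation_exists:
  obtains l :: "nat \<Rightarrow> complex poly" where
    "\<And>p x. degree p \<le> k \<Longrightarrow> poly p x = (\<Sum>j\<le>k. poly p (of_nat j) * poly (l j) x)"
proof -
  define l where "l j = (\<Prod>i\<in>{..k} - {j}. smult (1 / (of_nat j - of_nat i)) [:- of_nat i, 1 :: complex:])" for j
  have factor: "poly (smult (1 / (of_nat j - of_nat i)) [:- of_nat i, 1 :: complex:]) (of_nat n) = (of_nat n - of_nat i) / (of_nat j - of_nat i)" for i j n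
    by (simp add: diff_divide_distrib)
  have l_node: "poly (l j) (of_nat n) = (if n = j then 1 else 0)" if "j \<le> k" "n \<le> k" for j n
  proof (cases "n = j")
    case True
    then show ?thesis
      unfolding l_def poly_prod factor by (auto intro!: prod.neutral)
  next
    case False
    then show ?thesis
      unfolding l_def poly_prod factor using that by (auto intro!: prod_zero bexI[of _ n])
  qed
  have deg: "degree (l j) \<le> k" if "j \<le> k" for j
  proof -
    have "degree (l j) \<le> sum (degree \<circ> (\<lambda>i. smult (1 / (of_nat j - of_nat i)) [:- of_nat i, 1 :: complex:])) ({..k} - {j})"
      unfolding l_def by (rule degree_prod_sum_le) simp
    also have "\<dots> \<le> (\<Sum>i\<in>{..k} - {j}. 1)"
      by (intro sum_mono) (auto intro: order_trans[OF degree_smult_le])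
    also have "\<dots> = k" using that by simp
    finally show ?thesis .
  qed
  show ?thesis
  proof (rule that[of l])
    fix p :: "complex poly" and x assume p: "degree p \<le> k"
    define q where "q = (\<Sum>j\<le>k. smult (poly p (of_nat j)) (l j))"
    have "degree q \<le> k"
      unfolding q_def by (intro degree_sum_le) (auto intro: order_trans[OF degree_smult_le] deg)
    have "p = q"
    proof (rule poly_eqI_degree[where A = "of_nat ` {..k}"])
      show "poly p y = poly q y" if "y \<in> of_nat ` {..k}" for y
        using that by (auto simp: q_def poly_sum l_node if_distrib[where f = "\<lambda>x. _ * x"] cong: if_cong)
      have "card (of_nat ` {..k} :: complex set) = Suc k"
        by (subst card_image) (auto simp: inj_on_def)
      then show "degree p < card (of_nat ` {..k} :: complex set)" "degree q < card (of_nat ` {..k} :: complex set)"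
        using p \<open>degree q \<le> k\<close> by auto
    qed
    then have "poly p x = poly q x" by simp
    then show "poly p x = (\<Sum>j\<le>k. poly p (of_nat j) * poly (l j) x)"
      by (simp add: q_def poly_sum)
  qed
qed

definition vupd :: "complex ^ 'm::finite \<Rightarrow> 'm \<Rightarrow> complex \<Rightarrow> complex ^ 'm" where
  "vupd z i w = (\<chi> j. if j = i then w else z $ j)"

text \<open>Induction on the coordinates on which \<open>H\<close> depends. Interpolation in
  coordinate \<open>i\<close> writes \<open>H z\<close> as a sum of \<open>l j\<close> at
  \<open>z $ i\<close> times the slice frozen at \<open>j\<close>, and these slices depend on one
  coordinate fewer. The common bound \<open>k\<close> makes nodes and basis polynomials independent
  of \<open>z\<close>.\<close>

lemma separately_poly_imp_poly_fun:
  fixes H :: "complex ^ 'm::finite \<Rightarrow> complex"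
  assumes "finite I"
    and "\<And>z i. i \<in> I \<Longrightarrow> \<exists>p. degree p \<le> k \<and> (\<forall>w. H (vupd z i w) = poly p w)"
    and "\<And>z z'. (\<And>i. i \<in> I \<Longrightarrow> z $ i = z' $ i) \<Longrightarrow> H z = H z'"
  shows "H \<in> poly_fun"
  using assms
proof (induction I arbitrary: H rule: finite_induct)
  case empty
  have "H = (\<lambda>z. H 0 * zmonom (\<lambda>_. 0) z)"
    using empty(2) by (auto simp: zmonom_def)
  then show ?case using poly_fun_zmonom by metis
next
  case (insert i I)
  obtain l :: "nat \<Rightarrow> complex poly" where l: "\<And>p x. degree p \<le> k \<Longrightarrow> poly p x = (\<Sum>j\<le>k. poly p (of_nat j) * poly (l j) x)"
    using lagrange_interpolation_exists[of k] by blast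
  define Hj where "Hj j z = H (vupd z i (of_nat j))" for j z
  have "Hj j \<in> poly_fun" for j
  proof (rule insert.IH)
    fix z i' assume i': "i' \<in> I"
    then have "i' \<noteq> i" using insert.hyps by auto
    then have "vupd (vupd z i' w) i (of_nat j) = vupd (vupd z i (of_nat j)) i' w" for w
      by (auto simp: vupd_def vec_eq_iff)
    then show "\<exists>p. degree p \<le> k \<and> (\<forall>w. Hj j (vupd z i' w) = poly p w)"
      using insert.prems(1)[of i' "vupd z i (of_nat j)"] i' by (simp add: Hj_def)
  next
    fix z z' :: "complex ^ 'm" assume "\<And>i. i \<in> I \<Longrightarrow> z $ i = z' $ i"
    then show "Hj j z = Hj j z'"
      unfolding Hj_def by (intro insert.prems(2)) (auto simp: vupd_def)
  qed
  then have "(\<lambda>z. coeff (l j) d * z $ i ^ d * Hj j z) \<in> poly_fun" for j d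
    by (rule poly_fun_cmult_coord)
  then have "(\<lambda>z. \<Sum>j\<le>k. \<Sum>d\<le>degree (l j). coeff (l j) d * z $ i ^ d * Hj j z) \<in> poly_fun"
    by (intro poly_fun_sum) auto
  moreover have "H z = (\<Sum>j\<le>k. \<Sum>d\<le>degree (l j). coeff (l j) d * z $ i ^ d * Hj j z)" for z
  proof -
    obtain p where p: "degree p \<le> k" "\<And>w. H (vupd z i w) = poly p w"
      using insert.prems(1)[of i z] by auto
    have "vupd z i (z $ i) = z"
      by (auto simp: vupd_def vec_eq_iff)
    then have "H z = poly p (z $ i)"
      using p(2)[of "z $ i"] by simp
    also have "\<dots> = (\<Sum>j\<le>k. Hj j z * poly (l j) (z $ i))"
      unfolding Hj_def p(2) by (rule l[OF p(1)])
    also have "\<dots> = (\<Sum>j\<le>k. \<Sum>d\<le>degree (l j). coeff (l j) d * z $ i ^ d * Hj j z)"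
      unfolding poly_altdef sum_distrib_left by (intro sum.cong refl) (simp add: mult_ac)
    finally show ?thesis .
  qed
  ultimately show ?case by (simp add: fun_eq_iff[symmetric])
qed

section \<open>Homogeneous parts of a holomorphic function on the ball\<close>

lemma norm_vector_scalar_mult: "norm (c *s z) = norm c * norm (z :: complex ^ 'm::finite)"
  by (simp add: norm_vec_def vector_scalar_mult_def norm_mult L2_set_right_distrib)

lemma of_real_vector_scalar_mult: "of_real t *s (z :: complex ^ 'm::finite) = t *\<^sub>R z"
  by (simp add: vector_scalar_mult_def scaleR_vec_def scaleR_conv_of_real)

lemma of_real_power_mult: "a * b = c \<Longrightarrow> of_real a ^ k * of_real b ^ k = (of_real c ^ k :: complex)"
  by (metis of_real_mult power_mult_distrib)

lemma norm_shrink_le: "norm (of_real (1 / (1 + norm z)) *s (z :: complex ^ 'm::finite)) \<le> 1"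
  unfolding norm_vector_scalar_mult norm_of_real by (simp add: abs_of_pos add_pos_nonneg)

text \<open>The degree \<open>k\<close> part of \<open>F\<close>, read off from the one-variable
  Taylor series along the slice through \<open>z\<close>, so that power series in several variables
  do not occur.\<close>

definition hpart :: "(complex ^ 'm::finite \<Rightarrow> complex) \<Rightarrow> nat \<Rightarrow> complex ^ 'm \<Rightarrow> complex" where
  "hpart F k z = (deriv ^^ k) (\<lambda>w. F (w *s z)) 0 / fact k"

context
  fixes F :: "complex ^ 'm::finite \<Rightarrow> complex" and M :: real
  assumes cont: "continuous_on (cball 0 1) F" and holo: "holo_on (ball 0 1) F"
    and bound: "\<And>z. z \<in> cball 0 1 \<Longrightarrow> norm (F z) \<le> M"
begin

lemma bound_nonneg: "0 \<le> M"
  using order_trans[OF norm_ge_zero bound[of 0]] by simp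

lemma line_holomorphic: "(\<lambda>w. F (x + w *s v)) holomorphic_on {w. x + w *s v \<in> ball 0 1}"
  unfolding holomorphic_on_def field_differentiable_def
proof (intro ballI)
  fix w assume "w \<in> {w. x + w *s v \<in> ball 0 1}"
  then obtain L where L: "(F has_derivative L) (at (x + w *s v))" "\<And>c v. L (c *s v) = c * L v"
    using holo unfolding holo_on_def by blast
  have "((\<lambda>w. x + w *s v) has_derivative (\<lambda>h. h *s v)) (at w)"
  proof -
    have "bounded_linear (\<lambda>h. h *s v)"
      unfolding linear_conv_bounded_linear[symmetric]
      by (auto simp: linear_iff vec_eq_iff algebra_simps)
    then show ?thesis
      by (auto intro!: derivative_eq_intros bounded_linear_imp_has_derivative)
  qed
  from has_derivative_compose[OF this L(1)]
  have "((\<lambda>w. F (x + w *s v)) has_field_derivative L v) (at w)"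
    unfolding has_field_derivative_def by (simp add: L(2) mult_commute_abs)
  then show "\<exists>f'. ((\<lambda>w. F (x + w *s v)) has_field_derivative f') (at w within {w. x + w *s v \<in> ball 0 1})"
    by (auto intro: has_field_derivative_at_within)
qed

lemma slice_holomorphic:
  assumes "norm z \<le> 1"
  shows "(\<lambda>w. F (w *s z)) holomorphic_on ball 0 1"
proof -
  have "(\<lambda>w. F (0 + w *s z)) holomorphic_on {w. 0 + w *s z \<in> ball 0 1}"
    by (rule line_holomorphic)
  then have "(\<lambda>w. F (w *s z)) holomorphic_on {w. w *s z \<in> ball 0 1}"
    by simp
  then show ?thesis
  proof (rule holomorphic_on_subset)
    show "ball 0 1 \<subseteq> {w. w *s z \<in> ball 0 1}"
    proof
      fix w :: complex assume "w \<in> ball 0 1"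
      then have "norm w * norm z \<le> norm w" "norm w < 1"
        using assms by (auto intro: mult_right_le_one_le)
      then show "w \<in> {w. w *s z \<in> ball 0 1}"
        by (simp add: norm_vector_scalar_mult)
    qed
  qed
qed

text \<open>Cauchy's estimate on the full unit disc: the slice is holomorphic inside and continuous
  up to the boundary even when \<open>|z| = 1\<close>.\<close>

lemma norm_hpart_le:
  assumes "norm z \<le> 1"
  shows "norm (hpart F k z) \<le> M"
proof -
  have in_cball: "w *s z \<in> cball 0 1" if "w \<in> cball 0 1" for w
    using assms that by (simp add: norm_vector_scalar_mult mult_le_one)
  have "continuous_on (cball 0 1) (\<lambda>w. F (w *s z))"
  proof (rule continuous_on_compose2[OF cont])
    show "continuous_on (cball 0 1) (\<lambda>w. w *s z)"
      unfolding vector_scalar_mult_def by (intro continuous_intros)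
  qed (use in_cball in auto)
  then have "norm ((deriv ^^ k) (\<lambda>w. F (w *s z)) 0) \<le> fact k * M / 1 ^ k"
    using assms by (intro Cauchy_inequality slice_holomorphic bound in_cball) auto
  then show ?thesis
    by (simp add: hpart_def norm_divide divide_le_eq mult.commute)
qed

lemma hpart_sums:
  assumes "norm z \<le> 1" "norm w < 1"
  shows "(\<lambda>k. hpart F k z * w ^ k) sums F (w *s z)"
  using holomorphic_power_series[OF slice_holomorphic[OF assms(1)], of w] assms(2)
  by (simp add: hpart_def)

lemma hpart_scale:
  assumes "norm z \<le> 1" "norm c \<le> 1"
  shows "hpart F k (c *s z) = c ^ k * hpart F k z"
proof -
  have "(\<lambda>w. F (w *s (c *s z))) = (\<lambda>w. F ((c * w) *s z))"
    by (simp add: vector_smult_assoc mult.commute)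
  moreover have "(deriv ^^ k) (\<lambda>w. F ((c * w) *s z)) 0 = c ^ k * (deriv ^^ k) (\<lambda>w. F (w *s z)) (c * 0)"
  proof (rule higher_deriv_compose_linear[OF slice_holomorphic[OF assms(1)] open_ball open_ball])
    fix w :: complex assume w: "w \<in> ball 0 1"
    have "norm c * norm w \<le> norm w"
      using assms by (auto intro: mult_left_le_one_le)
    then show "c * w \<in> ball 0 1"
      using w by (simp add: norm_mult)
  qed simp
  ultimately show ?thesis
    by (simp add: hpart_def)
qed

lemma hpart_remainder:
  assumes "norm z \<le> 1" "norm w < 1"
  shows "norm (F (w *s z) - (\<Sum>j<k. hpart F j z * w ^ j)) \<le> M * norm w ^ k / (1 - norm w)"
proof -
  have tail: "(\<lambda>i. hpart F (i + k) z * w ^ (i + k)) sums (F (w *s z) - (\<Sum>j<k. hpart F j z * w ^ j))"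
    using sums_split_initial_segment[OF hpart_sums[OF assms]] .
  have geo: "(\<lambda>i. M * norm w ^ k * norm w ^ i) sums (M * norm w ^ k * (1 / (1 - norm w)))"
    using assms by (intro sums_mult geometric_sums) auto
  have le: "norm (hpart F (i + k) z * w ^ (i + k)) \<le> M * norm w ^ k * norm w ^ i" for i
    using mult_right_mono[OF norm_hpart_le[OF assms(1), of "i + k"], of "norm w ^ (i + k)"]
    by (simp add: norm_mult norm_power power_add mult_ac)
  show ?thesis
    using norm_suminf_le[OF le sums_summable[OF geo]] sums_unique[OF tail] sums_unique[OF geo] by simp
qed

text \<open>By \<open>hpart_remainder\<close> the degree \<open>k\<close> part at \<open>y\<close>
  is the limit, as \<open>\<zeta>\<close> tends to 0, of \<open>F\<close> at
  \<open>\<zeta> y\<close> minus the parts of lower degree, divided by \<open>\<zeta>^k\<close>; the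
  error is at most \<open>2 M |\<zeta>|\<close> for all \<open>y\<close> in the ball. The lower
  parts are holomorphic along the line by induction, and uniform limits preserve holomorphy.\<close>

lemma hpart_line_holomorphic:
  "(\<lambda>w. hpart F k (x + w *s v)) holomorphic_on {w. x + w *s v \<in> ball 0 1}"
proof (induction k rule: less_induct)
  case (less k)
  let ?S = "{w. x + w *s v \<in> ball 0 1}"
  \<comment> \<open>A null sequence bounded by 1/2, which keeps \<open>1 - |\<zeta>|\<close> away
    from 0 in the remainder.\<close>
  define \<zeta> where "\<zeta> n = complex_of_real (1 / (real n + 2))" for n
  define g where "g n w = (F (\<zeta> n *s (x + w *s v)) - (\<Sum>j<k. hpart F j (x + w *s v) * \<zeta> n ^ j)) / \<zeta> n ^ k" for n w
  have \<zeta>: "\<zeta> n \<noteq> 0" "norm (\<zeta> n) = 1 / (real n + 2)" "norm (\<zeta> n) \<le> 1 / 2" for n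
    by (auto simp: \<zeta>_def field_simps norm_divide simp del: of_real_divide)
  have line: "\<zeta> n *s x + w *s (\<zeta> n *s v) = \<zeta> n *s (x + w *s v)" for n w
    by (simp add: vec_eq_iff algebra_simps)
  have cont_line: "continuous_on A (\<lambda>w. x + w *s v)" for A
    unfolding vector_scalar_mult_def by (intro continuous_intros)
  have openS: "open ?S"
    using open_vimage[OF open_ball cont_line[of UNIV], of 0 1] by (simp add: vimage_def)
  show ?case
  proof (rule holomorphic_uniform_sequence[OF openS])
    fix n
    have "(\<lambda>w. F (\<zeta> n *s x + w *s (\<zeta> n *s v))) holomorphic_on ?S"
    proof (rule holomorphic_on_subset[OF line_holomorphic])
      show "?S \<subseteq> {w. \<zeta> n *s x + w *s (\<zeta> n *s v) \<in> ball 0 1}"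
      proof
        fix w assume w: "w \<in> ?S"
        have "norm (\<zeta> n *s (x + w *s v)) \<le> norm (x + w *s v)"
          unfolding norm_vector_scalar_mult using \<zeta>(3)[of n] by (intro mult_left_le_one_le) auto
        then show "w \<in> {w. \<zeta> n *s x + w *s (\<zeta> n *s v) \<in> ball 0 1}"
          using w unfolding line mem_Collect_eq mem_ball_0 by linarith
      qed
    qed
    then have "(\<lambda>w. F (\<zeta> n *s (x + w *s v))) holomorphic_on ?S"
      unfolding line .
    then show "g n holomorphic_on ?S"
      unfolding g_def[abs_def] using \<zeta>(1) by (intro holomorphic_intros less) auto
  next
    fix w0 assume "w0 \<in> ?S"
    then obtain d where d: "0 < d" "cball w0 d \<subseteq> ?S"
      using openS open_contains_cball by blast
    have "uniform_limit (cball w0 d) g (\<lambda>w. hpart F k (x + w *s v)) sequentially"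
    proof (rule uniform_limitI)
      fix e :: real assume "0 < e"
      have "(\<lambda>n. 2 * M * (1 / (real n + 2))) \<longlonglongrightarrow> 2 * M * 0"
        using LIMSEQ_ignore_initial_segment[OF lim_1_over_n[where 'a = real], of 2] by (intro tendsto_mult tendsto_const) (simp add: add.commute)
      then have "\<forall>\<^sub>F n in sequentially. 2 * M * (1 / (real n + 2)) < e"
        using \<open>0 < e\<close> by (intro order_tendstoD(2)) auto
      then show "\<forall>\<^sub>F n in sequentially. \<forall>w\<in>cball w0 d. dist (g n w) (hpart F k (x + w *s v)) < e"
      proof (rule eventually_mono, intro ballI)
        fix n w assume n: "2 * M * (1 / (real n + 2)) < e" and "w \<in> cball w0 d"
        define y where "y = x + w *s v"
        have "norm y \<le> 1"
          using d(2) \<open>w \<in> cball w0 d\<close> by (auto simp: y_def subset_iff)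
        have "0 \<le> M" by (rule bound_nonneg)
        have "norm (g n w - hpart F k y) = norm (F (\<zeta> n *s y) - (\<Sum>j<Suc k. hpart F j y * \<zeta> n ^ j)) / norm (\<zeta> n) ^ k"
        proof -
          have "g n w - hpart F k y = (F (\<zeta> n *s y) - (\<Sum>j<Suc k. hpart F j y * \<zeta> n ^ j)) / \<zeta> n ^ k"
            using \<zeta>(1)[of n] by (simp add: g_def y_def diff_divide_distrib add_divide_distrib)
          then show ?thesis by (simp add: norm_divide norm_power)
        qed
        also have "\<dots> \<le> (M * norm (\<zeta> n) ^ Suc k / (1 - norm (\<zeta> n))) / norm (\<zeta> n) ^ k"
          using \<zeta>(3)[of n] \<open>norm y \<le> 1\<close> by (intro divide_right_mono hpart_remainder) auto
        also have "\<dots> = M * norm (\<zeta> n) / (1 - norm (\<zeta> n))"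
          using \<zeta>(1)[of n] by simp
        also have "\<dots> \<le> M * norm (\<zeta> n) / (1 / 2)"
          using \<zeta>(3)[of n] \<open>0 \<le> M\<close> by (intro divide_left_mono) auto
        also have "\<dots> = 2 * M * (1 / (real n + 2))"
          by (simp add: \<zeta>(2))
        finally show "dist (g n w) (hpart F k (x + w *s v)) < e"
          using n by (simp add: dist_norm y_def)
      qed
    qed
    then show "\<exists>d>0. cball w0 d \<subseteq> ?S \<and> uniform_limit (cball w0 d) g (\<lambda>w. hpart F k (x + w *s v)) sequentially"
      using d by blast
  qed
qed

text \<open>\<open>hpart F k\<close> continued by homogeneity from the ball to the whole space,
  because Liouville's theorem needs entire lines. Shrinking by \<open>1 + |z|\<close> puts every
  point into the ball without a case distinction.\<close>

definition hext :: "nat \<Rightarrow> complex ^ 'm \<Rightarrow> complex" where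
  "hext k z = of_real (1 + norm z) ^ k * hpart F k (of_real (1 / (1 + norm z)) *s z)"

text \<open>The shrinking factor may be kept constant over a bounded set; there the extension
  inherits holomorphy along lines from \<open>hpart\<close>.\<close>

lemma hext_eq:
  assumes "0 < t" "t \<le> 1 / (1 + norm z)"
  shows "hext k z = of_real (1 / t) ^ k * hpart F k (of_real t *s z)"
proof -
  define s where "s = 1 / (1 + norm z)"
  have "0 < 1 + norm z" by (simp add: add_pos_nonneg)
  then have s: "0 < s" "t \<le> s" "norm (of_real s *s z) \<le> 1"
    using assms norm_shrink_le[of z] by (auto simp only: s_def zero_less_divide_1_iff)
  have "of_real t *s z = of_real (t / s) *s (of_real s *s z)"
    unfolding vector_smult_assoc of_real_mult[symmetric] using s(1) by simp
  moreover have "norm (complex_of_real (t / s)) \<le> 1"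
    unfolding norm_of_real using s assms(1) by simp
  ultimately have "hpart F k (of_real t *s z) = of_real (t / s) ^ k * hpart F k (of_real s *s z)"
    using hpart_scale[OF s(3)] by metis
  moreover have "hext k z = of_real (1 / s) ^ k * hpart F k (of_real s *s z)"
    by (simp add: hext_def s_def)
  moreover have "of_real (1 / t) ^ k * of_real (t / s) ^ k = (of_real (1 / s) ^ k :: complex)"
    using assms(1) by (intro of_real_power_mult) simp
  ultimately show ?thesis
    by (simp flip: mult.assoc)
qed

lemma hext_eq_hpart:
  assumes "norm z \<le> 1"
  shows "hext k z = hpart F k z"
proof -
  have pos: "0 < 1 + norm z" by (simp add: add_pos_nonneg)
  have "hpart F k (of_real (1 / (1 + norm z)) *s z) = of_real (1 / (1 + norm z)) ^ k * hpart F k z"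
    using assms pos by (intro hpart_scale) (simp_all only: norm_of_real, simp)
  moreover have "of_real (1 + norm z) ^ k * of_real (1 / (1 + norm z)) ^ k = (of_real 1 ^ k :: complex)"
    using pos by (intro of_real_power_mult) simp
  ultimately show ?thesis
    unfolding hext_def by (simp only: mult.assoc[symmetric] of_real_1 power_one mult_1)
qed

text \<open>Liouville's theorem: on a line the extension is entire and grows at most like
  \<open>|w|^k\<close>, by homogeneity and the bound \<open>M\<close> on the ball.\<close>

lemma hext_line_poly: "\<exists>p. degree p \<le> k \<and> (\<forall>w. hext k (x + w *s v) = poly p w)"
proof -
  define f where "f w = hext k (x + w *s v)" for w
  have "f holomorphic_on ball 0 \<rho>" if "0 < \<rho>" for \<rho>
  proof -
    \<comment> \<open>One factor that shrinks all points \<open>x + w *s v\<close> with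
      \<open>|w| < \<rho>\<close> into the ball.\<close>
    define t where "t = 1 / (1 + (norm x + \<rho> * norm v))"
    have denom: "0 < 1 + (norm x + \<rho> * norm v)"
      using that by (intro add_pos_nonneg add_nonneg_nonneg) auto
    then have "0 < t" by (simp add: t_def)
    have norm_le: "norm (x + w *s v) \<le> norm x + \<rho> * norm v" if "w \<in> ball 0 \<rho>" for w :: complex
    proof -
      have "norm (x + w *s v) \<le> norm x + norm w * norm v"
        using norm_triangle_ineq[of x "w *s v"] by (simp add: norm_vector_scalar_mult)
      also have "\<dots> \<le> norm x + \<rho> * norm v"
        using that by (intro add_left_mono mult_right_mono) auto
      finally show ?thesis .
    qed
    have line: "of_real t *s x + w *s (of_real t *s v) = of_real t *s (x + w *s v)" for w
      by (simp add: vec_eq_iff algebra_simps)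
    have "(\<lambda>w. hpart F k (of_real t *s x + w *s (of_real t *s v))) holomorphic_on ball 0 \<rho>"
    proof (rule holomorphic_on_subset[OF hpart_line_holomorphic])
      show "ball 0 \<rho> \<subseteq> {w. of_real t *s x + w *s (of_real t *s v) \<in> ball 0 1}"
      proof
        fix w :: complex assume "w \<in> ball 0 \<rho>"
        then have "norm (x + w *s v) < 1 + (norm x + \<rho> * norm v)"
          using norm_le[of w] by simp
        then show "w \<in> {w. of_real t *s x + w *s (of_real t *s v) \<in> ball 0 1}"
          unfolding line mem_Collect_eq mem_ball_0 norm_vector_scalar_mult norm_of_real
          using \<open>0 < t\<close> denom by (simp add: t_def)
      qed
    qed
    then have "(\<lambda>w. of_real (1 / t) ^ k * hpart F k (of_real t *s x + w *s (of_real t *s v))) holomorphic_on ball 0 \<rho>"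
      by (intro holomorphic_intros)
    then show ?thesis
    proof (rule holomorphic_transform)
      fix w :: complex assume w: "w \<in> ball 0 \<rho>"
      have "t \<le> 1 / (1 + norm (x + w *s v))"
        unfolding t_def using norm_le[OF w] by (intro divide_left_mono) (auto intro!: mult_pos_pos denom simp: add_pos_nonneg)
      then show "of_real (1 / t) ^ k * hpart F k (of_real t *s x + w *s (of_real t *s v)) = f w"
        unfolding line f_def by (rule hext_eq[OF \<open>0 < t\<close>, symmetric])
    qed
  qed
  then have "f holomorphic_on (\<Union>\<rho>\<in>{0<..}. ball 0 \<rho>)"
    by (intro holomorphic_on_UN_open) auto
  moreover have "(\<Union>\<rho>\<in>{0<..}. ball (0::complex) \<rho>) = UNIV"
  proof -
    have "w \<in> ball 0 (norm w + 1)" "0 < norm w + 1" for w :: complex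
      by (auto simp: add_nonneg_pos)
    then show ?thesis by blast
  qed
  ultimately have holf: "f holomorphic_on UNIV" by simp
  have growth: "norm (f w) \<le> (M * (1 + norm x + norm v) ^ k) * norm w ^ k" if "1 \<le> norm w" for w
  proof -
    define y where "y = x + w *s v"
    have pos: "0 < 1 + norm y" by (simp add: add_pos_nonneg)
    have "norm (hpart F k (of_real (1 / (1 + norm y)) *s y)) \<le> M"
      by (intro norm_hpart_le norm_shrink_le)
    then have "norm (hext k y) \<le> norm (of_real (1 + norm y) ^ k :: complex) * M"
      unfolding hext_def norm_mult by (intro mult_left_mono) auto
    also have "norm (of_real (1 + norm y) ^ k :: complex) = (1 + norm y) ^ k"
      using pos by (simp add: norm_power del: of_real_add)
    also have "(1 + norm y) ^ k * M \<le> ((1 + norm x + norm v) * norm w) ^ k * M"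
    proof (intro mult_right_mono power_mono)
      have "norm y \<le> norm x + norm w * norm v"
        unfolding y_def using norm_triangle_ineq[of x "w *s v"] by (simp add: norm_vector_scalar_mult)
      moreover have "1 + norm x \<le> (1 + norm x) * norm w"
        using that mult_left_mono[of 1 "norm w" "1 + norm x"] by simp
      ultimately show "1 + norm y \<le> (1 + norm x + norm v) * norm w"
        by (simp add: algebra_simps)
      show "0 \<le> M" by (rule bound_nonneg)
    qed (use pos in auto)
    finally show ?thesis
      by (simp add: f_def y_def power_mult_distrib mult_ac)
  qed
  define p where "p = (\<Sum>j\<le>k. monom ((deriv ^^ j) f 0 / fact j) j)"
  have "f w = poly p w" for w
    using Liouville_polynomial[OF holf growth] by (simp add: p_def poly_sum poly_monom)
  moreover have "degree p \<le> k"
    unfolding p_def by (intro degree_sum_le) (auto intro: order_trans[OF degree_monom_le])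
  ultimately show ?thesis
    unfolding f_def by blast
qed

lemma hext_poly_fun: "hext k \<in> poly_fun"
proof (rule separately_poly_imp_poly_fun[where I = UNIV and k = k])
  fix z and i :: 'm
  define x where "x = vupd z i 0"
  have "vupd z i w = x + w *s axis i 1" for w
    by (auto simp: x_def vupd_def vec_eq_iff axis_def)
  then show "\<exists>p. degree p \<le> k \<and> (\<forall>w. hext k (vupd z i w) = poly p w)"
    using hext_line_poly[of k x "axis i 1"] by simp
next
  fix z z' :: "complex ^ 'm" assume "\<And>i. i \<in> UNIV \<Longrightarrow> z $ i = z' $ i"
  then have "z = z'" by (simp add: vec_eq_iff)
  then show "hext k z = hext k z'" by simp
qed simp

text \<open>Dilate, then truncate: \<open>F\<close> at \<open>r z\<close> is close to
  \<open>F z\<close> by uniform continuity up to the boundary, and its expansion into homogeneous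
  parts converges geometrically.\<close>

lemma poly_fun_approx:
  assumes "0 < e"
  shows "\<exists>Q\<in>poly_fun. \<forall>z\<in>cball 0 1. norm (F z - Q z) < e"
proof -
  have "uniformly_continuous_on (cball 0 1) F"
    using compact_uniformly_continuous[OF cont] by simp
  then obtain d where d: "0 < d" "\<And>z y. z \<in> cball 0 1 \<Longrightarrow> y \<in> cball 0 1 \<Longrightarrow> dist y z < d \<Longrightarrow> dist (F y) (F z) < e / 2"
    unfolding uniformly_continuous_on_def using assms half_gt_zero by metis
  define r where "r = max (1 / 2) (1 - d / 2)"
  have r: "0 < r" "r < 1" "1 - r < d"
    using d(1) by (auto simp: r_def)
  have "(\<lambda>k. M * r ^ k / (1 - r)) \<longlonglongrightarrow> M * 0 / (1 - r)"
    using r by (intro tendsto_intros LIMSEQ_power_zero) auto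
  then have "\<forall>\<^sub>F k in sequentially. M * r ^ k / (1 - r) < e / 2"
    using assms by (intro order_tendstoD(2)) auto
  then obtain k where k: "M * r ^ k / (1 - r) < e / 2"
    using eventually_happens' sequentially_bot by blast
  define Q where "Q z = (\<Sum>j<k. hext j z * of_real r ^ j)" for z
  \<comment> \<open>A coordinate to the power 0, whichever coordinate it is, leaves multiplication
    by a constant.\<close>
  have "(\<lambda>z. hext j z * of_real r ^ j) \<in> poly_fun" for j
    using poly_fun_cmult_coord[OF hext_poly_fun, of "of_real r ^ j" undefined 0 j] by (simp add: mult.commute)
  then have "Q \<in> poly_fun"
    unfolding Q_def[abs_def] by (intro poly_fun_sum) auto
  moreover have "norm (F z - Q z) < e" if z: "z \<in> cball 0 1" for z
  proof -
    have "norm (F (of_real r *s z) - Q z) < e / 2"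
    proof -
      have "norm (F (of_real r *s z) - (\<Sum>j<k. hpart F j z * of_real r ^ j)) \<le> M * r ^ k / (1 - r)"
        using hpart_remainder[of z "of_real r" k] z r by simp
      moreover have "Q z = (\<Sum>j<k. hpart F j z * of_real r ^ j)"
        using z by (simp add: Q_def hext_eq_hpart)
      ultimately show ?thesis using k by (metis order_le_less_trans)
    qed
    moreover have "norm (F z - F (of_real r *s z)) < e / 2"
    proof -
      have "dist z (of_real r *s z) = norm ((1 - r) *\<^sub>R z)"
        by (simp add: dist_norm of_real_vector_scalar_mult scaleR_left_diff_distrib)
      also have "\<dots> \<le> 1 - r"
        using z r by (simp add: mult_left_le)
      finally have "dist z (of_real r *s z) < d" using r by simp
      moreover have "of_real r *s z \<in> cball 0 1"
        using z r by (simp add: norm_vector_scalar_mult mult_le_one)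
      ultimately show ?thesis
        using d(2)[of "of_real r *s z" z] z by (simp add: dist_norm)
    qed
    ultimately show ?thesis
      using norm_triangle_ineq[of "F z - F (of_real r *s z)" "F (of_real r *s z) - Q z"] by simp
  qed
  ultimately show ?thesis by blast
qed

end

lemma ball_algebra_poly_fun_approx:
  assumes "g \<in> ball_algebra" "0 < e"
  shows "\<exists>Q\<in>poly_fun. \<forall>z\<in>sphere 0 1. norm (g z - Q z) < e"
proof -
  obtain F where F: "continuous_on (cball 0 1) F" "holo_on (ball 0 1) F" "\<And>x. x \<in> sphere 0 1 \<Longrightarrow> F x = g x"
    using assms(1) unfolding ball_algebra_def by blast
  have "bounded (F ` cball 0 1)"
    using compact_continuous_image[OF F(1) compact_cball] by (rule compact_imp_bounded)
  then obtain M where "\<And>z. z \<in> cball 0 1 \<Longrightarrow> norm (F z) \<le> M"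
    unfolding bounded_iff by blast
  from poly_fun_approx[OF F(1,2) this assms(2)] show ?thesis
    using F(3) by (metis mem_cball_0 mem_sphere_0 order_refl)
qed

section \<open>Transference from the circle to the sphere\<close>

definition sphere_ip :: "(complex ^ 'm::finite \<Rightarrow> complex) \<Rightarrow> (complex ^ 'm \<Rightarrow> complex) \<Rightarrow> complex" where
  "sphere_ip f g = (\<integral>x. f x * cnj (g x) \<partial>sphere_measure)"

lemma zmonom_torus_act: "zmonom \<alpha> (torus_act u z) = (\<Prod>i\<in>UNIV. u i ^ \<alpha> i) * zmonom \<alpha> z"
  by (simp add: zmonom_def torus_act_def power_mult_distrib prod.distrib)

text \<open>Rotate a coordinate \<open>i\<close> with \<open>\<alpha> i \<noteq> \<beta> i\<close>
  by the angle \<open>\<theta>\<close> for which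
  \<open>(\<alpha> i - \<beta> i) \<theta> = pi\<close>: the integrand changes sign while the
  integral stays the same.\<close>

lemma sphere_ip_zmonom_distinct:
  assumes "\<alpha> \<noteq> \<beta>"
  shows "sphere_ip (zmonom \<alpha>) (zmonom \<beta>) = 0"
proof -
  obtain i where i: "\<alpha> i \<noteq> \<beta> i" using assms by auto
  define \<theta> where "\<theta> = pi / (real (\<alpha> i) - real (\<beta> i))"
  define u where "u j = (if j = i then cis \<theta> else 1)" for j
  have u_prod: "(\<Prod>j\<in>UNIV. u j ^ \<gamma> j) = cis \<theta> ^ \<gamma> i" for \<gamma>
    unfolding u_def by (subst prod.remove[of _ i]) (auto intro!: prod.neutral)
  have "cis \<theta> ^ \<alpha> i * cnj (cis \<theta> ^ \<beta> i) = cis ((real (\<alpha> i) - real (\<beta> i)) * \<theta>)"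
    unfolding complex_cnj_power cis_cnj Complex.DeMoivre cis_mult
    by (rule arg_cong[where f = cis]) (simp add: algebra_simps)
  also have "\<dots> = - 1"
    using i by (simp add: \<theta>_def)
  finally have minus: "cis \<theta> ^ \<alpha> i * cnj (cis \<theta> ^ \<beta> i) = - 1" .
  define f where "f x = zmonom \<alpha> x * cnj (zmonom \<beta> x)" for x
  have meas: "f \<in> borel_measurable sphere_measure"
    unfolding f_def by (intro sphere_measurable_continuous continuous_intros)
  have "(\<integral>x. f (torus_act u x) \<partial>sphere_measure) = integral\<^sup>L sphere_measure f"
    by (rule sphere_integral_torus_act[OF meas]) (simp add: u_def)
  moreover have "f (torus_act u x) = - f x" for x
  proof -
    have "f (torus_act u x) = (cis \<theta> ^ \<alpha> i * cnj (cis \<theta> ^ \<beta> i)) * f x"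
      unfolding f_def zmonom_torus_act u_prod complex_cnj_mult by (simp only: mult_ac)
    then show ?thesis unfolding minus by simp
  qed
  ultimately have "integral\<^sup>L sphere_measure f = 0"
    by simp
  then show ?thesis
    by (simp add: sphere_ip_def f_def[abs_def])
qed

definition znorm2 :: "('m::finite \<Rightarrow> nat) \<Rightarrow> real" where
  "znorm2 \<alpha> = (\<integral>x. (norm (zmonom \<alpha> x))\<^sup>2 \<partial>sphere_measure)"

lemma sphere_ip_self:
  "sphere_ip f f = of_real (\<integral>x. (norm (f x))\<^sup>2 \<partial>sphere_measure)"
  unfolding sphere_ip_def complex_norm_square[symmetric] by (rule integral_complex_of_real)

lemma znorm2_pos: "0 < znorm2 \<alpha>"
proof -
  \<comment> \<open>A point with no vanishing coordinate, so that no monomial vanishes at its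
    normalization.\<close>
  define x :: "complex ^ 'a" where "x = (\<chi> i. 1)"
  have "x \<noteq> 0" by (simp add: x_def vec_eq_iff)
  define y where "y = x /\<^sub>R norm x"
  have "y \<in> sphere 0 1" using \<open>x \<noteq> 0\<close> by (simp add: y_def)
  have "zmonom \<alpha> y \<noteq> 0"
    using \<open>x \<noteq> 0\<close> by (simp add: zmonom_def y_def x_def)
  have "znorm2 \<alpha> \<noteq> 0"
  proof
    assume "znorm2 \<alpha> = 0"
    moreover have "continuous_on (sphere 0 1) (\<lambda>x::complex ^ 'a. (norm (zmonom \<alpha> x))\<^sup>2)"
      by (intro continuous_intros)
    ultimately have "(norm (zmonom \<alpha> y))\<^sup>2 = 0"
      using sphere_integral_eq_0_imp[of "\<lambda>x. (norm (zmonom \<alpha> x))\<^sup>2" y] \<open>y \<in> sphere 0 1\<close>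
      unfolding znorm2_def by simp
    then show False using \<open>zmonom \<alpha> y \<noteq> 0\<close> by simp
  qed
  moreover have "0 \<le> znorm2 \<alpha>"
    unfolding znorm2_def by (intro Bochner_Integration.integral_nonneg) simp
  ultimately show ?thesis by simp
qed

lemma finite_mdeg_le: "finite {\<alpha>::'m::finite \<Rightarrow> nat. mdeg \<alpha> \<le> N}"
proof (rule finite_subset)
  show "{\<alpha>::'m \<Rightarrow> nat. mdeg \<alpha> \<le> N} \<subseteq> (\<Pi>\<^sub>E i\<in>UNIV. {..N})"
  proof
    fix \<alpha> :: "'m \<Rightarrow> nat" assume "\<alpha> \<in> {\<alpha>. mdeg \<alpha> \<le> N}"
    moreover have "\<alpha> i \<le> mdeg \<alpha>" for i
      unfolding mdeg_def by (rule member_le_sum) auto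
    ultimately show "\<alpha> \<in> (\<Pi>\<^sub>E i\<in>UNIV. {..N})"
      using order_trans by fastforce
  qed
qed (auto intro: finite_PiE)

text \<open>Orthogonal projection onto the holomorphic monomials of degree at most \<open>N\<close>,
  in general only a part of the spectral space; on Hardy functions it is \<open>riesz0\<close> by
  \<open>riesz0_eq_hproj\<close>. Monomials are bounded on the sphere, so the coefficients make
  sense for integrable \<open>f\<close>.\<close>

definition hproj :: "nat \<Rightarrow> (complex ^ 'm::finite \<Rightarrow> complex) \<Rightarrow> complex ^ 'm \<Rightarrow> complex" where
  "hproj N f z = (\<Sum>\<alpha> | mdeg \<alpha> \<le> N. sphere_ip f (zmonom \<alpha>) / of_real (znorm2 \<alpha>) * zmonom \<alpha> z)"

lemma sphere_ip_sum_left: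
  assumes "finite A" "\<And>i. i \<in> A \<Longrightarrow> continuous_on (sphere 0 1) (f i)" "continuous_on (sphere 0 1) g"
  shows "sphere_ip (\<lambda>x. \<Sum>i\<in>A. c i * f i x) g = (\<Sum>i\<in>A. c i * sphere_ip (f i) g)"
proof -
  have "sphere_ip (\<lambda>x. \<Sum>i\<in>A. c i * f i x) g = (\<integral>x. (\<Sum>i\<in>A. c i * (f i x * cnj (g x))) \<partial>sphere_measure)"
    by (simp add: sphere_ip_def sum_distrib_right mult.assoc)
  also have "\<dots> = (\<Sum>i\<in>A. \<integral>x. c i * (f i x * cnj (g x)) \<partial>sphere_measure)"
    using assms by (intro Bochner_Integration.integral_sum sphere_integrable_continuous continuous_intros) auto
  finally show ?thesis by (simp add: sphere_ip_def)
qed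

lemma hproj_poly:
  assumes "finite A"
  shows "hproj N (\<lambda>z. \<Sum>\<alpha>\<in>A. c \<alpha> * zmonom \<alpha> z) z = (\<Sum>\<alpha>\<in>A. if mdeg \<alpha> \<le> N then c \<alpha> * zmonom \<alpha> z else 0)"
proof -
  have ip: "sphere_ip (\<lambda>z. \<Sum>\<alpha>\<in>A. c \<alpha> * zmonom \<alpha> z) (zmonom \<beta>) = (if \<beta> \<in> A then c \<beta> * of_real (znorm2 \<beta>) else 0)" for \<beta>
  proof -
    have "sphere_ip (\<lambda>z. \<Sum>\<alpha>\<in>A. c \<alpha> * zmonom \<alpha> z) (zmonom \<beta>) = (\<Sum>\<alpha>\<in>A. c \<alpha> * sphere_ip (zmonom \<alpha>) (zmonom \<beta>))"
      using assms by (intro sphere_ip_sum_left continuous_intros)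
    also have "\<dots> = (\<Sum>\<alpha>\<in>A. if \<alpha> = \<beta> then c \<beta> * of_real (znorm2 \<beta>) else 0)"
      by (intro sum.cong) (auto simp: sphere_ip_zmonom_distinct sphere_ip_self znorm2_def)
    finally show ?thesis using assms by simp
  qed
  have "hproj N (\<lambda>z. \<Sum>\<alpha>\<in>A. c \<alpha> * zmonom \<alpha> z) z = (\<Sum>\<alpha> | mdeg \<alpha> \<le> N. if \<alpha> \<in> A then c \<alpha> * zmonom \<alpha> z else 0)"
    unfolding hproj_def ip using less_imp_neq[OF znorm2_pos] by (intro sum.cong) auto
  also have "\<dots> = (\<Sum>\<alpha>\<in>{\<alpha>. mdeg \<alpha> \<le> N} \<inter> A. c \<alpha> * zmonom \<alpha> z)"
    by (rule sum.inter_restrict[symmetric, OF finite_mdeg_le])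
  also have "\<dots> = (\<Sum>\<alpha>\<in>A. if mdeg \<alpha> \<le> N then c \<alpha> * zmonom \<alpha> z else 0)"
    by (subst Int_commute) (simp add: sum.inter_restrict[OF assms])
  finally show ?thesis .
qed

lemma continuous_on_hproj [continuous_intros]: "continuous_on A (hproj N f)"
  unfolding hproj_def[abs_def] by (intro continuous_on_sum continuous_on_mult continuous_on_const continuous_on_zmonom)

lemma sphere_measure_to_borel: "(\<lambda>x. x) \<in> sphere_measure \<rightarrow>\<^sub>M borel"
proof -
  have "(\<lambda>x. x) \<in> restrict_space borel (sphere 0 1) \<rightarrow>\<^sub>M borel"
    by (intro measurable_restrict_space1) simp
  then show ?thesis
    by (simp cong: measurable_cong_sets add: sets_sphere_measure)
qed

lemma continuous_on_scalar_slice: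
  assumes "continuous_on UNIV H"
  shows "continuous_on A (\<lambda>p. H (cis (fst p) *s (snd p :: complex ^ 'm::finite)))"
proof (rule continuous_on_compose2[OF assms])
  show "continuous_on A (\<lambda>p. cis (fst p) *s (snd p :: complex ^ 'm))"
    unfolding vector_scalar_mult_def by (intro continuous_intros)
qed simp

text \<open>Fubini and rotation invariance: for each \<open>t\<close> the integral over the sphere
  is that of \<open>H\<close> itself.\<close>

lemma slice_average:
  fixes H :: "complex ^ 'm::finite \<Rightarrow> real"
  assumes H: "continuous_on UNIV H"
  shows "integrable sphere_measure (\<lambda>z. integral {0..2 * pi} (\<lambda>t. H (cis t *s z)))"
    and "(\<integral>z. integral {0..2 * pi} (\<lambda>t. H (cis t *s z)) \<partial>sphere_measure) = 2 * pi * integral\<^sup>L sphere_measure H"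
proof -
  have "continuous_on UNIV (\<lambda>z. integral (cbox 0 (2 * pi)) (\<lambda>t. H (cis t *s z)))"
  proof (rule integral_continuous_on_param)
    have "continuous_on (UNIV \<times> cbox 0 (2 * pi)) (\<lambda>p. H (cis (snd p) *s fst p))"
      using continuous_on_compose2[OF continuous_on_scalar_slice[OF H, of UNIV], of "UNIV \<times> cbox 0 (2 * pi)" prod.swap]
      by (simp add: continuous_on_swap)
    then show "continuous_on (UNIV \<times> cbox 0 (2 * pi)) (\<lambda>(z, t). H (cis t *s z))"
      by (simp add: case_prod_unfold)
  qed
  then have cont: "continuous_on UNIV (\<lambda>z. integral {0..2 * pi} (\<lambda>t. H (cis t *s z)))"
    by simp
  show "integrable sphere_measure (\<lambda>z. integral {0..2 * pi} (\<lambda>t. H (cis t *s z)))"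
    by (rule sphere_integrable_continuous[OF continuous_on_subset[OF cont subset_UNIV]])
  \<comment> \<open>A finite measure, so that a bounded measurable integrand is integrable on the
    product.\<close>
  define T where "T = restrict_space lborel {0..2 * pi}"
  interpret S: finite_measure "sphere_measure :: (complex ^ 'm) measure"
    by (rule finite_measure_sphere_measure)
  have measT: "measure T (space T) = 2 * pi" "emeasure T (space T) \<noteq> \<infinity>"
    by (auto simp: T_def space_restrict_space measure_restrict_space emeasure_restrict_space)
  interpret T: finite_measure T
    by standard (rule measT(2))
  interpret TS: pair_sigma_finite T "sphere_measure :: (complex ^ 'm) measure" ..
  interpret TSf: finite_measure "T \<Otimes>\<^sub>M (sphere_measure :: (complex ^ 'm) measure)"
    by (rule finite_measure_pair_measure) (rule T.finite_measure_axioms S.finite_measure_axioms)+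
  obtain B where B: "0 \<le> B" "\<And>z. z \<in> sphere 0 1 \<Longrightarrow> norm (H z) \<le> B"
    using sphere_bounded_continuous[OF continuous_on_subset[OF H subset_UNIV]] by blast
  have meas: "(\<lambda>p. H (cis (fst p) *s snd p)) \<in> borel_measurable (T \<Otimes>\<^sub>M sphere_measure)"
  proof -
    have cont: "(\<lambda>p. H (cis (fst p) *s snd p)) \<in> borel_measurable (borel \<Otimes>\<^sub>M borel)"
      unfolding borel_prod by (intro borel_measurable_continuous_onI continuous_on_scalar_slice H)
    have "(\<lambda>x. x) \<in> T \<rightarrow>\<^sub>M borel"
      unfolding T_def by (intro measurable_restrict_space1) simp
    then have "(\<lambda>p. (fst p, snd p)) \<in> T \<Otimes>\<^sub>M sphere_measure \<rightarrow>\<^sub>M borel \<Otimes>\<^sub>M borel"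
      by (intro measurable_Pair measurable_compose[OF measurable_fst] measurable_compose[OF measurable_snd] sphere_measure_to_borel)
    from measurable_compose[OF this cont] show ?thesis by simp
  qed
  have rot: "cis t *s z = torus_act (\<lambda>_. cis t) z" for t and z :: "complex ^ 'm"
    by (simp add: torus_act_def vector_scalar_mult_def)
  have integrable: "integrable (T \<Otimes>\<^sub>M sphere_measure) (\<lambda>(t, z). H (cis t *s z))"
    unfolding case_prod_unfold
  proof (rule TSf.integrable_const_bound[OF _ meas])
    show "AE p in T \<Otimes>\<^sub>M sphere_measure. norm (H (cis (fst p) *s snd p)) \<le> B"
      by (intro AE_I2 B) (auto simp: space_pair_measure norm_vector_scalar_mult)
  qed
  have "(\<integral>z. integral {0..2 * pi} (\<lambda>t. H (cis t *s z)) \<partial>sphere_measure)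
      = (\<integral>z. (\<integral>t. H (cis t *s z) \<partial>T) \<partial>sphere_measure)"
  proof (intro Bochner_Integration.integral_cong refl)
    fix z :: "complex ^ 'm"
    have "continuous_on {0..2 * pi} (\<lambda>t. H (cis t *s z))"
      using continuous_on_compose2[OF continuous_on_scalar_slice[OF H, of UNIV], of "{0..2 * pi}" "\<lambda>t. (t, z)"]
      by (simp add: continuous_on_Pair)
    then have "set_integrable lborel {0..2 * pi} (\<lambda>t. H (cis t *s z))"
      by (rule borel_integrable_atLeastAtMost')
    then have "integral {0..2 * pi} (\<lambda>t. H (cis t *s z)) = (\<integral>t. indicator {0..2 * pi} t *\<^sub>R H (cis t *s z) \<partial>lborel)"
      unfolding set_lebesgue_integral_def[symmetric] by (rule set_borel_integral_eq_integral(2)[symmetric])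
    then show "integral {0..2 * pi} (\<lambda>t. H (cis t *s z)) = (\<integral>t. H (cis t *s z) \<partial>T)"
      unfolding T_def by (subst integral_restrict_space) auto
  qed
  also have "\<dots> = (\<integral>t. (\<integral>z. H (cis t *s z) \<partial>sphere_measure) \<partial>T)"
    by (rule TS.Fubini_integral[OF integrable])
  also have "\<dots> = (\<integral>t. integral\<^sup>L sphere_measure H \<partial>T)"
    unfolding rot using sphere_measurable_continuous[OF continuous_on_subset[OF H subset_UNIV]]
    by (intro Bochner_Integration.integral_cong refl sphere_integral_torus_act) auto
  also have "\<dots> = 2 * pi * integral\<^sup>L sphere_measure H"
    by (simp add: measT)
  finally show "(\<integral>z. integral {0..2 * pi} (\<lambda>t. H (cis t *s z)) \<partial>sphere_measure) = 2 * pi * integral\<^sup>L sphere_measure H" .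
qed

text \<open>With the monomials grouped by degree, \<open>Q\<close> on the slice through
  \<open>z\<close> is a polynomial in \<open>cis t\<close> with coefficients \<open>d k z\<close>,
  and \<open>hproj N\<close> takes its \<open>N\<close>-th partial sum. The circle inequality holds
  for every \<open>z\<close> with the same \<open>C\<close> and is averaged over the sphere.
  Separate \<open>G\<close> and \<open>J\<close> cover the strong and the weak estimate at
  once.\<close>

lemma hproj_transference:
  fixes G J :: "real \<Rightarrow> real" and Q :: "complex ^ 'm::finite \<Rightarrow> complex"
  assumes contG: "continuous_on {0..} G" and contJ: "continuous_on {0..} J"
    and circle: "\<And>c K. integral {0..2 * pi} (\<lambda>t. G (norm (\<Sum>k\<le>K. if k \<le> N then c k * cis t ^ k else 0)))
      \<le> C * integral {0..2 * pi} (\<lambda>t. J (norm (\<Sum>k\<le>K. c k * cis t ^ k)))"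
    and "Q \<in> poly_fun"
  shows "(\<integral>z. G (norm (hproj N Q z)) \<partial>sphere_measure) \<le> C * (\<integral>z. J (norm (Q z)) \<partial>sphere_measure)"
proof -
  obtain A c where A: "finite A" "Q = (\<lambda>z. \<Sum>\<alpha>\<in>A. c \<alpha> * zmonom \<alpha> z)"
    using \<open>Q \<in> poly_fun\<close> unfolding poly_fun_def by auto
  \<comment> \<open>The inserted 0 keeps \<open>Max\<close> meaningful when \<open>A\<close> is
    empty.\<close>
  define K where "K = Max (insert 0 (mdeg ` A))"
  have K: "mdeg \<alpha> \<le> K" if "\<alpha> \<in> A" for \<alpha>
    unfolding K_def using A(1) that by (intro Max_ge) auto
  define d where "d k z = (\<Sum>\<alpha>\<in>{\<alpha> \<in> A. mdeg \<alpha> = k}. c \<alpha> * zmonom \<alpha> z)" for k z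
  have group: "(\<Sum>\<alpha>\<in>A. f \<alpha>) = (\<Sum>k\<le>K. \<Sum>\<alpha>\<in>{\<alpha> \<in> A. mdeg \<alpha> = k}. f \<alpha>)" for f :: "_ \<Rightarrow> complex"
    using A(1) K by (intro sum.group[symmetric]) auto
  have Q_slice: "Q (cis t *s z) = (\<Sum>k\<le>K. d k z * cis t ^ k)" for t z
  proof -
    have "Q (cis t *s z) = (\<Sum>k\<le>K. \<Sum>\<alpha>\<in>{\<alpha> \<in> A. mdeg \<alpha> = k}. c \<alpha> * zmonom \<alpha> (cis t *s z))"
      unfolding A(2) by (rule group)
    also have "\<dots> = (\<Sum>k\<le>K. d k z * cis t ^ k)"
      unfolding d_def sum_distrib_right by (intro sum.cong refl) (auto simp: zmonom_scale mult_ac)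
    finally show ?thesis .
  qed
  have P_slice: "hproj N Q (cis t *s z) = (\<Sum>k\<le>K. if k \<le> N then d k z * cis t ^ k else 0)" for t z
  proof -
    have "hproj N Q (cis t *s z) = (\<Sum>k\<le>K. \<Sum>\<alpha>\<in>{\<alpha> \<in> A. mdeg \<alpha> = k}. if mdeg \<alpha> \<le> N then c \<alpha> * zmonom \<alpha> (cis t *s z) else 0)"
      unfolding A(2) hproj_poly[OF A(1)] by (rule group)
    also have "\<dots> = (\<Sum>k\<le>K. if k \<le> N then d k z * cis t ^ k else 0)"
    proof (intro sum.cong refl)
      fix k
      show "(\<Sum>\<alpha>\<in>{\<alpha> \<in> A. mdeg \<alpha> = k}. if mdeg \<alpha> \<le> N then c \<alpha> * zmonom \<alpha> (cis t *s z) else 0) = (if k \<le> N then d k z * cis t ^ k else 0)"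
        unfolding d_def sum_distrib_right by (auto simp: zmonom_scale mult_ac intro!: sum.cong sum.neutral)
    qed
    finally show ?thesis .
  qed
  have contQ: "continuous_on UNIV Q"
    unfolding A(2) by (intro continuous_intros)
  have contGP: "continuous_on UNIV (\<lambda>z. G (norm (hproj N Q z)))"
    by (rule continuous_on_compose2[OF contG]) (auto intro!: continuous_intros)
  have contJQ: "continuous_on UNIV (\<lambda>z. J (norm (Q z)))"
    by (rule continuous_on_compose2[OF contJ]) (auto intro!: continuous_intros contQ)
  have "2 * pi * (\<integral>z. G (norm (hproj N Q z)) \<partial>sphere_measure)
      = (\<integral>z. integral {0..2 * pi} (\<lambda>t. G (norm (hproj N Q (cis t *s z)))) \<partial>sphere_measure)"
    by (rule slice_average(2)[OF contGP, symmetric])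
  also have "\<dots> \<le> (\<integral>z. C * integral {0..2 * pi} (\<lambda>t. J (norm (Q (cis t *s z)))) \<partial>sphere_measure)"
  proof (rule integral_mono)
    fix z
    show "integral {0..2 * pi} (\<lambda>t. G (norm (hproj N Q (cis t *s z)))) \<le> C * integral {0..2 * pi} (\<lambda>t. J (norm (Q (cis t *s z))))"
      unfolding Q_slice P_slice by (rule circle)
  qed (intro slice_average(1)[OF contGP] integrable_mult_right slice_average(1)[OF contJQ])+
  also have "\<dots> = C * (2 * pi * (\<integral>z. J (norm (Q z)) \<partial>sphere_measure))"
    by (simp add: slice_average(2)[OF contJQ])
  finally have "2 * pi * (\<integral>z. G (norm (hproj N Q z)) \<partial>sphere_measure)
     \<le> 2 * pi * (C * (\<integral>z. J (norm (Q z)) \<partial>sphere_measure))"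
    by (simp add: mult_ac)
  then show ?thesis
    by (rule mult_left_le_imp_le) simp
qed

lemma hproj_Lp_poly:
  fixes p :: real
  assumes "1 < p"
  shows "\<exists>C\<ge>0. \<forall>N. \<forall>Q \<in> (poly_fun :: (complex ^ 'm::finite \<Rightarrow> complex) set).
    (\<integral>z. norm (hproj N Q z) powr p \<partial>sphere_measure) \<le> C * (\<integral>z. norm (Q z) powr p \<partial>sphere_measure)"
proof -
  obtain C where "0 \<le> C" and C: "\<And>c K N. integral {0..2 * pi} (\<lambda>t. norm (\<Sum>k\<le>K. if k \<le> N then c k * cis t ^ k else 0) powr p)
     \<le> C * integral {0..2 * pi} (\<lambda>t. norm (\<Sum>k\<le>K. c k * cis t ^ k) powr p)"
    using partial_sum_Lp[OF assms] by blast
  have "continuous_on {0..} (\<lambda>x::real. x powr p)"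
    using assms by (intro continuous_on_powr' continuous_intros) auto
  then show ?thesis
    using \<open>0 \<le> C\<close> hproj_transference[where G = "\<lambda>x. x powr p" and J = "\<lambda>x. x powr p", OF _ _ C] by blast
qed

text \<open>The circle estimate is stated at level 1; dividing all coefficients by \<open>t\<close>
  gives every other level.\<close>

lemma hproj_weak_poly:
  assumes "Q \<in> poly_fun" "0 < t"
  shows "(\<integral>z. (norm (hproj N Q z) / t)\<^sup>2 / (1 + (norm (hproj N Q z) / t)\<^sup>2) \<partial>sphere_measure)
     \<le> 8 * (\<integral>z. norm (Q z) / t \<partial>sphere_measure)"
proof (rule hproj_transference[OF _ _ _ assms(1)])
  show "continuous_on {0..} (\<lambda>x. (x / t)\<^sup>2 / (1 + (x / t)\<^sup>2))" "continuous_on {0..} (\<lambda>x. x / t)"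
    using assms(2) by (intro continuous_intros; simp add: add_nonneg_eq_0_iff)+
  fix c :: "nat \<Rightarrow> complex" and K
  define c' where "c' k = c k / of_real t" for k
  have div: "norm s / t = norm (s / of_real t)" for s :: complex
    using assms(2) by (simp add: norm_divide)
  have "(\<Sum>k\<le>K. if k \<le> N then c k * cis s ^ k else 0) / of_real t = (\<Sum>k\<le>K. if k \<le> N then c' k * cis s ^ k else 0)"
    "(\<Sum>k\<le>K. c k * cis s ^ k) / of_real t = (\<Sum>k\<le>K. c' k * cis s ^ k)" for s
    unfolding sum_divide_distrib by (intro sum.cong; simp add: c'_def)+
  then show "integral {0..2 * pi} (\<lambda>s. (norm (\<Sum>k\<le>K. if k \<le> N then c k * cis s ^ k else 0) / t)\<^sup>2
       / (1 + (norm (\<Sum>k\<le>K. if k \<le> N then c k * cis s ^ k else 0) / t)\<^sup>2))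
     \<le> 8 * integral {0..2 * pi} (\<lambda>s. norm (\<Sum>k\<le>K. c k * cis s ^ k) / t)"
    unfolding div using partial_sum_weak[where c = c' and K = K and N = N] by simp
qed

section \<open>Spectral projections on Hardy spaces\<close>

lemma poly_fun_continuous: "Q \<in> poly_fun \<Longrightarrow> continuous_on A Q"
proof -
  assume "Q \<in> poly_fun"
  then obtain B c where "Q = (\<lambda>z. \<Sum>\<alpha>\<in>B. c \<alpha> * zmonom \<alpha> z)"
    unfolding poly_fun_def by auto
  then show ?thesis
    by (simp add: continuous_on_sum continuous_on_mult continuous_on_zmonom)
qed

section \<open>Polynomial approximation in Hardy spaces\<close>

lemma powr_add_le:
  fixes x y p :: real
  assumes "0 \<le> x" "0 \<le> y" "0 \<le> p"
  shows "(x + y) powr p \<le> 2 powr p * (x powr p + y powr p)"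
proof -
  have "(x + y) powr p \<le> (2 * max x y) powr p"
    using assms by (intro powr_mono2) auto
  also have "\<dots> = 2 powr p * max x y powr p"
    by (rule powr_mult)
  also have "\<dots> \<le> 2 powr p * (x powr p + y powr p)"
    by (intro mult_left_mono) (auto simp: max_def)
  finally show ?thesis .
qed

lemma in_Lp_diff_continuous:
  fixes f g :: "complex ^ 'm::finite \<Rightarrow> complex"
  assumes f: "in_Lp p f" and "continuous_on (sphere 0 1) g" and p: "0 \<le> p"
  shows "in_Lp p (\<lambda>x. f x - g x)"
proof -
  have [measurable]: "f \<in> borel_measurable sphere_measure" "g \<in> borel_measurable sphere_measure"
    using f assms(2) by (auto simp: in_Lp_def sphere_measurable_continuous)
  obtain B where B: "0 \<le> B" "\<And>x. x \<in> sphere 0 1 \<Longrightarrow> norm (g x) \<le> B"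
    using sphere_bounded_continuous[OF assms(2)] by blast
  have "integrable sphere_measure (\<lambda>x. norm (f x - g x) powr p)"
  proof (rule Bochner_Integration.integrable_bound)
    show "integrable sphere_measure (\<lambda>x. 2 powr p * (norm (f x) powr p + B powr p))"
      using f finite_measure.integrable_const[OF finite_measure_sphere_measure]
      by (intro integrable_mult_right Bochner_Integration.integrable_add) (auto simp: in_Lp_def)
    show "AE x in sphere_measure. norm (norm (f x - g x) powr p) \<le> norm (2 powr p * (norm (f x) powr p + B powr p))"
    proof (intro AE_I2)
      fix x :: "complex ^ 'm" assume "x \<in> space sphere_measure"
      then have "norm (f x - g x) powr p \<le> (norm (f x) + B) powr p"
        using B p by (intro powr_mono2) (auto intro!: order_trans[OF norm_triangle_ineq4] add_left_mono)
      also have "\<dots> \<le> 2 powr p * (norm (f x) powr p + B powr p)"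
        using B p by (intro powr_add_le) auto
      finally show "norm (norm (f x - g x) powr p) \<le> norm (2 powr p * (norm (f x) powr p + B powr p))"
        by simp
    qed
  qed measurable
  then show ?thesis by (simp add: in_Lp_def)
qed

text \<open>Pointwise \<open>y \<le> \<epsilon> + \<epsilon>^(1 - p) y^p\<close>, by comparing
  \<open>y\<close> with \<open>\<epsilon>\<close>. The free \<open>\<epsilon>\<close> lets
  convergence in L^p imply convergence in L^1.\<close>

lemma L1_le_Lp:
  fixes h :: "complex ^ 'm::finite \<Rightarrow> complex"
  assumes h: "in_Lp p h" and p: "1 \<le> p"
  shows "integrable sphere_measure h"
    and "0 < \<epsilon> \<Longrightarrow> (\<integral>x. norm (h x) \<partial>sphere_measure)
      \<le> \<epsilon> * measure (sphere_measure :: (complex ^ 'm) measure) (sphere 0 1) + \<epsilon> powr (1 - p) * (\<integral>x. norm (h x) powr p \<partial>sphere_measure)"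
proof -
  have meas: "h \<in> borel_measurable sphere_measure" and int_p: "integrable sphere_measure (\<lambda>x. norm (h x) powr p)"
    using h by (auto simp: in_Lp_def)
  note const = finite_measure.integrable_const[OF finite_measure_sphere_measure]
  have le: "norm (h x) \<le> \<epsilon> + \<epsilon> powr (1 - p) * norm (h x) powr p" if "0 < \<epsilon>" for \<epsilon> x
  proof (cases "norm (h x) \<le> \<epsilon>")
    case False
    then have "1 \<le> (norm (h x) / \<epsilon>) powr (p - 1)"
      using that p by (intro ge_one_powr_ge_zero) auto
    then have "norm (h x) * 1 \<le> norm (h x) * (norm (h x) / \<epsilon>) powr (p - 1)"
      by (intro mult_left_mono) auto
    also have "\<dots> = \<epsilon> powr (1 - p) * norm (h x) powr p"
    proof -
      have "norm (h x) * norm (h x) powr (p - 1) = norm (h x) powr p"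
        using powr_mult_base[of "norm (h x)" "p - 1"] by simp
      moreover have "1 / \<epsilon> powr (p - 1) = \<epsilon> powr (1 - p)"
        using powr_minus_divide[of \<epsilon> "p - 1"] by simp
      moreover have "norm (h x) * (norm (h x) / \<epsilon>) powr (p - 1) = (1 / \<epsilon> powr (p - 1)) * (norm (h x) * norm (h x) powr (p - 1))"
        using that by (simp add: powr_divide)
      ultimately show ?thesis by simp
    qed
    finally show ?thesis using that by simp
  next
    case True
    moreover have "0 \<le> \<epsilon> powr (1 - p) * norm (h x) powr p" by simp
    ultimately show ?thesis by linarith
  qed
  show int: "integrable sphere_measure h"
  proof (rule Bochner_Integration.integrable_bound[OF _ meas])
    show "integrable sphere_measure (\<lambda>x. 1 + 1 powr (1 - p) * norm (h x) powr p)"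
      by (intro Bochner_Integration.integrable_add const integrable_mult_right int_p)
    show "AE x in sphere_measure. norm (h x) \<le> norm (1 + 1 powr (1 - p) * norm (h x) powr p)"
      using le[of 1] by (intro AE_I2) (simp add: abs_of_nonneg)
  qed
  show "(\<integral>x. norm (h x) \<partial>sphere_measure)
      \<le> \<epsilon> * measure (sphere_measure :: (complex ^ 'm) measure) (sphere 0 1) + \<epsilon> powr (1 - p) * (\<integral>x. norm (h x) powr p \<partial>sphere_measure)" if "0 < \<epsilon>"
  proof -
    have "(\<integral>x. norm (h x) \<partial>sphere_measure) \<le> (\<integral>x. \<epsilon> + \<epsilon> powr (1 - p) * norm (h x) powr p \<partial>sphere_measure)"
      using int le[OF that] by (intro integral_mono Bochner_Integration.integrable_add const integrable_mult_right int_p) auto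
    also have "\<dots> = \<epsilon> * measure (sphere_measure :: (complex ^ 'm) measure) (sphere 0 1) + \<epsilon> powr (1 - p) * (\<integral>x. norm (h x) powr p \<partial>sphere_measure)"
      using int_p const by (subst Bochner_Integration.integral_add) (auto simp: mult.commute)
    finally show ?thesis .
  qed
qed

text \<open>The errors of an element of the ball algebra and of its uniform polynomial approximation
  are added with \<open>powr_add_le\<close>. Working with integrals of powers instead of
  \<open>Lp_norm\<close> avoids the triangle inequality in L^p.\<close>

lemma hardy_poly_approx:
  fixes f :: "complex ^ 'm::finite \<Rightarrow> complex"
  assumes f: "f \<in> hardy p" and p: "1 \<le> p" and "0 < e"
  shows "\<exists>Q\<in>poly_fun. (\<integral>x. norm (f x - Q x) powr p \<partial>sphere_measure) < e"
proof -
  define S where "S = measure (sphere_measure :: (complex ^ 'm) measure) (sphere 0 1)"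
  have "0 \<le> S" by (simp add: S_def)
  \<comment> \<open>So small that the final bound \<open>2 powr p * (D + D * S)\<close> is less than
    \<open>e\<close>.\<close>
  define D where "D = e / (2 powr p * (1 + S) + 1)"
  have denom: "0 < 2 powr p * (1 + S) + 1"
    using \<open>0 \<le> S\<close> by (intro add_nonneg_pos mult_nonneg_nonneg) auto
  then have "0 < D" using \<open>0 < e\<close> by (simp add: D_def)
  define \<delta> where "\<delta> = D powr (1 / p)"
  have \<delta>: "0 < \<delta>" "\<delta> powr p = D"
    using \<open>0 < D\<close> p by (auto simp: \<delta>_def powr_powr)
  have inLp: "in_Lp p f" using f by (simp add: hardy_def)
  obtain g where g: "g \<in> ball_algebra" "Lp_norm p (\<lambda>x. f x - g x) < \<delta>"
    using f \<delta>(1) unfolding hardy_def by blast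
  have contg: "continuous_on (sphere 0 1) g"
    using g(1) by (simp add: ball_algebra_def)
  obtain Q where Q: "Q \<in> poly_fun" "\<And>z. z \<in> sphere 0 1 \<Longrightarrow> norm (g z - Q z) < \<delta>"
    using ball_algebra_poly_fun_approx[OF g(1) \<delta>(1)] by blast
  have int_fg: "integrable sphere_measure (\<lambda>x. norm (f x - g x) powr p)"
    and int_fQ: "integrable sphere_measure (\<lambda>x. norm (f x - Q x) powr p)"
    using in_Lp_diff_continuous[OF inLp] contg poly_fun_continuous[OF Q(1)] p by (auto simp: in_Lp_def)
  define I where "I = (\<integral>x. norm (f x - g x) powr p \<partial>sphere_measure)"
  have "0 \<le> I" by (simp add: I_def)
  have "I \<le> D"
  proof -
    have "(I powr (1 / p)) powr p < \<delta> powr p"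
      using g(2) p by (intro powr_less_mono2) (auto simp: Lp_norm_def I_def)
    then show ?thesis
      using p \<open>0 \<le> I\<close> by (simp add: powr_powr \<delta>(2))
  qed
  note const = finite_measure.integrable_const[OF finite_measure_sphere_measure]
  have "(\<integral>x. norm (f x - Q x) powr p \<partial>sphere_measure) \<le> (\<integral>x. 2 powr p * (norm (f x - g x) powr p + \<delta> powr p) \<partial>sphere_measure)"
  proof (rule integral_mono[OF int_fQ])
    show "integrable sphere_measure (\<lambda>x. 2 powr p * (norm (f x - g x) powr p + \<delta> powr p))"
      by (intro integrable_mult_right Bochner_Integration.integrable_add int_fg const)
    fix x :: "complex ^ 'm" assume "x \<in> space sphere_measure"
    then have "norm (f x - Q x) \<le> norm (f x - g x) + \<delta>"
      using Q(2)[of x] norm_triangle_ineq[of "f x - g x" "g x - Q x"] by simp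
    then have "norm (f x - Q x) powr p \<le> (norm (f x - g x) + \<delta>) powr p"
      using p by (intro powr_mono2) auto
    also have "\<dots> \<le> 2 powr p * (norm (f x - g x) powr p + \<delta> powr p)"
      using \<delta> p by (intro powr_add_le) auto
    finally show "norm (f x - Q x) powr p \<le> 2 powr p * (norm (f x - g x) powr p + \<delta> powr p)" .
  qed
  also have "\<dots> = 2 powr p * (I + D * S)"
  proof -
    have "(\<integral>x. norm (f x - g x) powr p + \<delta> powr p \<partial>sphere_measure) = I + D * S"
      unfolding I_def \<delta>(2) using int_fg const
      by (subst Bochner_Integration.integral_add) (auto simp: S_def mult.commute)
    then show ?thesis by simp
  qed
  also have "\<dots> \<le> 2 powr p * (D + D * S)"
    using \<open>I \<le> D\<close> by simp
  also have "\<dots> < e"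
  proof -
    have "2 powr p * (D + D * S) = D * (2 powr p * (1 + S))"
      by (simp add: algebra_simps)
    also have "\<dots> < D * (2 powr p * (1 + S) + 1)"
      using \<open>0 < D\<close> by (intro mult_strict_left_mono) auto
    also have "\<dots> = e" using denom by (simp add: D_def)
    finally show ?thesis .
  qed
  finally show ?thesis using Q(1) by blast
qed

text \<open>Convergence of p-th powers carries the norm inequality to the limit; convergence in L^1
  carries the pairings and the coefficients of \<open>hproj\<close>.\<close>

lemma hardy_approx_sequence:
  fixes f :: "complex ^ 'm::finite \<Rightarrow> complex"
  assumes f: "f \<in> hardy p" and p: "1 \<le> p"
  obtains Q where "\<And>n::nat. Q n \<in> poly_fun"
    "(\<lambda>n. \<integral>x. norm (f x - Q n x) powr p \<partial>sphere_measure) \<longlonglongrightarrow> 0"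
    "(\<lambda>n. \<integral>x. norm (f x - Q n x) \<partial>sphere_measure) \<longlonglongrightarrow> 0"
proof -
  define S where "S = measure (sphere_measure :: (complex ^ 'm) measure) (sphere 0 1)"
  have "\<exists>Q\<in>poly_fun. (\<integral>x. norm (f x - Q x) powr p \<partial>sphere_measure) < 1 / real (Suc n)" for n
    by (rule hardy_poly_approx[OF f p]) simp
  then obtain Q where Q: "\<And>n. Q n \<in> poly_fun" "\<And>n. (\<integral>x. norm (f x - Q n x) powr p \<partial>sphere_measure) < 1 / real (Suc n)"
    by metis
  have inLp: "in_Lp p f" using f by (simp add: hardy_def)
  have inLp_diff: "in_Lp p (\<lambda>x. f x - Q n x)" for n
    using p by (intro in_Lp_diff_continuous[OF inLp] poly_fun_continuous Q) simp
  have lim_p: "(\<lambda>n. \<integral>x. norm (f x - Q n x) powr p \<partial>sphere_measure) \<longlonglongrightarrow> 0"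
  proof (rule tendsto_sandwich[OF _ _ tendsto_const])
    show "(\<lambda>n. 1 / real (Suc n)) \<longlonglongrightarrow> 0"
      using LIMSEQ_inverse_real_of_nat by (simp add: inverse_eq_divide)
  qed (use Q(2) in \<open>auto intro!: always_eventually less_imp_le\<close>)
  moreover have "(\<lambda>n. \<integral>x. norm (f x - Q n x) \<partial>sphere_measure) \<longlonglongrightarrow> 0"
  proof (rule order_tendstoI)
    fix a :: real assume "a < 0"
    have "a < (\<integral>x. norm (f x - Q n x) \<partial>sphere_measure)" for n
      by (rule less_le_trans[OF \<open>a < 0\<close>]) simp
    then show "\<forall>\<^sub>F n in sequentially. a < (\<integral>x. norm (f x - Q n x) \<partial>sphere_measure)"
      by simp
  next
    fix a :: real assume "0 < a"
    \<comment> \<open>Makes the fixed term \<open>\<epsilon> * S\<close> of \<open>L1_le_Lp\<close>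
      at most \<open>a / 2\<close>, while the other term tends to 0.\<close>
    define \<epsilon> where "\<epsilon> = (a / 2) / (S + 1)"
    have "0 \<le> S" by (simp add: S_def)
    then have "0 < \<epsilon>" using \<open>0 < a\<close> by (simp add: \<epsilon>_def)
    have "\<epsilon> * S < a"
    proof -
      have "\<epsilon> * S \<le> \<epsilon> * (S + 1)" using \<open>0 < \<epsilon>\<close> by simp
      also have "\<epsilon> * (S + 1) = a / 2"
        unfolding \<epsilon>_def using \<open>0 \<le> S\<close> by (intro nonzero_eq_divide_eq[THEN iffD1] refl) simp
      also have "\<dots> < a" using \<open>0 < a\<close> by simp
      finally show ?thesis .
    qed
    have "(\<lambda>n. \<epsilon> * S + \<epsilon> powr (1 - p) * (\<integral>x. norm (f x - Q n x) powr p \<partial>sphere_measure)) \<longlonglongrightarrow> \<epsilon> * S + \<epsilon> powr (1 - p) * 0"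
      by (intro tendsto_intros lim_p)
    then have "\<forall>\<^sub>F n in sequentially. \<epsilon> * S + \<epsilon> powr (1 - p) * (\<integral>x. norm (f x - Q n x) powr p \<partial>sphere_measure) < a"
      using \<open>\<epsilon> * S < a\<close> by (intro order_tendstoD(2)) auto
    then show "\<forall>\<^sub>F n in sequentially. (\<integral>x. norm (f x - Q n x) \<partial>sphere_measure) < a"
    proof (rule eventually_mono)
      fix n assume "\<epsilon> * S + \<epsilon> powr (1 - p) * (\<integral>x. norm (f x - Q n x) powr p \<partial>sphere_measure) < a"
      then show "(\<integral>x. norm (f x - Q n x) \<partial>sphere_measure) < a"
        using L1_le_Lp(2)[OF inLp_diff p \<open>0 < \<epsilon>\<close>, of n] unfolding S_def by linarith
    qed
  qed
  ultimately show ?thesis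
    using that Q(1) by blast
qed

lemma sphere_ip_diff_le:
  fixes f g Y :: "complex ^ 'm::finite \<Rightarrow> complex"
  assumes "integrable sphere_measure f" "integrable sphere_measure g" and Y: "continuous_on (sphere 0 1) Y"
    and B: "\<And>x. x \<in> sphere 0 1 \<Longrightarrow> norm (Y x) \<le> B"
  shows "norm (sphere_ip f Y - sphere_ip g Y) \<le> B * (\<integral>x. norm (f x - g x) \<partial>sphere_measure)"
proof -
  have int: "integrable sphere_measure (\<lambda>x. h x * cnj (Y x))" if "integrable sphere_measure h" for h
  proof (rule Bochner_Integration.integrable_bound)
    show "integrable sphere_measure (\<lambda>x. B * norm (h x))"
      using that by (intro integrable_mult_right integrable_norm)
    have "(\<lambda>x. cnj (Y x)) \<in> borel_measurable sphere_measure"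
      by (intro sphere_measurable_continuous continuous_intros Y)
    then show "(\<lambda>x. h x * cnj (Y x)) \<in> borel_measurable sphere_measure"
      using that by (intro borel_measurable_times) auto
    show "AE x in sphere_measure. norm (h x * cnj (Y x)) \<le> norm (B * norm (h x))"
    proof (intro AE_I2)
      fix x :: "complex ^ 'm" assume "x \<in> space sphere_measure"
      then have "norm (Y x) \<le> \<bar>B\<bar>" using B[of x] by simp
      then show "norm (h x * cnj (Y x)) \<le> norm (B * norm (h x))"
        by (simp add: norm_mult abs_mult mult.commute mult_right_mono)
    qed
  qed
  have "sphere_ip f Y - sphere_ip g Y = (\<integral>x. (f x - g x) * cnj (Y x) \<partial>sphere_measure)"
    unfolding sphere_ip_def using int assms(1,2)
    by (subst Bochner_Integration.integral_diff[symmetric]) (auto simp: left_diff_distrib)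
  also have "norm \<dots> \<le> (\<integral>x. norm ((f x - g x) * cnj (Y x)) \<partial>sphere_measure)"
    by (rule integral_norm_bound)
  also have "\<dots> \<le> (\<integral>x. B * norm (f x - g x) \<partial>sphere_measure)"
  proof (rule integral_mono)
    show "integrable sphere_measure (\<lambda>x. norm ((f x - g x) * cnj (Y x)))"
      using assms(1,2) by (intro integrable_norm int Bochner_Integration.integrable_diff)
    show "integrable sphere_measure (\<lambda>x. B * norm (f x - g x))"
      using assms(1,2) by (intro integrable_mult_right integrable_norm Bochner_Integration.integrable_diff)
    fix x :: "complex ^ 'm" assume "x \<in> space sphere_measure"
    then show "norm ((f x - g x) * cnj (Y x)) \<le> B * norm (f x - g x)"
      using B[of x] by (simp add: norm_mult mult.commute mult_right_mono)
  qed
  finally show ?thesis by simp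
qed

text \<open>Finitely many coefficients, each a pairing with a function bounded by 1 on the sphere.
  \<open>C\<close> depends on \<open>N\<close>, so this serves passages to the limit and not the
  uniform bounds.\<close>

lemma hproj_diff_le:
  fixes N :: nat
  defines "C \<equiv> (\<Sum>\<alpha> | mdeg (\<alpha> :: 'm::finite \<Rightarrow> nat) \<le> N. 1 / znorm2 \<alpha>)"
  assumes "integrable sphere_measure f" "integrable sphere_measure g" "z \<in> sphere (0 :: complex ^ 'm) 1"
  shows "norm (hproj N f z - hproj N g z) \<le> C * (\<integral>x. norm (f x - g x) \<partial>sphere_measure)"
proof -
  have "hproj N f z - hproj N g z = (\<Sum>\<alpha> | mdeg \<alpha> \<le> N. (sphere_ip f (zmonom \<alpha>) - sphere_ip g (zmonom \<alpha>)) / of_real (znorm2 \<alpha>) * zmonom \<alpha> z)"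
    by (simp add: hproj_def sum_subtractf diff_divide_distrib left_diff_distrib)
  also have "norm \<dots> \<le> (\<Sum>\<alpha> | mdeg (\<alpha> :: 'm \<Rightarrow> nat) \<le> N. 1 / znorm2 \<alpha> * (\<integral>x. norm (f x - g x) \<partial>sphere_measure))"
  proof (intro sum_norm_le)
    fix \<alpha> :: "'m \<Rightarrow> nat"
    have unit: "norm (zmonom \<alpha> x) \<le> 1" if "x \<in> sphere 0 1" for x
      using that by (intro norm_zmonom_le_1) simp
    have "norm (sphere_ip f (zmonom \<alpha>) - sphere_ip g (zmonom \<alpha>)) \<le> 1 * (\<integral>x. norm (f x - g x) \<partial>sphere_measure)"
      using assms unit by (intro sphere_ip_diff_le continuous_on_zmonom) auto
    then have "norm (sphere_ip f (zmonom \<alpha>) - sphere_ip g (zmonom \<alpha>)) * norm (zmonom \<alpha> z) \<le> (\<integral>x. norm (f x - g x) \<partial>sphere_measure) * 1"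
      using unit[OF assms(4)] by (intro mult_mono) auto
    then show "norm ((sphere_ip f (zmonom \<alpha>) - sphere_ip g (zmonom \<alpha>)) / of_real (znorm2 \<alpha>) * zmonom \<alpha> z)
       \<le> 1 / znorm2 \<alpha> * (\<integral>x. norm (f x - g x) \<partial>sphere_measure)"
      using znorm2_pos[of \<alpha>] by (simp add: norm_mult norm_divide divide_right_mono)
  qed
  also have "\<dots> = C * (\<integral>x. norm (f x - g x) \<partial>sphere_measure)"
    by (simp add: C_def sum_distrib_right)
  finally show ?thesis .
qed

lemma hproj_limit:
  fixes f :: "complex ^ 'm::finite \<Rightarrow> complex"
  assumes f: "integrable sphere_measure f" and Q: "\<And>n. integrable sphere_measure (Q n)"
    and lim: "(\<lambda>n. \<integral>x. norm (f x - Q n x) \<partial>sphere_measure) \<longlonglongrightarrow> 0"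
    and z: "z \<in> sphere 0 1"
  shows "(\<lambda>n. hproj N (Q n) z) \<longlonglongrightarrow> hproj N f z"
proof -
  define C where "C = (\<Sum>\<alpha> | mdeg (\<alpha> :: 'm \<Rightarrow> nat) \<le> N. 1 / znorm2 \<alpha>)"
  have "(\<lambda>n. C * (\<integral>x. norm (f x - Q n x) \<partial>sphere_measure)) \<longlonglongrightarrow> C * 0"
    by (intro tendsto_intros lim)
  then have null: "(\<lambda>n. C * (\<integral>x. norm (f x - Q n x) \<partial>sphere_measure)) \<longlonglongrightarrow> 0"
    by simp
  have le: "norm (hproj N f z - hproj N (Q n) z) \<le> C * (\<integral>x. norm (f x - Q n x) \<partial>sphere_measure)" for n
    unfolding C_def by (rule hproj_diff_le[OF f Q z])
  have "(\<lambda>n. hproj N f z - hproj N (Q n) z) \<longlonglongrightarrow> 0"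
    by (rule Lim_null_comparison[OF _ null]) (simp add: le)
  from tendsto_diff[OF tendsto_const[of "hproj N f z"] this] show ?thesis by simp
qed

text \<open>At fixed \<open>N\<close> the projections converge at every point of the sphere and are
  uniformly bounded there, so dominated convergence on a finite measure applies to any continuous
  \<open>G\<close>.\<close>

lemma hproj_integral_limit:
  fixes G :: "real \<Rightarrow> real" and f :: "complex ^ 'm::finite \<Rightarrow> complex"
  assumes G: "continuous_on {0..} G"
    and f: "integrable sphere_measure f" and Q: "\<And>n. integrable sphere_measure (Q n)"
    and lim: "(\<lambda>n. \<integral>x. norm (f x - Q n x) \<partial>sphere_measure) \<longlonglongrightarrow> 0"
  shows "(\<lambda>n. \<integral>x. G (norm (hproj N (Q n) x)) \<partial>sphere_measure) \<longlonglongrightarrow> (\<integral>x. G (norm (hproj N f x)) \<partial>sphere_measure)"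
proof -
  define C where "C = (\<Sum>\<alpha> | mdeg (\<alpha> :: 'm \<Rightarrow> nat) \<le> N. 1 / znorm2 \<alpha>)"
  have "0 \<le> C" unfolding C_def by (intro sum_nonneg divide_nonneg_nonneg less_imp_le[OF znorm2_pos]) simp
  obtain L where L: "\<And>n. norm (\<integral>x. norm (f x - Q n x) \<partial>sphere_measure) \<le> L"
    using convergent_imp_Bseq[OF convergentI[OF lim]] unfolding Bseq_def by blast
  obtain A where A: "0 \<le> A" "\<And>x. x \<in> sphere 0 1 \<Longrightarrow> norm (hproj N f x) \<le> A"
    using sphere_bounded_continuous[OF continuous_on_hproj] by blast
  have bound: "norm (hproj N (Q n) x) \<le> A + C * L" if "x \<in> sphere 0 1" for n x
  proof -
    have "norm (hproj N f x - hproj N (Q n) x) \<le> C * (\<integral>x. norm (f x - Q n x) \<partial>sphere_measure)"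
      unfolding C_def by (rule hproj_diff_le[OF f Q that])
    also have "\<dots> \<le> C * L"
      using L[of n] \<open>0 \<le> C\<close> by (intro mult_left_mono) auto
    finally show ?thesis
      using A(2)[OF that] norm_triangle_ineq2[of "hproj N (Q n) x" "hproj N f x"] by (simp add: norm_minus_commute)
  qed
  have "bounded (G ` {0..A + C * L})"
    by (intro compact_imp_bounded compact_continuous_image continuous_on_subset[OF G]) auto
  then obtain B where B: "\<And>r. r \<in> {0..A + C * L} \<Longrightarrow> norm (G r) \<le> B"
    unfolding bounded_iff by blast
  have cont: "continuous_on (sphere 0 1) (\<lambda>x. G (norm (hproj N h x)))" for h
    by (rule continuous_on_compose2[OF G]) (auto intro!: continuous_on_norm continuous_on_hproj)
  show ?thesis
  proof (rule integral_dominated_convergence[where w = "\<lambda>_. B"])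
    show "integrable sphere_measure (\<lambda>_::complex ^ 'm. B)"
      by (rule finite_measure.integrable_const[OF finite_measure_sphere_measure])
    show "AE x in sphere_measure. (\<lambda>n. G (norm (hproj N (Q n) x))) \<longlonglongrightarrow> G (norm (hproj N f x))"
    proof (intro AE_I2)
      fix x :: "complex ^ 'm" assume "x \<in> space sphere_measure"
      then have "(\<lambda>n. norm (hproj N (Q n) x)) \<longlonglongrightarrow> norm (hproj N f x)"
        by (intro tendsto_norm hproj_limit[OF f Q lim]) simp
      then show "(\<lambda>n. G (norm (hproj N (Q n) x))) \<longlonglongrightarrow> G (norm (hproj N f x))"
        by (rule continuous_on_tendsto_compose[OF G]) auto
    qed
    show "AE x in sphere_measure. norm (G (norm (hproj N (Q n) x))) \<le> B" for n
      using bound by (intro AE_I2 B) auto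
  qed (intro sphere_measurable_continuous cont)+
qed

section \<open>Spectral spaces and the identification of \<open>riesz0\<close> with
  truncation\<close>

lemma spec_space_eigenfun:
  assumes "LB_eigenfun Y \<mu>" "0 \<le> \<mu>" "\<mu> \<le> R"
  shows "(\<lambda>x. c * Y x) \<in> spec_space R"
  unfolding spec_space_def mem_Collect_eq
  by (rule exI[of _ "1 :: nat"], rule exI[of _ "\<lambda>_. c"], rule exI[of _ "\<lambda>_. Y"], rule exI[of _ "\<lambda>_. \<mu>"]) (simp add: assms)

lemma spec_space_add:
  fixes g h :: "complex ^ 'm::finite \<Rightarrow> complex"
  assumes "g \<in> spec_space R" "h \<in> spec_space R"
  shows "(\<lambda>x. g x + a * h x) \<in> spec_space R"
proof -
  obtain n :: nat and c :: "nat \<Rightarrow> complex" and Y :: "nat \<Rightarrow> complex ^ 'm \<Rightarrow> complex" and \<mu> :: "nat \<Rightarrow> real" where g: "\<And>i. i < n \<Longrightarrow> 0 \<le> \<mu> i \<and> \<mu> i \<le> R \<and> LB_eigenfun (Y i) (\<mu> i)"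
    "g = (\<lambda>x. \<Sum>i<n. c i * Y i x)"
    using assms(1) unfolding spec_space_def by blast
  obtain m :: nat and d :: "nat \<Rightarrow> complex" and Z :: "nat \<Rightarrow> complex ^ 'm \<Rightarrow> complex" and \<nu> :: "nat \<Rightarrow> real" where h: "\<And>i. i < m \<Longrightarrow> 0 \<le> \<nu> i \<and> \<nu> i \<le> R \<and> LB_eigenfun (Z i) (\<nu> i)"
    "h = (\<lambda>x. \<Sum>i<m. d i * Z i x)"
    using assms(2) unfolding spec_space_def by blast
  \<comment> \<open>The two families are concatenated, the second one shifted by
    \<open>n\<close>.\<close>
  define c' where "c' i = (if i < n then c i else a * d (i - n))" for i
  define Y' where "Y' i = (if i < n then Y i else Z (i - n))" for i
  define \<mu>' where "\<mu>' i = (if i < n then \<mu> i else \<nu> (i - n))" for i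
  have "(\<Sum>i<n + k. c' i * Y' i x) = (\<Sum>i<n. c i * Y i x) + a * (\<Sum>i<k. d i * Z i x)" for k x
    by (induction k) (simp_all add: c'_def Y'_def algebra_simps)
  then have "(\<lambda>x. g x + a * h x) = (\<lambda>x. \<Sum>i<n + m. c' i * Y' i x)"
    by (simp add: g(2) h(2))
  moreover have "\<forall>i<n + m. 0 \<le> \<mu>' i \<and> \<mu>' i \<le> R \<and> LB_eigenfun (Y' i) (\<mu>' i)"
    using g(1) h(1) by (auto simp: \<mu>'_def Y'_def)
  ultimately show ?thesis
    unfolding spec_space_def by blast
qed

lemma spec_space_sum:
  assumes "finite I" "\<And>i. i \<in> I \<Longrightarrow> f i \<in> spec_space R"
  shows "(\<lambda>x. \<Sum>i\<in>I. f i x) \<in> spec_space R"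
  using assms
proof (induction I rule: finite_induct)
  case empty
  show ?case
    unfolding spec_space_def by (intro CollectI exI[of _ 0]) auto
next
  case (insert i I)
  then show ?case
    using spec_space_add[of "f i" R "\<lambda>x. \<Sum>i\<in>I. f i x" 1] by simp
qed

lemma spec_space_props:
  fixes g :: "complex ^ 'm::finite \<Rightarrow> complex"
  assumes "g \<in> spec_space R"
  shows "continuous_on (sphere 0 1) g" "x \<notin> sphere 0 1 \<Longrightarrow> g x = 0"
proof -
  obtain n :: nat and c :: "nat \<Rightarrow> complex" and Y :: "nat \<Rightarrow> complex ^ 'm \<Rightarrow> complex" and \<mu> :: "nat \<Rightarrow> real" where g: "\<And>i. i < n \<Longrightarrow> 0 \<le> \<mu> i \<and> \<mu> i \<le> R \<and> LB_eigenfun (Y i) (\<mu> i)"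
    "g = (\<lambda>x. \<Sum>i<n. c i * Y i x)"
    using assms unfolding spec_space_def by blast
  show "continuous_on (sphere 0 1) g"
    unfolding g(2) using g(1) by (intro continuous_intros LB_eigenfun_ext(4)) auto
  show "g x = 0" if "x \<notin> sphere 0 1"
    unfolding g(2) using g(1) that unfolding LB_eigenfun_def by (intro sum.neutral) auto
qed

lemma sphere_ip_spec_space:
  fixes f Y :: "complex ^ 'm::finite \<Rightarrow> complex"
  assumes "Y \<in> spec_space R" and f: "continuous_on (sphere 0 1) f"
    and "\<And>Z \<mu>. LB_eigenfun Z \<mu> \<Longrightarrow> \<mu> \<le> R \<Longrightarrow> sphere_ip f Z = 0"
  shows "sphere_ip f Y = 0"
proof -
  obtain n :: nat and c :: "nat \<Rightarrow> complex" and Z :: "nat \<Rightarrow> complex ^ 'm \<Rightarrow> complex" and \<mu> :: "nat \<Rightarrow> real" where Y: "\<And>i. i < n \<Longrightarrow> 0 \<le> \<mu> i \<and> \<mu> i \<le> R \<and> LB_eigenfun (Z i) (\<mu> i)"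
    "Y = (\<lambda>x. \<Sum>i<n. c i * Z i x)"
    using assms(1) unfolding spec_space_def by blast
  have "sphere_ip f Y = (\<integral>x. (\<Sum>i<n. cnj (c i) * (f x * cnj (Z i x))) \<partial>sphere_measure)"
    by (simp add: sphere_ip_def Y(2) cnj_sum sum_distrib_left mult_ac)
  also have "\<dots> = (\<Sum>i<n. \<integral>x. cnj (c i) * (f x * cnj (Z i x)) \<partial>sphere_measure)"
    using Y(1) f LB_eigenfun_ext(4)
    by (intro Bochner_Integration.integral_sum sphere_integrable_continuous continuous_intros) blast+
  also have "\<dots> = (\<Sum>i<n. cnj (c i) * sphere_ip f (Z i))"
    by (simp add: sphere_ip_def)
  also have "\<dots> = 0"
    using Y(1) assms(3) by (intro sum.neutral) auto
  finally show ?thesis .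
qed

text \<open>The eigenvalue of \<open>zmonom \<alpha>\<close> exceeds \<open>R\<close>, hence differs
  from that of every generator of \<open>spec_space R\<close>, holomorphic or not.\<close>

lemma sphere_ip_zmonom_high:
  fixes \<alpha> :: "'m::finite \<Rightarrow> nat"
  assumes "Y \<in> spec_space R" "R < real (mdeg \<alpha>) * (real (mdeg \<alpha>) + 2 * real CARD('m) - 2)"
  shows "sphere_ip (zmonom \<alpha>) Y = 0"
proof (rule sphere_ip_spec_space[OF assms(1) continuous_on_zmonom])
  fix Z :: "complex ^ 'm \<Rightarrow> complex" and \<mu>
  assume "LB_eigenfun Z \<mu>" "\<mu> \<le> R"
  then have "(\<integral>x. (if x \<in> sphere 0 1 then zmonom \<alpha> x else 0) * cnj (Z x) \<partial>sphere_measure) = 0"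
    using assms(2) by (intro LB_eigenfun_orthogonal[OF LB_eigenfun_zmonom LB_eigenfun_cnj]) auto
  then show "sphere_ip (zmonom \<alpha>) Z = 0"
    unfolding sphere_ip_def by (subst (asm) Bochner_Integration.integral_cong[OF refl]) auto
qed

text \<open>The eigenvalue \<open>k (k + 2 m - 2)\<close> is monotone in \<open>k\<close> and at
  least \<open>k\<close>, so the degrees with eigenvalue at most \<open>R\<close> form a finite
  initial segment, which contains 0 because \<open>0 < R\<close>.\<close>

lemma cutoff_degree_exists:
  fixes R :: real and m :: nat
  assumes "0 < R" "1 \<le> m"
  obtains N :: nat where "\<And>k::nat. k \<le> N \<longleftrightarrow> real k * (real k + 2 * real m - 2) \<le> R"
proof -
  define ev where "ev k = real k * (real k + 2 * real m - 2)" for k :: nat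
  have "1 \<le> real m" using assms by simp
  have mono_ev: "ev j \<le> ev k" if "j \<le> k" for j k
    unfolding ev_def using that \<open>1 \<le> real m\<close> by (intro mult_mono) auto
  have "finite {k. ev k \<le> R}"
  proof (rule finite_subset)
    show "{k. ev k \<le> R} \<subseteq> {..nat \<lceil>R\<rceil> + 1}"
    proof
      fix k assume "k \<in> {k. ev k \<le> R}"
      moreover have "real k \<le> ev k"
      proof (cases "k = 0")
        case False
        then have "real k * 1 \<le> real k * (real k + 2 * real m - 2)"
          using \<open>1 \<le> real m\<close> by (intro mult_left_mono) linarith+
        then show ?thesis by (simp add: ev_def)
      qed (simp add: ev_def)
      ultimately show "k \<in> {..nat \<lceil>R\<rceil> + 1}" by simp linarith
    qed
  qed simp
  moreover have "0 \<in> {k. ev k \<le> R}" using assms by (simp add: ev_def)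
  ultimately have "Max {k. ev k \<le> R} \<in> {k. ev k \<le> R}" "\<And>k. k \<in> {k. ev k \<le> R} \<Longrightarrow> k \<le> Max {k. ev k \<le> R}"
    using Max_in[of "{k. ev k \<le> R}"] Max_ge[of "{k. ev k \<le> R}"] by blast+
  then have "k \<le> Max {k. ev k \<le> R} \<longleftrightarrow> ev k \<le> R" for k
    using mono_ev order_trans by blast
  then show ?thesis
    using that unfolding ev_def by blast
qed

text \<open>Existence: on polynomials the pairings agree because the discarded monomials are
  orthogonal to all of \<open>spec_space R\<close>, and both pairings are continuous in L^1.
  Uniqueness: the difference of two solutions lies in \<open>spec_space R\<close> and is orthogonal
  to itself.\<close>

lemma riesz0_eq_hproj:
  fixes f :: "complex ^ 'm::finite \<Rightarrow> complex"
  assumes f: "f \<in> hardy p" and p: "1 \<le> p"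
    and N: "\<And>k::nat. k \<le> N \<longleftrightarrow> real k * (real k + 2 * real CARD('m) - 2) \<le> R"
  shows "riesz0 R f = (\<lambda>x. if x \<in> sphere 0 1 then hproj N f x else 0)"
proof -
  \<comment> \<open>Extended by 0, since elements of \<open>spec_space R\<close> vanish off the
    sphere and \<open>THE\<close> asks for equality on the whole space.\<close>
  define g where "g x = (if x \<in> sphere 0 1 then hproj N f x else 0)" for x
  have g_spec: "g \<in> spec_space R"
  proof -
    have "(\<lambda>x. sphere_ip f (zmonom \<alpha>) / of_real (znorm2 \<alpha>) * (if x \<in> sphere 0 1 then zmonom \<alpha> x else 0)) \<in> spec_space R"
      if "\<alpha> \<in> {\<alpha>. mdeg \<alpha> \<le> N}" for \<alpha>
    proof (rule spec_space_eigenfun[OF LB_eigenfun_zmonom])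
      have "1 \<le> real CARD('m)" by simp
      then show "0 \<le> real (mdeg \<alpha>) * (real (mdeg \<alpha>) + 2 * real CARD('m) - 2)"
        by (intro mult_nonneg_nonneg) linarith+
      show "real (mdeg \<alpha>) * (real (mdeg \<alpha>) + 2 * real CARD('m) - 2) \<le> R"
        using N[of "mdeg \<alpha>"] that by simp
    qed
    from spec_space_sum[OF finite_mdeg_le this]
    have "(\<lambda>x. \<Sum>\<alpha> | mdeg \<alpha> \<le> N. sphere_ip f (zmonom \<alpha>) / of_real (znorm2 \<alpha>) * (if x \<in> sphere 0 1 then zmonom \<alpha> x else 0)) \<in> spec_space R" .
    moreover have "(\<lambda>x. \<Sum>\<alpha> | mdeg \<alpha> \<le> N. sphere_ip f (zmonom \<alpha>) / of_real (znorm2 \<alpha>) * (if x \<in> sphere 0 1 then zmonom \<alpha> x else 0)) = g"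
      by (rule ext) (simp add: g_def hproj_def)
    ultimately show ?thesis by simp
  qed
  have inLp: "in_Lp p f" using f by (simp add: hardy_def)
  have int_f: "integrable sphere_measure f"
    by (rule L1_le_Lp(1)[OF inLp p])
  obtain Q where Q: "\<And>n::nat. Q n \<in> poly_fun"
    "(\<lambda>n. \<integral>x. norm (f x - Q n x) \<partial>sphere_measure) \<longlonglongrightarrow> 0"
    using hardy_approx_sequence[OF f p] by blast
  have int_Q: "integrable sphere_measure (Q n)" for n
    by (intro sphere_integrable_continuous poly_fun_continuous Q)
  have int_P: "integrable sphere_measure (hproj N h)" for h :: "complex ^ 'm \<Rightarrow> complex"
    by (intro sphere_integrable_continuous continuous_on_hproj)
  have pairing_Q: "sphere_ip (Q n) Y = sphere_ip (hproj N (Q n)) Y" if "Y \<in> spec_space R" for Y n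
  proof -
    obtain A c where A: "finite A" "\<And>z. Q n z = (\<Sum>\<alpha>\<in>A. c \<alpha> * zmonom \<alpha> z)"
      using Q(1)[of n] unfolding poly_fun_def by blast
    have Qn: "Q n = (\<lambda>z. \<Sum>\<alpha>\<in>A. c \<alpha> * zmonom \<alpha> z)"
      by (rule ext) (rule A(2))
    have contY: "continuous_on (sphere 0 1) Y"
      using that by (rule spec_space_props)
    have "hproj N (Q n) = (\<lambda>z. \<Sum>\<alpha>\<in>A. (if mdeg \<alpha> \<le> N then c \<alpha> else 0) * zmonom \<alpha> z)"
      unfolding Qn by (rule ext, subst hproj_poly[OF A(1)], intro sum.cong) auto
    then have "sphere_ip (hproj N (Q n)) Y = (\<Sum>\<alpha>\<in>A. (if mdeg \<alpha> \<le> N then c \<alpha> else 0) * sphere_ip (zmonom \<alpha>) Y)"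
      by (simp only: sphere_ip_sum_left[OF A(1) continuous_on_zmonom contY])
    also have "\<dots> = (\<Sum>\<alpha>\<in>A. c \<alpha> * sphere_ip (zmonom \<alpha>) Y)"
    proof (intro sum.cong refl)
      fix \<alpha>
      show "(if mdeg \<alpha> \<le> N then c \<alpha> else 0) * sphere_ip (zmonom \<alpha>) Y = c \<alpha> * sphere_ip (zmonom \<alpha>) Y"
        using sphere_ip_zmonom_high[OF that, of \<alpha>] N[of "mdeg \<alpha>"] by auto
    qed
    also have "\<dots> = sphere_ip (Q n) Y"
      by (simp only: Qn sphere_ip_sum_left[OF A(1) continuous_on_zmonom contY])
    finally show ?thesis by simp
  qed
  have pairing: "sphere_ip f Y = sphere_ip g Y" if Y: "Y \<in> spec_space R" for Y
  proof -
    have contY: "continuous_on (sphere 0 1) Y"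
      using Y by (rule spec_space_props)
    obtain B where B: "0 \<le> B" "\<And>x. x \<in> sphere 0 1 \<Longrightarrow> norm (Y x) \<le> B"
      using sphere_bounded_continuous[OF contY] by blast
    have conv: "(\<lambda>n. sphere_ip (q n) Y) \<longlonglongrightarrow> sphere_ip h Y"
      if "integrable sphere_measure h" "\<And>n. integrable sphere_measure (q n)" "(\<lambda>n. \<integral>x. norm (h x - q n x) \<partial>sphere_measure) \<longlonglongrightarrow> 0" for h q
    proof -
      have null: "(\<lambda>n. B * (\<integral>x. norm (h x - q n x) \<partial>sphere_measure)) \<longlonglongrightarrow> 0"
        using tendsto_mult_right_zero[OF that(3)] .
      have "(\<lambda>n. sphere_ip h Y - sphere_ip (q n) Y) \<longlonglongrightarrow> 0"
        using sphere_ip_diff_le[OF that(1,2) contY B(2)] by (intro Lim_null_comparison[OF _ null]) simp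
      from tendsto_diff[OF tendsto_const[of "sphere_ip h Y"] this] show ?thesis by simp
    qed
    have "(\<lambda>n. \<integral>x. norm (hproj N f x - hproj N (Q n) x) \<partial>sphere_measure) \<longlonglongrightarrow> 0"
    proof -
      define C where "C = (\<Sum>\<alpha> | mdeg (\<alpha> :: 'm \<Rightarrow> nat) \<le> N. 1 / znorm2 \<alpha>)"
      define S where "S = measure (sphere_measure :: (complex ^ 'm) measure) (sphere 0 1)"
      have le: "(\<integral>x. norm (hproj N f x - hproj N (Q n) x) \<partial>sphere_measure) \<le> S * (C * (\<integral>x. norm (f x - Q n x) \<partial>sphere_measure))" for n
      proof -
        have "(\<integral>x. norm (hproj N f x - hproj N (Q n) x) \<partial>sphere_measure)
           \<le> (\<integral>x. C * (\<integral>x. norm (f x - Q n x) \<partial>sphere_measure) \<partial>(sphere_measure :: (complex ^ 'm) measure))"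
          using hproj_diff_le[OF int_f int_Q] finite_measure.integrable_const[OF finite_measure_sphere_measure]
          by (intro integral_mono integrable_norm Bochner_Integration.integrable_diff int_P) (auto simp: C_def)
        then show ?thesis by (simp add: S_def)
      qed
      have null: "(\<lambda>n. S * (C * (\<integral>x. norm (f x - Q n x) \<partial>sphere_measure))) \<longlonglongrightarrow> 0"
        using tendsto_mult_right_zero[OF tendsto_mult_right_zero[OF Q(2)]] .
      show ?thesis
        using le by (intro Lim_null_comparison[OF _ null]) simp
    qed
    from conv[OF int_P int_P this]
    have "(\<lambda>n. sphere_ip (Q n) Y) \<longlonglongrightarrow> sphere_ip (hproj N f) Y"
      by (simp add: pairing_Q[OF Y])
    moreover have "(\<lambda>n. sphere_ip (Q n) Y) \<longlonglongrightarrow> sphere_ip f Y"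
      by (rule conv[OF int_f int_Q Q(2)])
    ultimately have "sphere_ip f Y = sphere_ip (hproj N f) Y"
      using LIMSEQ_unique by blast
    also have "\<dots> = sphere_ip g Y"
      unfolding sphere_ip_def by (intro Bochner_Integration.integral_cong) (auto simp: g_def)
    finally show ?thesis .
  qed
  have "riesz0 R f = g"
    unfolding riesz0_def sphere_ip_def[symmetric]
  proof (rule the_equality)
    show "g \<in> spec_space R \<and> (\<forall>Y\<in>spec_space R. sphere_ip f Y = sphere_ip g Y)"
      using g_spec pairing by blast
  next
    fix h assume h: "h \<in> spec_space R \<and> (\<forall>Y\<in>spec_space R. sphere_ip f Y = sphere_ip h Y)"
    define d where "d x = h x - g x" for x
    have d: "d \<in> spec_space R"
      using spec_space_add[of h R g "- 1"] h g_spec by (simp add: d_def[abs_def])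
    note cont = spec_space_props(1)[OF d] spec_space_props(1)[of h R] spec_space_props(1)[OF g_spec]
    have "sphere_ip d d = sphere_ip h d - sphere_ip g d"
    proof -
      have "integrable sphere_measure (\<lambda>x. h x * cnj (d x))" "integrable sphere_measure (\<lambda>x. g x * cnj (d x))"
        using cont h by (auto intro!: sphere_integrable_continuous continuous_intros)
      then have "sphere_ip h d - sphere_ip g d = (\<integral>x. h x * cnj (d x) - g x * cnj (d x) \<partial>sphere_measure)"
        unfolding sphere_ip_def by (rule Bochner_Integration.integral_diff[symmetric])
      also have "\<dots> = sphere_ip d d"
        unfolding sphere_ip_def by (intro Bochner_Integration.integral_cong refl) (simp only: d_def left_diff_distrib)
      finally show ?thesis by simp
    qed
    also have "\<dots> = 0"
      using h pairing d by auto
    finally have "(\<integral>x. (norm (d x))\<^sup>2 \<partial>sphere_measure) = 0"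
      unfolding sphere_ip_self by simp
    moreover have "continuous_on (sphere 0 1) (\<lambda>x. (norm (d x))\<^sup>2)"
      by (intro continuous_intros cont(1))
    ultimately have "d x = 0" if "x \<in> sphere 0 1" for x
      using sphere_integral_eq_0_imp[of "\<lambda>x. (norm (d x))\<^sup>2" x] that by simp
    then have "d x = 0" for x
      using spec_space_props(2)[OF d, of x] by blast
    then show "h = g"
      by (auto simp: d_def)
  qed
  then show ?thesis
    unfolding g_def[abs_def] .
qed

section \<open>The uniform strong and weak type bounds\<close>

lemma riesz0_Lp_bound:
  fixes p :: real
  assumes "1 < p"
  shows "\<exists>C. \<forall>R>0. \<forall>f \<in> (hardy p :: (complex ^ 'm::finite \<Rightarrow> complex) set). Lp_norm p (riesz0 R f) \<le> C * Lp_norm p f"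
proof -
  obtain C where "0 \<le> C" and C: "\<And>N Q. Q \<in> (poly_fun :: (complex ^ 'm \<Rightarrow> complex) set) \<Longrightarrow>
    (\<integral>z. norm (hproj N Q z) powr p \<partial>sphere_measure) \<le> C * (\<integral>z. norm (Q z) powr p \<partial>sphere_measure)"
    using hproj_Lp_poly[OF assms] by blast
  \<comment> \<open>The factor \<open>2 powr p\<close> comes from comparing \<open>Q n\<close> with
    \<open>f\<close> by \<open>powr_add_le\<close>; like \<open>C\<close>, it depends on
    \<open>p\<close> but not on \<open>R\<close>.\<close>
  have "Lp_norm p (riesz0 R f) \<le> (C * 2 powr p) powr (1 / p) * Lp_norm p f"
    if R: "0 < R" and f: "f \<in> hardy p" for R and f :: "complex ^ 'm \<Rightarrow> complex"
  proof -
    have p: "1 \<le> p" using assms by simp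
    have "1 \<le> CARD('m)" by simp
    then obtain N where N: "\<And>k::nat. k \<le> N \<longleftrightarrow> real k * (real k + 2 * real CARD('m) - 2) \<le> R"
      using cutoff_degree_exists[OF R] by blast
    note riesz = riesz0_eq_hproj[OF f p N]
    have inLp: "in_Lp p f" using f by (simp add: hardy_def)
    have int_f: "integrable sphere_measure f"
      by (rule L1_le_Lp(1)[OF inLp p])
    obtain Q where Q: "\<And>n::nat. Q n \<in> poly_fun"
      "(\<lambda>n. \<integral>x. norm (f x - Q n x) powr p \<partial>sphere_measure) \<longlonglongrightarrow> 0"
      "(\<lambda>n. \<integral>x. norm (f x - Q n x) \<partial>sphere_measure) \<longlonglongrightarrow> 0"
      using hardy_approx_sequence[OF f p] by blast
    have int_Q: "integrable sphere_measure (Q n)" for n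
      by (intro sphere_integrable_continuous poly_fun_continuous Q)
    define I where "I = (\<integral>x. norm (f x) powr p \<partial>sphere_measure)"
    have "0 \<le> I" by (simp add: I_def)
    have contG: "continuous_on {0..} (\<lambda>x::real. x powr p)"
      using assms by (intro continuous_on_powr' continuous_intros) auto
    have "(\<lambda>n. \<integral>x. norm (hproj N (Q n) x) powr p \<partial>sphere_measure) \<longlonglongrightarrow> (\<integral>x. norm (hproj N f x) powr p \<partial>sphere_measure)"
      by (rule hproj_integral_limit[OF contG int_f int_Q Q(3)])
    moreover have "(\<lambda>n. C * (2 powr p * (I + (\<integral>x. norm (f x - Q n x) powr p \<partial>sphere_measure)))) \<longlonglongrightarrow> C * (2 powr p * (I + 0))"
      by (intro tendsto_intros Q(2))
    moreover have "(\<integral>x. norm (hproj N (Q n) x) powr p \<partial>sphere_measure)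
        \<le> C * (2 powr p * (I + (\<integral>x. norm (f x - Q n x) powr p \<partial>sphere_measure)))" for n
    proof -
      have int_diff: "integrable sphere_measure (\<lambda>x. norm (f x - Q n x) powr p)" and int_fp: "integrable sphere_measure (\<lambda>x. norm (f x) powr p)"
        using in_Lp_diff_continuous[OF inLp poly_fun_continuous[OF Q(1)], of n] p inLp by (auto simp: in_Lp_def)
      have "(\<integral>x. norm (Q n x) powr p \<partial>sphere_measure) \<le> (\<integral>x. 2 powr p * (norm (f x) powr p + norm (f x - Q n x) powr p) \<partial>sphere_measure)"
      proof (rule integral_mono)
        show "integrable sphere_measure (\<lambda>x. norm (Q n x) powr p)"
          using assms by (intro sphere_integrable_continuous continuous_on_powr' continuous_intros poly_fun_continuous Q) auto
        show "integrable sphere_measure (\<lambda>x. 2 powr p * (norm (f x) powr p + norm (f x - Q n x) powr p))"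
          by (intro integrable_mult_right Bochner_Integration.integrable_add int_fp int_diff)
        fix x
        have "norm (Q n x) powr p \<le> (norm (f x) + norm (f x - Q n x)) powr p"
          using p norm_triangle_ineq4[of "f x" "f x - Q n x"] by (intro powr_mono2) auto
        also have "\<dots> \<le> 2 powr p * (norm (f x) powr p + norm (f x - Q n x) powr p)"
          using p by (intro powr_add_le) auto
        finally show "norm (Q n x) powr p \<le> 2 powr p * (norm (f x) powr p + norm (f x - Q n x) powr p)" .
      qed
      also have "\<dots> = 2 powr p * (I + (\<integral>x. norm (f x - Q n x) powr p \<partial>sphere_measure))"
        using int_fp int_diff by (simp add: I_def)
      finally show ?thesis
        using C[OF Q(1), of N n] \<open>0 \<le> C\<close> by (meson mult_left_mono order_trans)
    qed
    ultimately have "(\<integral>x. norm (hproj N f x) powr p \<partial>sphere_measure) \<le> C * (2 powr p * (I + 0))"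
      by (intro LIMSEQ_le) auto
    then have "(\<integral>x. norm (hproj N f x) powr p \<partial>sphere_measure) \<le> (C * 2 powr p) * I"
      by (simp add: mult_ac)
    moreover have "(\<integral>x. norm (riesz0 R f x) powr p \<partial>sphere_measure) = (\<integral>x. norm (hproj N f x) powr p \<partial>sphere_measure)"
      unfolding riesz by (intro Bochner_Integration.integral_cong) auto
    ultimately have "Lp_norm p (riesz0 R f) \<le> ((C * 2 powr p) * I) powr (1 / p)"
      unfolding Lp_norm_def using assms by (intro powr_mono2) auto
    also have "\<dots> = (C * 2 powr p) powr (1 / p) * Lp_norm p f"
      unfolding Lp_norm_def I_def by (rule powr_mult)
    finally show ?thesis .
  qed
  then show ?thesis by blast
qed

text \<open>The constant is \<open>2 * 8\<close>: the 8 is that of the circle estimate, and since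
  \<open>r / (1 + r) \<ge> 1 / 2\<close> for \<open>r \<ge> 1\<close>, \<open>2 * G\<close>
  majorizes the indicator of the level set.\<close>

lemma riesz0_weak_bound:
  fixes f :: "complex ^ 'm::finite \<Rightarrow> complex"
  assumes "0 < t" "0 < R" "f \<in> hardy 1"
  shows "emeasure sphere_measure {x \<in> space sphere_measure. norm (riesz0 R f x) > t} \<le> ennreal (16 * Lp_norm 1 f / t)"
proof -
  have "1 \<le> CARD('m)" by simp
  then obtain N where N: "\<And>k::nat. k \<le> N \<longleftrightarrow> real k * (real k + 2 * real CARD('m) - 2) \<le> R"
    using cutoff_degree_exists[OF \<open>0 < R\<close>] by blast
  note riesz = riesz0_eq_hproj[OF assms(3) order_refl N]
  have inLp: "in_Lp 1 f" using assms(3) by (simp add: hardy_def)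
  have int_f: "integrable sphere_measure f"
    by (rule L1_le_Lp(1)[OF inLp order_refl])
  obtain Q where Q: "\<And>n::nat. Q n \<in> poly_fun"
    "(\<lambda>n. \<integral>x. norm (f x - Q n x) \<partial>sphere_measure) \<longlonglongrightarrow> 0"
    using hardy_approx_sequence[OF assms(3) order_refl] by blast
  have int_Q: "integrable sphere_measure (Q n)" for n
    by (intro sphere_integrable_continuous poly_fun_continuous Q)
  define I where "I = (\<integral>x. norm (f x) \<partial>sphere_measure)"
  have I: "Lp_norm 1 f = I"
    by (simp add: Lp_norm_def I_def)
  define G where "G x = (x / t)\<^sup>2 / (1 + (x / t)\<^sup>2)" for x
  have contG: "continuous_on {0..} G"
    unfolding G_def[abs_def] using \<open>0 < t\<close> by (intro continuous_intros) (auto simp: add_nonneg_eq_0_iff)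
  have "(\<lambda>n. \<integral>x. G (norm (hproj N (Q n) x)) \<partial>sphere_measure) \<longlonglongrightarrow> (\<integral>x. G (norm (hproj N f x)) \<partial>sphere_measure)"
    by (rule hproj_integral_limit[OF contG int_f int_Q Q(2)])
  moreover have "(\<lambda>n. 8 * ((I + (\<integral>x. norm (f x - Q n x) \<partial>sphere_measure)) / t)) \<longlonglongrightarrow> 8 * ((I + 0) / t)"
    using \<open>0 < t\<close> by (intro tendsto_intros Q(2)) auto
  moreover have "(\<integral>x. G (norm (hproj N (Q n) x)) \<partial>sphere_measure) \<le> 8 * ((I + (\<integral>x. norm (f x - Q n x) \<partial>sphere_measure)) / t)" for n
  proof -
    have "(\<integral>x. norm (Q n x) \<partial>sphere_measure) \<le> (\<integral>x. norm (f x) + norm (f x - Q n x) \<partial>sphere_measure)"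
      using norm_triangle_ineq4[of "f x" "f x - Q n x" for x]
      by (intro integral_mono Bochner_Integration.integrable_add integrable_norm Bochner_Integration.integrable_diff int_f int_Q) simp
    also have "\<dots> = I + (\<integral>x. norm (f x - Q n x) \<partial>sphere_measure)"
      unfolding I_def by (intro Bochner_Integration.integral_add integrable_norm Bochner_Integration.integrable_diff int_f int_Q)
    finally have "(\<integral>x. norm (Q n x) / t \<partial>sphere_measure) \<le> (I + (\<integral>x. norm (f x - Q n x) \<partial>sphere_measure)) / t"
      using \<open>0 < t\<close> by (simp add: divide_right_mono)
    then show ?thesis
      using hproj_weak_poly[OF Q(1) \<open>0 < t\<close>, of N n] unfolding G_def by linarith
  qed
  ultimately have G_le: "(\<integral>x. G (norm (hproj N f x)) \<partial>sphere_measure) \<le> 8 * ((I + 0) / t)"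
    by (intro LIMSEQ_le) auto
  define E where "E = {x \<in> space sphere_measure. norm (riesz0 R f x) > t}"
  interpret S: finite_measure "sphere_measure :: (complex ^ 'm) measure"
    by (rule finite_measure_sphere_measure)
  have E_eq: "E = {x \<in> space sphere_measure. t < norm (hproj N f x)}"
    unfolding E_def riesz by auto
  have meas: "hproj N f \<in> borel_measurable sphere_measure"
    by (intro sphere_measurable_continuous continuous_on_hproj)
  then have E_sets: "E \<in> sets sphere_measure"
    unfolding E_eq by measurable
  have "measure sphere_measure E = (\<integral>x. indicator E x \<partial>sphere_measure)"
    using E_sets sets.sets_into_space[OF E_sets] by (simp add: Int_absorb2)
  also have "\<dots> \<le> (\<integral>x. 2 * G (norm (hproj N f x)) \<partial>sphere_measure)"
  proof (rule integral_mono)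
    show "integrable sphere_measure (indicator E :: complex ^ 'm \<Rightarrow> real)"
      using E_sets by (intro integrable_real_indicator) (auto simp: S.emeasure_finite less_top[symmetric])
    show "integrable sphere_measure (\<lambda>x. 2 * G (norm (hproj N f x)))"
      by (intro integrable_mult_right sphere_integrable_continuous continuous_on_compose2[OF contG])
        (auto intro!: continuous_on_norm continuous_on_hproj)
    fix x
    show "indicator E x \<le> 2 * G (norm (hproj N f x))"
    proof (cases "x \<in> E")
      case True
      define r where "r = (norm (hproj N f x) / t)\<^sup>2"
      have "1 \<le> norm (hproj N f x) / t"
        using True \<open>0 < t\<close> by (auto simp: E_eq)
      then have "1 \<le> r"
        unfolding r_def by (rule one_le_power)
      then have "1 \<le> 2 * (r / (1 + r))"
        by (simp add: field_simps)
      then show ?thesis using True by (simp add: G_def r_def)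
    qed (simp add: G_def)
  qed
  also have "\<dots> \<le> 16 * I / t"
    using G_le by simp
  finally have "ennreal (measure sphere_measure E) \<le> ennreal (16 * I / t)"
    by (rule ennreal_leI)
  then show ?thesis
    unfolding E_def[symmetric] I S.emeasure_eq_measure .
qed

theorem theorem3:
  assumes "CARD('m::finite) \<ge> 2"
  shows "(\<forall>p::real. 1 < p \<longrightarrow>
           (\<exists>C. \<forall>R>0. \<forall>f \<in> (hardy p :: (complex ^ 'm \<Rightarrow> complex) set).
               Lp_norm p (riesz0 R f) \<le> C * Lp_norm p f))
       \<and> (\<exists>C. \<forall>t>0. \<forall>R>0. \<forall>f \<in> (hardy 1 :: (complex ^ 'm \<Rightarrow> complex) set).
               emeasure sphere_measure {x \<in> space sphere_measure. norm (riesz0 R f x) > t}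
                 \<le> ennreal (C * Lp_norm 1 f / t))"
  using riesz0_Lp_bound riesz0_weak_bound by blast

end
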